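(* Let $k>0$, $\gamma>0$, $\kappa\in(0,1)$ and a positive integer $P$ be fixed, let $D=[0,1]^3$, let $N(x)=1/\gamma^3$, and let $h:D\to\mathbb{C}$ be a function with $\operatorname{Im}h\le 0$ such that $p(x):=4\pi h(x)N(x)\in C^2(D)$. Let $u$ be the solution of the integral equation $$u(x)+\int_D g(x,y)p(y)u(y)\,dy=u_0(x),\qquad x\in D .$$ For $M=(mP)^3$, $m=1,2,\dots$, let $x_1,\dots,x_M$ be the centers of the cubes of side length $1/(mP)$ partitioning $D$, let $a_{mP}\in(0,1/(mP))$ be the solution of $\frac{1}{mP}-2a_{mP}=\gamma a_{mP}^{(2-\kappa)/3}$, let $u_M:=(u(x_1),\dots,u(x_M))^T\in\mathbb{C}^M$, and, for $M$ sufficiently large, let $u_{e,M}=(u_e(x_1),\dots,u_e(x_M))^T\in\mathbb{C}^M$ be the solution of the linear algebraic system $$u_e(x_l)=u_0(x_l)-4\pi\sum_{j=1,\,j\ne l}^{M} g(x_l,x_j)h(x_j)\,a_{mP}^{2-\kappa}\,u_e(x_j),\qquad l=1,\dots,M .$$ Then $$\|u_M-u_{e,M}\|_{\mathbb{C}^M}=O\!\left(\frac{\log M}{M^{2/3}}+\bigl|1-\gamma^3 M a_{mP}^{2-\kappa}\bigr|\right)\qquad\text{as } M\to\infty .$$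
   Context: $g(x,y):=\dfrac{e^{ik|x-y|}}{4\pi|x-y|}$ for $x\ne y$ in $\mathbb{R}^3$. $u_0(x)=e^{ik\alpha\cdot x}$ with $\alpha\in\mathbb{R}^3$ a fixed unit vector is the incident plane wave. $\|v\|_{\mathbb{C}^M}:=\max_{1\le j\le M}|v_j|$. $M$ runs only over the numbers $(mP)^3$ with $P$ fixed and $m\to\infty$; the constant in $O(\cdot)$ is independent of $m$. Here $a_{mP}$ is the common radius of $M$ balls embedded in $D$, one centered at each $x_j$; the equation defining $a_{mP}$ has exactly one positive solution and says that the minimal distance between distinct balls is $\gamma a_{mP}^{(2-\kappa)/3}$. The integral equation is uniquely solvable, and the linear system is uniquely solvable for all sufficiently large $M$. *)

theory Defs
  imports "HOL-Analysis.Analysis" "HOL-Library.Landau_Symbols"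
begin

abbreviation unit_cube :: "(real^3) set" where
  "unit_cube \<equiv> cbox 0 1"

text \<open>On the diagonal the value is \<open>0\<close> by division by zero; it is never used in the linear system,
  and it concerns only a null set in the integral equation.\<close>

definition green :: "real \<Rightarrow> real^3 \<Rightarrow> real^3 \<Rightarrow> complex" where
  "green k x y = exp (\<i> * of_real (k * norm (x - y))) / of_real (4 * pi * norm (x - y))"

definition plane_wave :: "real \<Rightarrow> real^3 \<Rightarrow> real^3 \<Rightarrow> complex" where
  "plane_wave k \<alpha> x = exp (\<i> * of_real (k * (\<alpha> \<bullet> x)))"

text \<open>Derivatives are real Frechet derivatives, taken within \<open>S\<close>. On a closed convex
  set with nonempty interior, such as the cube, they are unique and this is the usual space of
  functions that are \<open>C\<^sup>2\<close> up to the boundary.\<close>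

definition C2_on :: "(real^3) set \<Rightarrow> (real^3 \<Rightarrow> complex) \<Rightarrow> bool" where
  "C2_on S f \<longleftrightarrow>
     (\<exists>(f' :: real^3 \<Rightarrow> ((real^3) \<Rightarrow>\<^sub>L complex))
       (f'' :: real^3 \<Rightarrow> ((real^3) \<Rightarrow>\<^sub>L ((real^3) \<Rightarrow>\<^sub>L complex))).
        (\<forall>x\<in>S. (f has_derivative blinfun_apply (f' x)) (at x within S)) \<and>
        (\<forall>x\<in>S. (f' has_derivative blinfun_apply (f'' x)) (at x within S)) \<and>
        continuous_on S f'')"

text \<open>The equation is required at every point of the cube, with an absolutely convergent Lebesgue
  integral. No regularity of \<open>u\<close> is demanded; only the values of \<open>u\<close> on the cube matter.\<close>

definition solves_integral_eq ::
    "real \<Rightarrow> real^3 \<Rightarrow> (real^3 \<Rightarrow> complex) \<Rightarrow> (real^3 \<Rightarrow> complex) \<Rightarrow> bool" where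
  "solves_integral_eq k \<alpha> p u \<longleftrightarrow>
     (\<forall>x\<in>unit_cube.
        (\<lambda>y. green k x y * p y * u y) absolutely_integrable_on unit_cube \<and>
        u x + integral unit_cube (\<lambda>y. green k x y * p y * u y) = plane_wave k \<alpha> x)"

definition cube_centers :: "nat \<Rightarrow> (real^3) set" where
  "cube_centers n = {x. \<forall>i. \<exists>j<n. x $ i = (real j + 1/2) / real n}"

text \<open>A vector in \<open>\<complex>\<^sup>M\<close> is a function on indices, of which only \<open>1, \<dots>, M\<close> are relevant.\<close>

definition vec_max_norm :: "nat \<Rightarrow> (nat \<Rightarrow> complex) \<Rightarrow> real" where
  "vec_max_norm M v = (MAX j\<in>{1..M}. cmod (v j))"

definition solves_linear_system ::
    "real \<Rightarrow> real^3 \<Rightarrow> (real^3 \<Rightarrow> complex) \<Rightarrow> real \<Rightarrow> real \<Rightarrow> nat \<Rightarrow> (nat \<Rightarrow> real^3) \<Rightarrow>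
      (nat \<Rightarrow> complex) \<Rightarrow> bool" where
  "solves_linear_system k \<alpha> h \<kappa> a M x v \<longleftrightarrow>
     (\<forall>l\<in>{1..M}.
        v l = plane_wave k \<alpha> (x l) -
              4 * of_real pi *
                (\<Sum>j\<in>{1..M} - {l}. green k (x l) (x j) * h (x j) * of_real (a powr (2 - \<kappa>)) * v j))"

end

theory Submission
  imports Defs "HOL-Complex_Analysis.Great_Picard"
begin

text \<open>
  Put \<open>n = m P\<close>, let \<open>T w\<close> denote the integral of \<open>g(x, y) p(y) w(y)\<close> over the cube, and let \<open>T\<^sub>n w\<close> be the midpoint
  sum for it over the \<open>n\<^sup>3\<close> cells of side \<open>1 / n\<close>, without the cell of \<open>x\<close>. As \<open>4 \<pi> h = \<gamma>\<^sup>3 p\<close>, the linear system reads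
  \<open>u\<^sub>e + \<rho> T\<^sub>n u\<^sub>e = u\<^sub>0\<close> at the centres with \<open>\<rho> = \<gamma>\<^sup>3 M a\<^bsup>2 - \<kappa>\<^esup>\<close>, while \<open>u + T u = u\<^sub>0\<close>. Hence \<open>e = u - u\<^sub>e\<close> satisfies
  \<open>e + \<rho> T\<^sub>n e = (T\<^sub>n - T) u + (\<rho> - 1) T\<^sub>n u\<close>, and the theorem follows from consistency, \<open>(T\<^sub>n - T) u = O(log n / n\<^sup>2)\<close>,
  and stability, a bound for the inverse of \<open>I + T\<^sub>n\<close> that is uniform in \<open>n\<close>, since \<open>\<rho>\<close> tends to 1
  (\<open>density_factor_tendsto_1\<close>, \<open>discrete_error_bound\<close>).

  Consistency (\<open>discrete_potential_consistent\<close>). The solution need not be twice differentiable with bounded derivatives up to the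
  edges of the cube, since the density \<open>p u\<close> jumps at the boundary. What holds is the bound \<open>O(|h|\<^sup>2 log (1 / |h|))\<close> for
  \<open>u(x + h) + u(x - h) - 2 u(x)\<close>. Every potential of a bounded density obeys it (\<open>potential_second_diff\<close>), because the second difference of the
  kernel is \<open>O(|h|\<^sup>2 / |x - y|\<^sup>3)\<close> away from the singularity. Boundedness of \<open>u\<close> itself is obtained by inserting the equation into
  itself once (\<open>solution_bounded\<close>). The midpoint rule on a cell, which is symmetric about its centre, sees only second
  differences (\<open>midpoint_rule\<close>). The errors of the cells are therefore controlled by sums of \<open>|x - c|\<^bsup>-s\<^esup> / n\<^sup>3\<close> over the other centres
  \<open>c\<close>, which are bounded for \<open>s = 1, 2\<close> and \<open>O(log n)\<close> for \<open>s = 3\<close>.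

  Stability (\<open>discrete_stability\<close>). Otherwise there are grid functions of norm 1 on finer and finer grids whose images under \<open>I + T\<^sub>n\<close> tend to 0.
  Up to a small error they are values of negative potentials of step functions, and these potentials are uniformly bounded and
  uniformly Lipschitz. By the theorem of Arzela and Ascoli a subsequence converges uniformly, to a continuous function \<open>\<phi> \<noteq> 0\<close> with
  \<open>\<phi> + T \<phi> = 0\<close> (\<open>approximate_null_vectors_limit\<close>). This contradicts the uniqueness of \<open>u\<close>.
\<close>

section \<open>Integrals of powers of the distance\<close>

lemma content_cball_3: "r \<ge> 0 \<Longrightarrow> measure lebesgue (cball (x :: real^3) r) \<le> 8 * r ^ 3"
proof -
  assume r: "r \<ge> 0"
  have "measure lebesgue (cball x r) = unit_ball_vol (real DIM(real^3)) * r ^ DIM(real^3)"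
    using r content_cball[of r x] by simp
  also have "\<dots> = 4 / 3 * pi * r ^ 3"
    using unit_ball_vol_3 by simp
  also have "\<dots> \<le> 8 * r ^ 3"
    using pi_less_4 r by (intro mult_right_mono) auto
  finally show ?thesis .
qed

lemma integrable_on_continuous_compact:
  fixes f :: "'a::euclidean_space \<Rightarrow> 'b::euclidean_space"
  assumes "compact S" "continuous_on S f"
  shows "f integrable_on S"
proof -
  have "(\<lambda>x. indicat_real S x *\<^sub>R f x) integrable_on UNIV"
    by (intro integrable_on_lborel borel_integrable_compact assms)
  also have "(\<lambda>x. indicat_real S x *\<^sub>R f x) = (\<lambda>x. if x \<in> S then f x else 0)"
    by auto
  finally show ?thesis
    by (simp add: integrable_restrict_UNIV)
qed

text \<open>On an annulus whose radii differ by a factor 2 the integrand is constant up to the factor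
  \<open>2 ^ s\<close>, so the integral is at most the volume of the outer ball times the largest value. Summing
  over dyadic annuli then gives a convergent geometric series for \<open>s = 2\<close> and one equal term per
  annulus, that is a logarithm, for \<open>s = 3\<close>; these two exponents are the only ones used below.\<close>

lemma integral_annulus:
  fixes x :: "real^3" and s :: nat
  assumes "r > 0"
  defines "A \<equiv> {y. r / 2 \<le> norm (x - y) \<and> norm (x - y) \<le> r}"
  shows "(\<lambda>y. 1 / norm (x - y) ^ s) integrable_on A"
    and "integral A (\<lambda>y. 1 / norm (x - y) ^ s) \<le> 8 * 2 ^ s * r ^ 3 / r ^ s"
proof -
  have "A = cball x r - ball x (r / 2)"
    by (auto simp: A_def dist_norm)
  then have A: "A \<in> lmeasurable" "compact A" "measure lebesgue A \<le> 8 * r ^ 3"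
    using measure_mono_fmeasurable[of A "cball x r" lebesgue] content_cball_3[of r x] assms(1)
    by (auto simp: compact_diff fmeasurable.Diff)
  have "continuous_on A (\<lambda>y. 1 / norm (x - y) ^ s)"
    using \<open>r > 0\<close> by (intro continuous_intros) (auto simp: A_def)
  then show int: "(\<lambda>y. 1 / norm (x - y) ^ s) integrable_on A"
    using A by (intro integrable_on_continuous_compact)
  have "integral A (\<lambda>y. 1 / norm (x - y) ^ s) \<le> integral A (\<lambda>y. 2 ^ s / r ^ s * 1)"
  proof (rule integral_le[OF int])
    show "(\<lambda>y. 2 ^ s / r ^ s * 1) integrable_on A"
      using A(1) by (intro integrable_on_const)
    fix y assume "y \<in> A"
    then have "(r / 2) ^ s \<le> norm (x - y) ^ s"
      using \<open>r > 0\<close> by (intro power_mono) (auto simp: A_def)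
    then have "1 / norm (x - y) ^ s \<le> 1 / (r / 2) ^ s"
      using \<open>r > 0\<close> by (intro frac_le) auto
    then show "1 / norm (x - y) ^ s \<le> 2 ^ s / r ^ s * 1"
      by (simp add: power_divide)
  qed
  also have "\<dots> = 2 ^ s / r ^ s * measure lebesgue A"
    using A(1) by (subst integral_mult_right) (simp add: lmeasure_integral)
  also have "\<dots> \<le> 2 ^ s / r ^ s * (8 * r ^ 3)"
    using A(3) \<open>r > 0\<close> by (intro mult_left_mono) auto
  finally show "integral A (\<lambda>y. 1 / norm (x - y) ^ s) \<le> 8 * 2 ^ s * r ^ 3 / r ^ s"
    by (simp add: mult_ac)
qed

lemma integral_dyadic_annuli:
  fixes x :: "real^3" and s :: nat
  assumes "R > 0"
  defines "A \<equiv> \<lambda>K. {y. R / 2 ^ K \<le> norm (x - y) \<and> norm (x - y) \<le> R}"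
  shows "(\<lambda>y. 1 / norm (x - y) ^ s) integrable_on A K \<and>
         integral (A K) (\<lambda>y. 1 / norm (x - y) ^ s) \<le> (\<Sum>k<K. 8 * 2 ^ s * (R / 2 ^ k) ^ 3 / (R / 2 ^ k) ^ s)"
proof (induction K)
  case 0
  have "A 0 = sphere x R"
    by (auto simp: A_def dist_norm)
  then have "negligible (A 0)"
    by (simp add: negligible_sphere)
  then have "((\<lambda>y. 1 / norm (x - y) ^ s) has_integral 0) (A 0)"
    by (rule has_integral_negligible) auto
  then show ?case
    by (auto simp: integral_unique has_integral_integrable)
next
  case (Suc K)
  define B where "B = {y. R / 2 ^ K / 2 \<le> norm (x - y) \<and> norm (x - y) \<le> R / 2 ^ K}"
  have pos: "R / 2 ^ K > 0"
    using \<open>R > 0\<close> by simp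
  note B = integral_annulus[OF pos, of x s, folded B_def]
  have "R / 2 ^ K \<le> R" "R / 2 ^ K / 2 \<le> R / 2 ^ K"
    using \<open>R > 0\<close> by (auto simp: divide_le_eq)
  then have AB: "A (Suc K) = A K \<union> B"
    by (auto simp: A_def B_def mult.commute)
  have "A K \<inter> B \<subseteq> sphere x (R / 2 ^ K)"
    by (auto simp: A_def B_def dist_norm)
  then have neg: "negligible (A K \<inter> B)"
    by (rule negligible_subset[OF negligible_sphere])
  show ?case
    using Suc B neg unfolding AB by (auto intro!: integrable_Un)
qed

text \<open>The annuli exhaust the ball up to its centre, where the integrand has the value \<open>1 / 0 = 0\<close>;
  monotone convergence passes from the annuli to the whole ball. The bound is linear in \<open>R\<close>, which is
  what makes the contribution of a small ball around the singularity negligible.\<close>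

lemma integral_inverse_square_cball:
  fixes x :: "real^3"
  assumes "R \<ge> 0"
  shows "(\<lambda>y. 1 / norm (x - y) ^ 2) integrable_on cball x R"
    and "integral (cball x R) (\<lambda>y. 1 / norm (x - y) ^ 2) \<le> 64 * R"
proof -
  have "(\<lambda>y. 1 / norm (x - y) ^ 2) integrable_on cball x R \<and>
    integral (cball x R) (\<lambda>y. 1 / norm (x - y) ^ 2) \<le> 64 * R"
  proof (cases "R = 0")
    case True
    then show ?thesis
      by (simp add: integrable_negligible)
  next
    case False
    with assms have R: "R > 0" by simp
    define A where "A K = {y. R / 2 ^ K \<le> norm (x - y) \<and> norm (x - y) \<le> R}" for K :: nat
    define f where "f = (\<lambda>y::real^3. 1 / norm (x - y) ^ 2)"
    define F where "F K y = (if y \<in> A K then f y else 0)" for K y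
    have sub: "A K \<inter> cball x R = A K" for K
      by (auto simp: A_def dist_norm)
    note A = integral_dyadic_annuli[OF R, of x 2, folded A_def f_def]
    have sum: "(\<Sum>k<K. 8 * 2 ^ 2 * (R / 2 ^ k) ^ 3 / (R / 2 ^ k) ^ 2) \<le> 64 * R" for K :: nat
    proof -
      have "(\<Sum>k<K. 8 * 2 ^ 2 * (R / 2 ^ k) ^ 3 / (R / 2 ^ k) ^ 2) = 32 * R * (\<Sum>k<K. (1/2) ^ k)"
        using R by (simp add: sum_distrib_left power3_eq_cube power2_eq_square power_divide)
      also have "\<dots> \<le> 32 * R * (2)"
        using R by (intro mult_left_mono) (subst sum_gp_strict, auto)
      finally show ?thesis by simp
    qed
    have Fint: "F K integrable_on cball x R" "integral (cball x R) (F K) = integral (A K) f" for K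
      using A[of K] sub[of K] unfolding F_def
      by (auto simp: integrable_restrict_Int integral_restrict_Int Int_commute)
    have f0: "f y \<ge> 0" for y by (simp add: f_def)
    have "f integrable_on cball x R \<and> (\<lambda>K. integral (cball x R) (F K)) \<longlonglongrightarrow> integral (cball x R) f"
    proof (rule monotone_convergence_increasing)
      show "F k integrable_on cball x R" for k by (rule Fint)
      fix k y
      have "R / 2 ^ Suc k \<le> R / 2 ^ k"
        using R by (simp add: field_simps)
      then show "F k y \<le> F (Suc k) y"
        using f0[of y] by (auto simp: F_def A_def)
    next
      fix y assume y: "y \<in> cball x R"
      show "(\<lambda>k. F k y) \<longlonglongrightarrow> f y"
      proof (cases "y = x")
        case True
        then have "F k y = 0" for k by (simp add: F_def f_def)
        then show ?thesis using True by (simp add: f_def)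
      next
        case False
        have "(\<lambda>k. R * (1/2) ^ k) \<longlonglongrightarrow> R * 0"
          by (intro tendsto_mult_left LIMSEQ_power_zero) auto
        then have "\<forall>\<^sub>F k in sequentially. R * (1/2) ^ k < norm (x - y)"
          using False by (intro order_tendstoD) auto
        then have "\<forall>\<^sub>F k in sequentially. F k y = f y"
        proof eventually_elim
          case (elim k)
          have "norm (x - y) \<le> R" using y by (simp add: dist_norm)
          with elim have "y \<in> A k" by (simp add: A_def power_divide)
          then show ?case by (simp add: F_def)
        qed
        then show ?thesis
          by (simp add: tendsto_eventually)
      qed
    next
      have "norm (integral (cball x R) (F k)) \<le> 64 * R" for k
      proof -
        have "0 \<le> integral (cball x R) (F k)"
          by (intro integral_nonneg Fint) (auto simp: F_def f0)
        then show ?thesis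
          using A[of k] sum[of k] Fint(2)[of k] by simp
      qed
      then show "bounded (range (\<lambda>k. integral (cball x R) (F k)))"
        by (auto simp: bounded_iff)
    qed
    moreover from this have "integral (cball x R) f \<le> 64 * R"
    proof (intro LIMSEQ_le_const2[of "\<lambda>K. integral (cball x R) (F K)"])
      have "integral (cball x R) (F k) \<le> 64 * R" for k
        using A[of k] sum[of k] Fint[of k] by linarith
      then show "\<exists>N. \<forall>n\<ge>N. integral (cball x R) (F n) \<le> 64 * R" by blast
    qed auto
    ultimately show ?thesis by (simp add: f_def)
  qed
  then show "(\<lambda>y. 1 / norm (x - y) ^ 2) integrable_on cball x R"
    and "integral (cball x R) (\<lambda>y. 1 / norm (x - y) ^ 2) \<le> 64 * R" by auto
qed

text \<open>The constant 7/4 is a rational upper bound for \<open>sqrt 3\<close> that is still below 2. Consequently half the diagonal of a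
  cube of side \<open>s\<close> is at most \<open>7 / 8 * s\<close>, strictly less than the distance \<open>s\<close> between neighbouring
  centres, and a cube stays away from all other centres by a fixed proportion of their distance.\<close>

lemma norm_vec3_le:
  fixes v :: "real^3"
  assumes "\<And>i. \<bar>v $ i\<bar> \<le> d"
  shows "norm v \<le> 7 / 4 * d"
proof (rule power2_le_imp_le)
  have sq: "v $ i * v $ i \<le> d * d" for i
    using abs_le_square_iff[of "v $ i" d] assms[of i] by (simp add: power2_eq_square)
  have "(norm v)\<^sup>2 = v $ 1 * v $ 1 + v $ 2 * v $ 2 + v $ 3 * v $ 3"
    by (simp add: power2_norm_eq_inner inner_vec_def sum_3)
  also have "\<dots> \<le> d * d + d * d + d * d"
    by (intro add_mono sq)
  also have "\<dots> \<le> (7 / 4 * d)\<^sup>2"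
    by (simp add: power2_eq_square)
  finally show "(norm v)\<^sup>2 \<le> (7 / 4 * d)\<^sup>2" .
  show "0 \<le> 7 / 4 * d"
    using assms[of 1] by simp
qed

lemma norm_diff_unit_cube:
  fixes x y :: "real^3"
  assumes "x \<in> unit_cube" "y \<in> unit_cube"
  shows "norm (x - y) \<le> 2"
proof -
  have "\<bar>(x - y) $ i\<bar> \<le> 1" for i
  proof -
    have "0 \<le> x $ i" "x $ i \<le> 1" "0 \<le> y $ i" "y $ i \<le> 1"
      using assms by (auto simp: mem_box_cart)
    then show ?thesis by simp
  qed
  then show ?thesis
    using norm_vec3_le[of "x - y" 1] by simp
qed

lemma integral_inverse_square_cube:
  fixes x :: "real^3"
  assumes "x \<in> unit_cube"
  shows "(\<lambda>y. 1 / norm (x - y) ^ 2) integrable_on unit_cube"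
    and "integral unit_cube (\<lambda>y. 1 / norm (x - y) ^ 2) \<le> 128"
proof -
  have sub: "unit_cube \<subseteq> cball x 2"
    using norm_diff_unit_cube[OF assms] by (auto simp: dist_norm)
  note c = integral_inverse_square_cball[of 2 x]
  show int: "(\<lambda>y. 1 / norm (x - y) ^ 2) integrable_on unit_cube"
    using integrable_on_subcbox[OF c(1) sub] by simp
  show "integral unit_cube (\<lambda>y. 1 / norm (x - y) ^ 2) \<le> 128"
    using integral_subset_le[OF sub int c(1)] c(2) by auto
qed

text \<open>This integral is the origin of the logarithm in the final estimate.\<close>

lemma integral_inverse_cube_far:
  fixes x :: "real^3"
  assumes "x \<in> unit_cube" "0 < r" "r \<le> 1"
  defines "S \<equiv> {y\<in>unit_cube. r \<le> norm (x - y)}"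
  shows "(\<lambda>y. 1 / norm (x - y) ^ 3) integrable_on S"
    and "integral S (\<lambda>y. 1 / norm (x - y) ^ 3) \<le> 128 * (1 + ln (1 / r))"
proof -
  have "S = unit_cube - ball x r"
    by (auto simp: S_def dist_norm)
  then have "compact S"
    by (auto simp: compact_diff)
  moreover have "continuous_on S (\<lambda>y. 1 / norm (x - y) ^ 3)"
    using \<open>r > 0\<close> by (intro continuous_intros) (auto simp: S_def)
  ultimately show int: "(\<lambda>y. 1 / norm (x - y) ^ 3) integrable_on S"
    by (rule integrable_on_continuous_compact)
  \<comment> \<open>\<open>K\<close> dyadic annuli reach from the radius 2, which exceeds the diameter of the cube, down to \<open>r\<close>.\<close>
  define K where "K = nat \<lceil>log 2 (2 / r)\<rceil>"
  define A where "A = {y. 2 / 2 ^ K \<le> norm (x - y) \<and> norm (x - y) \<le> 2}"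
  have l1: "log 2 (2 / r) \<ge> 0"
    using assms by (intro zero_le_log_cancel_iff[THEN iffD2]) auto
  have K: "log 2 (2 / r) \<le> K" "real K \<le> log 2 (2 / r) + 1"
    unfolding K_def using l1 by linarith+
  have "2 / r \<le> 2 powr K"
    using K(1) assms by (simp add: log_le_iff)
  then have "2 / 2 ^ K \<le> r"
    using assms by (simp add: powr_realpow field_simps)
  then have sub: "S \<subseteq> A"
    using norm_diff_unit_cube[OF assms(1)] by (auto simp: S_def A_def)
  note d = integral_dyadic_annuli[of 2 x 3 K, folded A_def]
  have "integral S (\<lambda>y. 1 / norm (x - y) ^ 3) \<le> integral A (\<lambda>y. 1 / norm (x - y) ^ 3)"
    using d by (intro integral_subset_le[OF sub int]) auto
  also have "\<dots> \<le> 64 * real K"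
    using d by simp
  also have "\<dots> \<le> 64 * (2 + ln (1 / r) / ln 2)"
    using K(2) assms by (simp add: log_def ln_div ln_mult field_simps)
  also have "\<dots> \<le> 64 * (2 + 2 * ln (1 / r))"
  proof -
    have "ln 2 \<ge> (1/2 :: real)" 
      using ln2_ge_two_thirds by simp
    moreover have "ln (1 / r) \<ge> 0"
      using assms by simp
    ultimately have "ln (1 / r) / ln 2 \<le> ln (1 / r) / (1/2)"
      by (intro divide_left_mono) auto
    then show ?thesis by simp
  qed
  finally show "integral S (\<lambda>y. 1 / norm (x - y) ^ 3) \<le> 128 * (1 + ln (1 / r))"
    by simp
qed

section \<open>The Green kernel\<close>

text \<open>For \<open>i = 0, 1, 2\<close> this is the \<open>i\<close>-th derivative of \<open>t \<mapsto> exp (\<i> k t) / (4 pi t)\<close>, written out on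
  the complex plane so that the complex Taylor formula applies on real segments. It reduces every
  estimate for the Green kernel to one real variable, the distance.\<close>

definition radial_green :: "real \<Rightarrow> nat \<Rightarrow> complex \<Rightarrow> complex" where
  "radial_green k i t = exp (\<i> * of_real k * t) / of_real (4 * pi) *
     (if i = 0 then 1 / t else if i = 1 then \<i> * of_real k / t - 1 / t ^ 2
      else - of_real (k ^ 2) / t - 2 * \<i> * of_real k / t ^ 2 + 2 / t ^ 3)"

lemma green_eq_radial: "green k x y = radial_green k 0 (of_real (norm (x - y)))"
  by (simp add: green_def radial_green_def mult_ac)

lemma norm_exp_i_div_4pi: "cmod (exp (\<i> * of_real k * of_real t) / of_real (4 * pi)) \<le> 1"
proof -
  have "cmod (exp (\<i> * of_real k * of_real t) / of_real (4 * pi)) = 1 / (4 * pi)"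
    using norm_exp_i_times[of "k * t"] by (simp add: norm_divide mult.assoc)
  also have "\<dots> \<le> 1" using pi_gt3 by simp
  finally show ?thesis .
qed

lemma DERIV_radial_green:
  assumes "t \<noteq> 0" "i \<le> 1"
  shows "(radial_green k i has_field_derivative radial_green k (Suc i) t) (at t within S)"
proof -
  have "i = 0 \<or> i = 1" using assms(2) by auto
  then show ?thesis
    unfolding radial_green_def [abs_def]
    apply (elim disjE; clarsimp)
     apply (rule derivative_eq_intros refl | use assms in force)+
     apply (use assms in \<open>simp add: field_simps power2_eq_square\<close>)
     apply (rule derivative_eq_intros refl | use assms in force)+
     apply (use assms in \<open>simp add: field_simps power2_eq_square power3_eq_cube\<close>)
    done
qed

text \<open>The restriction \<open>t \<le> 4\<close> lets the less singular terms be absorbed into the most singular one; distances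
  between points of the cube, and between their small translates, respect it.\<close>

lemma norm_radial_green_1:
  assumes "k \<ge> 0" "0 < t" "t \<le> 4"
  shows "cmod (radial_green k 1 (of_real t)) \<le> (4 * k + 1) / t ^ 2"
proof -
  have "cmod (\<i> * of_real k / of_real t - 1 / of_real t ^ 2) \<le> k / t + 1 / t ^ 2"
    using assms by (intro order_trans[OF norm_triangle_ineq4])
      (simp add: norm_divide norm_mult norm_power)
  also have "k / t \<le> 4 * k / t ^ 2"
  proof -
    have "k / t = k * t / t ^ 2" using assms by (simp add: power2_eq_square)
    also have "\<dots> \<le> k * 4 / t ^ 2" using assms by (intro divide_right_mono mult_left_mono) auto
    finally show ?thesis by (simp add: mult.commute)
  qed
  finally have b: "cmod (\<i> * of_real k / of_real t - 1 / of_real t ^ 2) \<le> (4 * k + 1) / t ^ 2"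
    by (simp add: add_divide_distrib)
  show ?thesis
    using mult_mono[OF norm_exp_i_div_4pi[of k t] b] assms
    by (simp add: radial_green_def norm_mult[symmetric])
qed

lemma norm_radial_green_2:
  assumes "k \<ge> 0" "0 < t" "t \<le> 4"
  shows "cmod (radial_green k 2 (of_real t)) \<le> (16 * k ^ 2 + 8 * k + 2) / t ^ 3"
proof -
  have "cmod (- of_real (k ^ 2) / of_real t - 2 * \<i> * of_real k / of_real t ^ 2 + 2 / of_real t ^ 3)
    \<le> cmod (- of_real (k ^ 2) / of_real t) + cmod (2 * \<i> * of_real k / of_real t ^ 2) + cmod (2 / of_real t ^ 3)"
    by (meson norm_triangle_ineq norm_triangle_ineq4 add_right_mono order_trans)
  also have "\<dots> = k ^ 2 / t + 2 * k / t ^ 2 + 2 / t ^ 3"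
    using assms by (simp add: norm_divide norm_mult norm_power)
  also have "k ^ 2 / t \<le> 16 * k ^ 2 / t ^ 3"
  proof -
    have t: "t ^ 2 \<le> 4 ^ 2" using assms by (intro power_mono) auto
    have "k ^ 2 / t = k ^ 2 * t ^ 2 / t ^ 3"
      using assms by (simp add: power2_eq_square power3_eq_cube)
    also have "\<dots> \<le> k ^ 2 * 4 ^ 2 / t ^ 3"
      using assms t by (intro divide_right_mono mult_left_mono) auto
    finally show ?thesis by (simp add: mult.commute)
  qed
  also have "2 * k / t ^ 2 \<le> 8 * k / t ^ 3"
  proof -
    have "2 * k / t ^ 2 = 2 * k * t / t ^ 3"
      using assms by (simp add: power2_eq_square power3_eq_cube)
    also have "\<dots> \<le> 2 * k * 4 / t ^ 3"
      using assms by (intro divide_right_mono mult_left_mono) auto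
    finally show ?thesis by simp
  qed
  finally have b: "cmod (- of_real (k ^ 2) / of_real t - 2 * \<i> * of_real k / of_real t ^ 2 + 2 / of_real t ^ 3)
     \<le> (16 * k ^ 2 + 8 * k + 2) / t ^ 3"
    by (simp add: add_divide_distrib)
  show ?thesis
    using mult_mono[OF norm_exp_i_div_4pi[of k t] b] assms
    by (simp add: radial_green_def norm_mult[symmetric])
qed

lemma norm_green_le: "cmod (green k x y) \<le> 1 / norm (x - y)"
proof -
  have "cmod (green k x y) = 1 / (4 * pi * norm (x - y))"
    by (simp add: green_def norm_divide norm_mult)
  also have "\<dots> \<le> 1 / norm (x - y)"
    using pi_gt3 by (cases "x = y") (auto simp: field_simps)
  finally show ?thesis .
qed

lemma green_diag: "green k z z = 0"
  by (simp add: green_def)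

lemma green_commute: "green k x y = green k y x"
  by (simp add: green_def norm_minus_commute)

lemma segment_of_real_positive:
  assumes "z \<in> closed_segment (of_real a :: complex) (of_real b)" "c \<le> a" "c \<le> b" "a \<le> d" "b \<le> d"
  shows "\<exists>t. z = of_real t \<and> c \<le> t \<and> t \<le> d"
proof -
  obtain t where "z = of_real t" "t \<in> closed_segment a b"
    using assms(1) by (auto simp: closed_segment_of_real)
  then show ?thesis
    using assms by (auto simp: closed_segment_eq_real_ivl split: if_splits)
qed

lemma norm_radial_green_diff:
  assumes "k \<ge> 0" "0 < r" "0 < r'" "r \<le> 4" "r' \<le> 4"
  shows "cmod (radial_green k 0 (of_real r) - radial_green k 0 (of_real r'))
          \<le> (4 * k + 1) * \<bar>r - r'\<bar> * (1 / r ^ 2 + 1 / r' ^ 2)"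
proof -
  define m where "m = min r r'"
  define S where "S = closed_segment (of_real r' :: complex) (of_real r)"
  have m: "0 < m" "m \<le> r" "m \<le> r'" using assms by (auto simp: m_def)
  have S: "\<exists>t. z = of_real t \<and> m \<le> t \<and> t \<le> 4" if "z \<in> S" for z
    using segment_of_real_positive[OF that[unfolded S_def], of m 4] m assms by auto
  have "cmod (radial_green k 0 (of_real r) - (\<Sum>i\<le>0. radial_green k i (of_real r') * (of_real r - of_real r') ^ i / fact i))
    \<le> ((4 * k + 1) / m ^ 2) * cmod (of_real r - of_real r') ^ Suc 0 / fact 0"
  proof (rule field_Taylor)
    show "convex S" by (simp add: S_def)
    show "of_real r' \<in> S" "of_real r \<in> S" by (auto simp: S_def)
    fix z i assume z: "z \<in> S"
    from S[OF z] obtain t where t: "z = of_real t" "m \<le> t" "t \<le> 4" by blast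
    show "(radial_green k i has_field_derivative radial_green k (Suc i) z) (at z within S)" if "i \<le> 0"
      using that t m by (intro DERIV_radial_green) auto
    have "cmod (radial_green k 1 z) \<le> (4 * k + 1) / t ^ 2"
      unfolding t(1) by (intro norm_radial_green_1) (use t m assms in auto)
    also have "\<dots> \<le> (4 * k + 1) / m ^ 2"
      using t m assms by (intro divide_left_mono power_mono) auto
    finally show "cmod (radial_green k (Suc 0) z) \<le> (4 * k + 1) / m ^ 2" by simp
  qed
  then have "cmod (radial_green k 0 (of_real r) - radial_green k 0 (of_real r'))
    \<le> (4 * k + 1) * \<bar>r - r'\<bar> * (1 / m ^ 2)"
    by (simp flip: of_real_diff)
  also have "1 / m ^ 2 \<le> 1 / r ^ 2 + 1 / r' ^ 2"
    by (auto simp: m_def min_def)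
  finally show ?thesis
    using assms by (simp add: mult_left_mono)
qed

text \<open>The two-sided bound, with one inverse square centred at each of the two points, spares a distinction
  of near and far \<open>y\<close>: it integrates to a constant directly. It also holds at the singularities, where
  the kernel and \<open>1 / 0\<close> are both 0.\<close>

lemma norm_green_diff:
  assumes "k \<ge> 0" "norm (x - y) \<le> 4" "norm (x' - y) \<le> 4"
  shows "cmod (green k x y - green k x' y)
          \<le> (4 * k + 1) * norm (x - x') * (1 / norm (x - y) ^ 2 + 1 / norm (x' - y) ^ 2)"
proof (cases "y = x \<or> y = x'")
  case True
  have diag: "cmod (green k a b) \<le> (4 * k + 1) * norm (a - b) * (1 / norm (a - b) ^ 2)" for a b
  proof -
    have "cmod (green k a b) \<le> 1 * (norm (a - b) * (1 / norm (a - b) ^ 2))"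
      using norm_green_le[of k a b] by (auto simp: power2_eq_square green_diag)
    also have "\<dots> \<le> (4 * k + 1) * (norm (a - b) * (1 / norm (a - b) ^ 2))"
      using assms(1) by (intro mult_right_mono) auto
    finally show ?thesis by (simp add: mult.assoc)
  qed
  show ?thesis
    using green_diag[of k] True diag[of x' x] diag[of x x'] by (auto simp: norm_minus_commute)
next
  case False
  have "cmod (green k x y - green k x' y)
    \<le> (4 * k + 1) * \<bar>norm (x - y) - norm (x' - y)\<bar> * (1 / norm (x - y) ^ 2 + 1 / norm (x' - y) ^ 2)"
    unfolding green_eq_radial using assms False by (intro norm_radial_green_diff) auto
  also have "\<dots> \<le> (4 * k + 1) * norm (x - x') * (1 / norm (x - y) ^ 2 + 1 / norm (x' - y) ^ 2)"
    using assms norm_triangle_ineq3[of "x - y" "x' - y"]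
    by (intro mult_right_mono mult_left_mono) auto
  finally show ?thesis .
qed

lemma norm_radial_green_taylor:
  assumes "k \<ge> 0" "0 < c" "c \<le> r" "c \<le> r'" "r \<le> 4" "r' \<le> 4"
  shows "cmod (radial_green k 0 (of_real r') - radial_green k 0 (of_real r)
            - radial_green k 1 (of_real r) * of_real (r' - r))
          \<le> (16 * k ^ 2 + 8 * k + 2) / c ^ 3 * (r' - r) ^ 2"
proof -
  define S where "S = closed_segment (of_real r :: complex) (of_real r')"
  have S: "\<exists>t. z = of_real t \<and> c \<le> t \<and> t \<le> 4" if "z \<in> S" for z
    using segment_of_real_positive[OF that[unfolded S_def], of c 4] assms by auto
  have "cmod (radial_green k 0 (of_real r') - (\<Sum>i\<le>1. radial_green k i (of_real r) * (of_real r' - of_real r) ^ i / fact i))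
    \<le> ((16 * k ^ 2 + 8 * k + 2) / c ^ 3) * cmod (of_real r' - of_real r) ^ Suc 1 / fact 1"
  proof (rule field_Taylor)
    show "convex S" by (simp add: S_def)
    show "of_real r' \<in> S" "of_real r \<in> S" by (auto simp: S_def)
    fix z i assume z: "z \<in> S"
    from S[OF z] obtain t where t: "z = of_real t" "c \<le> t" "t \<le> 4" by blast
    show "(radial_green k i has_field_derivative radial_green k (Suc i) z) (at z within S)" if "i \<le> 1"
      using that t assms by (intro DERIV_radial_green) auto
    have "cmod (radial_green k 2 z) \<le> (16 * k ^ 2 + 8 * k + 2) / t ^ 3"
      unfolding t(1) by (intro norm_radial_green_2) (use t assms in auto)
    also have "\<dots> \<le> (16 * k ^ 2 + 8 * k + 2) / c ^ 3"
      using t assms by (intro divide_left_mono power_mono) auto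
    finally show "cmod (radial_green k (Suc 1) z) \<le> (16 * k ^ 2 + 8 * k + 2) / c ^ 3"
      by (simp add: numeral_2_eq_2)
  qed
  then show ?thesis
    by (simp add: diff_diff_add mult.commute power2_eq_square flip: of_real_diff)
qed

text \<open>The lower bound is the triangle inequality for \<open>2 z = (z + h) + (z - h)\<close>, the upper bound the
  parallelogram law. It says that the first-order terms of the two increments of the norm cancel.\<close>

lemma norm_second_difference:
  fixes z h :: "'a::real_inner"
  assumes "z \<noteq> 0"
  shows "0 \<le> norm (z + h) + norm (z - h) - 2 * norm z"
    and "norm (z + h) + norm (z - h) - 2 * norm z \<le> norm h ^ 2 / norm z"
proof -
  have "norm (2 *\<^sub>R z) \<le> norm (z + h) + norm (z - h)"
    using norm_triangle_ineq[of "z + h" "z - h"] by (simp add: scaleR_2)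
  then show "0 \<le> norm (z + h) + norm (z - h) - 2 * norm z" by simp
  have par: "norm (z + h) ^ 2 + norm (z - h) ^ 2 = 2 * norm z ^ 2 + 2 * norm h ^ 2"
    by (simp add: power2_norm_eq_inner inner_simps inner_commute)
  have z: "norm z > 0" using assms by simp
  have "norm (z + h) + norm (z - h) \<le> 2 * norm z + norm h ^ 2 / norm z"
  proof (rule power2_le_imp_le)
    have "(norm (z + h) + norm (z - h)) ^ 2 \<le> 2 * (norm (z + h) ^ 2 + norm (z - h) ^ 2)"
      using sum_squares_bound[of "norm (z + h)" "norm (z - h)"] by (simp add: power2_sum)
    also have "\<dots> = 4 * norm z ^ 2 + 4 * norm h ^ 2" using par by simp
    also have "\<dots> = (2 * norm z) ^ 2 + 2 * (2 * norm z) * (norm h ^ 2 / norm z)"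
      using z by (simp add: power_mult_distrib)
    also have "\<dots> \<le> (2 * norm z + norm h ^ 2 / norm z) ^ 2"
      unfolding power2_sum[of "2 * norm z"] by simp
    finally show "(norm (z + h) + norm (z - h)) ^ 2 \<le> (2 * norm z + norm h ^ 2 / norm z) ^ 2" .
  qed (use z in auto)
  then show "norm (z + h) + norm (z - h) - 2 * norm z \<le> norm h ^ 2 / norm z" by simp
qed

text \<open>Write \<open>r\<close>, \<open>r\<^sub>1\<close>, \<open>r\<^sub>2\<close> for the distances of \<open>x\<close>, \<open>x + h\<close>, \<open>x - h\<close> to \<open>y\<close>. Taylor expansion of the radial
  profile at \<open>r\<close> leaves two second-order remainders and the first derivative times \<open>r\<^sub>1 + r\<^sub>2 - 2 r\<close>, and
  the latter is itself of second order in \<open>h\<close>. The factor 7/8 keeps \<open>r\<^sub>1\<close> and \<open>r\<^sub>2\<close> above \<open>r / 8\<close>, which gives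
  the factor \<open>8 ^ 3 = 512\<close> per remainder, and it admits every \<open>h\<close> that stays in the
  cube around a centre when \<open>y\<close> is another centre.\<close>

lemma norm_green_second_diff:
  fixes x h y :: "real^3"
  assumes "k \<ge> 0" "x \<noteq> y" "norm (x - y) \<le> 2" "norm h \<le> 7 / 8 * norm (x - y)"
  defines "C \<equiv> 4 * k + 1 + 1024 * (16 * k ^ 2 + 8 * k + 2)"
  shows "cmod (green k (x + h) y + green k (x - h) y - 2 * green k x y) \<le> C * norm h ^ 2 / norm (x - y) ^ 3"
proof -
  define r where "r = norm (x - y)"
  define r1 where "r1 = norm (x + h - y)"
  define r2 where "r2 = norm (x - h - y)"
  have r: "r > 0" "r \<le> 2" using assms by (auto simp: r_def)
  have e: "x + h - y = (x - y) + h" "x - h - y = (x - y) - h" by simp_all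
  have d: "\<bar>r1 - r\<bar> \<le> norm h" "\<bar>r2 - r\<bar> \<le> norm h"
    using norm_triangle_ineq3[of "x - y + h" "x - y"] norm_triangle_ineq3[of "x - y - h" "x - y"]
    by (simp_all add: r_def r1_def r2_def e)
  have b: "r / 8 \<le> r1" "r / 8 \<le> r2" "r1 \<le> 4" "r2 \<le> 4"
    using d assms(4) r unfolding r_def[symmetric] by linarith+
  have s: "0 \<le> r1 + r2 - 2 * r" "r1 + r2 - 2 * r \<le> norm h ^ 2 / r"
    using norm_second_difference[of "x - y" h] assms(2) by (simp_all add: r_def r1_def r2_def e)
  define K where "K = 16 * k ^ 2 + 8 * k + 2"
  have K: "K \<ge> 0" using assms by (simp add: K_def)
  define f where "f = (\<lambda>i t. radial_green k i (of_real t))"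
  have T: "cmod (f 0 r' - f 0 r - f 1 r * of_real (r' - r)) \<le> 512 * K * norm h ^ 2 / r ^ 3"
    if "r / 8 \<le> r'" "r' \<le> 4" "\<bar>r' - r\<bar> \<le> norm h" for r'
  proof -
    have "cmod (f 0 r' - f 0 r - f 1 r * of_real (r' - r)) \<le> K / (r / 8) ^ 3 * (r' - r) ^ 2"
      unfolding f_def K_def using that r assms by (intro norm_radial_green_taylor) auto
    also have "\<dots> \<le> K / (r / 8) ^ 3 * norm h ^ 2"
      using that(3) K r abs_le_square_iff[of "r' - r" "norm h"] by (intro mult_left_mono) auto
    finally show ?thesis using r by (simp add: power_divide mult_ac)
  qed
  have F: "cmod (f 1 r * of_real (r1 + r2 - 2 * r)) \<le> (4 * k + 1) * norm h ^ 2 / r ^ 3"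
  proof -
    have "cmod (f 1 r * of_real (r1 + r2 - 2 * r)) \<le> (4 * k + 1) / r ^ 2 * (norm h ^ 2 / r)"
      unfolding norm_mult norm_of_real f_def using s r assms(1) norm_radial_green_1[of k r]
      by (intro mult_mono) auto
    then show ?thesis by (simp add: power2_eq_square power3_eq_cube mult_ac)
  qed
  have "green k (x + h) y + green k (x - h) y - 2 * green k x y =
     (f 0 r1 - f 0 r - f 1 r * of_real (r1 - r)) + (f 0 r2 - f 0 r - f 1 r * of_real (r2 - r))
     + f 1 r * of_real (r1 + r2 - 2 * r)"
    unfolding green_eq_radial f_def r_def r1_def r2_def by (simp add: algebra_simps)
  also have "cmod \<dots> \<le> 512 * K * norm h ^ 2 / r ^ 3 + 512 * K * norm h ^ 2 / r ^ 3 + (4 * k + 1) * norm h ^ 2 / r ^ 3"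
    using T[of r1] T[of r2] F b d by (intro norm_triangle_mono) auto
  also have "\<dots> = C * norm h ^ 2 / r ^ 3"
    unfolding C_def K_def[symmetric] by (simp add: algebra_simps add_divide_distrib)
  finally show ?thesis by (simp add: r_def)
qed

section \<open>Potentials of bounded densities\<close>

lemma borel_measurable_lebesgue_on:
  "f \<in> borel_measurable borel \<Longrightarrow> f \<in> borel_measurable (lebesgue_on S)"
  by (simp add: measurable_completion measurable_restrict_space1)

lemma borel_measurable_green [measurable]: "(\<lambda>y. green k x y) \<in> borel_measurable borel"
  unfolding green_def by measurable

lemma measurable_bounded_by_integrable_on_cube:
  fixes f :: "real^3 \<Rightarrow> complex"
  assumes "f \<in> borel_measurable (lebesgue_on unit_cube)" "g integrable_on unit_cube"
    and "\<And>y. y \<in> unit_cube \<Longrightarrow> cmod (f y) \<le> g y" "integral unit_cube g \<le> c"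
  shows "f absolutely_integrable_on unit_cube"
    and "integral unit_cube (\<lambda>y. cmod (f y)) \<le> c"
    and "cmod (integral unit_cube f) \<le> c"
proof -
  show abs: "f absolutely_integrable_on unit_cube"
    using assms by (intro measurable_bounded_by_integrable_imp_absolutely_integrable[of _ _ g]) auto
  then have int: "f integrable_on unit_cube" "(\<lambda>y. cmod (f y)) integrable_on unit_cube"
    by (auto simp: absolutely_integrable_on_def)
  show "integral unit_cube (\<lambda>y. cmod (f y)) \<le> c"
    using integral_le[OF int(2) assms(2)] assms(3,4) by force
  then show "cmod (integral unit_cube f) \<le> c"
    using integral_norm_bound_integral[OF int(1,2)] by force
qed

text \<open>Trades one power of the singularity for the radius, so that only inverse squares need to be
  integrated.\<close>

lemma inverse_norm_le:
  fixes v :: "'a::real_normed_vector"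
  assumes "norm v \<le> R"
  shows "1 / norm v \<le> R * (1 / norm v ^ 2)"
proof -
  have "1 / norm v = norm v * (1 / norm v ^ 2)" by (auto simp: power2_eq_square)
  also have "\<dots> \<le> R * (1 / norm v ^ 2)" using assms by (intro mult_right_mono) auto
  finally show ?thesis .
qed

lemma potential_integrable:
  assumes w: "w \<in> borel_measurable (lebesgue_on unit_cube)"
    and B: "\<And>y. y \<in> unit_cube \<Longrightarrow> cmod (w y) \<le> B" and x: "x \<in> unit_cube"
  shows "(\<lambda>y. green k x y * w y) absolutely_integrable_on unit_cube"
    and "integral unit_cube (\<lambda>y. cmod (green k x y * w y)) \<le> 256 * B"
    and "cmod (integral unit_cube (\<lambda>y. green k x y * w y)) \<le> 256 * B"
proof -
  have B0: "B \<ge> 0"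
    using B[OF x] norm_ge_zero order_trans by blast
  note sq = integral_inverse_square_cube[OF x]
  define g where "g y = 2 * B * (1 / norm (x - y) ^ 2)" for y
  have g: "g integrable_on unit_cube"
    unfolding g_def by (intro integrable_on_mult_right sq)
  have "integral unit_cube g = 2 * B * integral unit_cube (\<lambda>y. 1 / norm (x - y) ^ 2)"
    unfolding g_def by (rule integral_mult_right)
  also have "\<dots> \<le> 2 * B * 128"
    using sq B0 by (intro mult_left_mono) auto
  finally have g': "integral unit_cube g \<le> 256 * B" by simp
  have le: "cmod (green k x y * w y) \<le> g y" if "y \<in> unit_cube" for y
  proof -
    have "cmod (green k x y * w y) \<le> 1 / norm (x - y) * B"
      unfolding norm_mult by (intro mult_mono norm_green_le B that) auto
    also have "1 / norm (x - y) \<le> 2 * (1 / norm (x - y) ^ 2)"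
      using norm_diff_unit_cube[OF x that] by (rule inverse_norm_le)
    finally show ?thesis
      using B0 by (simp add: g_def mult_right_mono mult.commute)
  qed
  have m: "(\<lambda>y. green k x y * w y) \<in> borel_measurable (lebesgue_on unit_cube)"
    by (intro borel_measurable_times w borel_measurable_lebesgue_on borel_measurable_green)
  note * = measurable_bounded_by_integrable_on_cube[OF m g le g']
  show "(\<lambda>y. green k x y * w y) absolutely_integrable_on unit_cube"
    "integral unit_cube (\<lambda>y. cmod (green k x y * w y)) \<le> 256 * B"
    "cmod (integral unit_cube (\<lambda>y. green k x y * w y)) \<le> 256 * B"
    by (rule *; assumption)+
qed

lemma potential_lipschitz:
  assumes w: "w \<in> borel_measurable (lebesgue_on unit_cube)"
    and B: "\<And>y. y \<in> unit_cube \<Longrightarrow> cmod (w y) \<le> B" and x: "x \<in> unit_cube" "x' \<in> unit_cube" and k: "k \<ge> 0"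
  shows "integral unit_cube (\<lambda>y. cmod (green k x y * w y - green k x' y * w y))
           \<le> 256 * (4 * k + 1) * B * norm (x - x')"
    and "cmod (integral unit_cube (\<lambda>y. green k x y * w y) - integral unit_cube (\<lambda>y. green k x' y * w y))
           \<le> 256 * (4 * k + 1) * B * norm (x - x')"
proof -
  have B0: "B \<ge> 0"
    using B[OF x(1)] norm_ge_zero order_trans by blast
  note sq = integral_inverse_square_cube[OF x(1)] integral_inverse_square_cube[OF x(2)]
  define c where "c = (4 * k + 1) * norm (x - x') * B"
  have c: "c \<ge> 0" using B0 k by (simp add: c_def)
  define g where "g y = c * (1 / norm (x - y) ^ 2 + 1 / norm (x' - y) ^ 2)" for y
  have g1: "g integrable_on unit_cube"
    unfolding g_def by (intro integrable_on_mult_right integrable_add sq)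
  have "integral unit_cube g = c * (integral unit_cube (\<lambda>y. 1 / norm (x - y) ^ 2) + integral unit_cube (\<lambda>y. 1 / norm (x' - y) ^ 2))"
    unfolding g_def by (subst integral_mult_right, subst integral_add) (use sq in auto)
  also have "\<dots> \<le> c * (128 + 128)"
    using sq c by (intro mult_left_mono add_mono) auto
  finally have g2: "integral unit_cube g \<le> 256 * (4 * k + 1) * B * norm (x - x')"
    by (simp add: c_def mult_ac)
  have le: "cmod (green k x y * w y - green k x' y * w y) \<le> g y" if "y \<in> unit_cube" for y
  proof -
    have "norm (x - y) \<le> 4" "norm (x' - y) \<le> 4"
      using norm_diff_unit_cube[OF x(1) that] norm_diff_unit_cube[OF x(2) that] by auto
    note green = norm_green_diff[OF k this]
    have "cmod (green k x y * w y - green k x' y * w y) = cmod (green k x y - green k x' y) * cmod (w y)"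
      by (simp add: left_diff_distrib flip: norm_mult)
    also have "\<dots> \<le> ((4 * k + 1) * norm (x - x') * (1 / norm (x - y) ^ 2 + 1 / norm (x' - y) ^ 2)) * B"
      using k by (intro mult_mono green B that) auto
    finally show ?thesis
      by (simp add: g_def c_def mult_ac)
  qed
  have m: "(\<lambda>y. green k x y * w y - green k x' y * w y) \<in> borel_measurable (lebesgue_on unit_cube)"
    by (intro borel_measurable_times borel_measurable_diff w borel_measurable_lebesgue_on borel_measurable_green)
  note * = measurable_bounded_by_integrable_on_cube[OF m g1 le g2]
  show "integral unit_cube (\<lambda>y. cmod (green k x y * w y - green k x' y * w y))
           \<le> 256 * (4 * k + 1) * B * norm (x - x')"
    by (rule *; assumption)
  have "integral unit_cube (\<lambda>y. green k x y * w y) - integral unit_cube (\<lambda>y. green k x' y * w y)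
    = integral unit_cube (\<lambda>y. green k x y * w y - green k x' y * w y)"
    using potential_integrable(1)[OF w B x(1)] potential_integrable(1)[OF w B x(2)]
    by (subst integral_diff) (auto simp: absolutely_integrable_on_def)
  then show "cmod (integral unit_cube (\<lambda>y. green k x y * w y) - integral unit_cube (\<lambda>y. green k x' y * w y))
           \<le> 256 * (4 * k + 1) * B * norm (x - x')"
    using *(3) by simp
qed

lemma integral_inverse_square_cube_near:
  fixes z :: "real^3"
  assumes "R \<ge> 0"
  defines "q \<equiv> \<lambda>y. if y \<in> cball z R then 1 / norm (z - y) ^ 2 else 0"
  shows "q integrable_on unit_cube" and "integral unit_cube q \<le> 64 * R"
proof -
  note c = integral_inverse_square_cball[OF assms(1), of z]
  have q: "q integrable_on UNIV" "integral UNIV q = integral (cball z R) (\<lambda>y. 1 / norm (z - y) ^ 2)"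
    using c(1) unfolding q_def by (simp_all only: integrable_restrict_UNIV integral_restrict_UNIV)
  show int: "q integrable_on unit_cube"
    using integrable_on_subcbox[OF q(1)] by simp
  have "integral unit_cube q \<le> integral UNIV q"
    using int q(1) by (intro integral_subset_le) (auto simp: q_def)
  then show "integral unit_cube q \<le> 64 * R" using q(2) c(2) by simp
qed

text \<open>Outside the ball \<open>|x - y| < 2 |h|\<close> the second difference of the kernel is \<open>O(|h|\<^sup>2 / |x - y|\<^sup>3)\<close>, and its
  integral is \<open>O(|h|\<^sup>2 log (1 / |h|))\<close>. Inside, the three kernels are estimated one by one: each is integrated over a
  ball of radius \<open>3 |h|\<close> around its own singularity, which costs only \<open>O(|h|\<^sup>2)\<close>. The
  density enters through its bound alone, so its jump at the boundary of the cube does no harm.\<close>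

lemma potential_second_diff:
  assumes w: "w \<in> borel_measurable (lebesgue_on unit_cube)"
    and B: "\<And>y. y \<in> unit_cube \<Longrightarrow> cmod (w y) \<le> B"
    and x: "x \<in> unit_cube" "x + h \<in> unit_cube" "x - h \<in> unit_cube" and k: "k \<ge> 0"
    and h: "h \<noteq> 0" "norm h \<le> 1 / 2"
  defines "C \<equiv> 4 * k + 1 + 1024 * (16 * k ^ 2 + 8 * k + 2)"
    and "U \<equiv> \<lambda>x. integral unit_cube (\<lambda>y. green k x y * w y)"
  shows "cmod (U (x + h) + U (x - h) - 2 * U x) \<le> (128 * C + 2304) * B * (norm h ^ 2 * (1 + ln (1 / norm h)))"
proof -
  have B0: "B \<ge> 0"
    using B[OF x(1)] norm_ge_zero order_trans by blast
  have C0: "C \<ge> 0" using k by (simp add: C_def)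
  define r where "r = norm h"
  have r: "0 < r" "r \<le> 1/2" using h by (auto simp: r_def)
  define F where "F = {y\<in>unit_cube. 2 * r \<le> norm (x - y)}"
  define f where "f y = (if y \<in> F then 1 / norm (x - y) ^ 3 else 0)" for y
  define q where "q z y = (if y \<in> cball z (3 * r) then 1 / norm (z - y) ^ 2 else 0)" for z y :: "real^3"
  have "F \<inter> unit_cube = F" by (auto simp: F_def)
  then have f: "f integrable_on unit_cube" "integral unit_cube f \<le> 128 * (1 + ln (1 / r))"
  proof -
    assume F: "F \<inter> unit_cube = F"
    note e = integral_inverse_cube_far[OF x(1), of "2 * r", folded F_def]
    show "f integrable_on unit_cube"
      using e(1) r F unfolding f_def by (simp add: integrable_restrict_Int Int_commute)
    have "integral unit_cube f = integral F (\<lambda>y. 1 / norm (x - y) ^ 3)"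
      using F unfolding f_def by (simp add: integral_restrict_Int Int_commute)
    also have "\<dots> \<le> 128 * (1 + ln (1 / (2 * r)))"
      using e(2) r by simp
    also have "ln (1 / (2 * r)) \<le> ln (1 / r)"
      using r by (simp add: ln_div ln_mult)
    finally show "integral unit_cube f \<le> 128 * (1 + ln (1 / r))" by simp
  qed
  have q: "q z integrable_on unit_cube" "integral unit_cube (q z) \<le> 192 * r" for z
    using integral_inverse_square_cube_near[of "3 * r" z] r unfolding q_def by auto
  have f0: "f y \<ge> 0" "q z y \<ge> 0" for y z by (auto simp: f_def q_def)
  define g where "g y = B * (C * r ^ 2) * f y + B * (3 * r) * (q (x + h) y + q (x - h) y + 2 * q x y)" for y
  have g1: "g integrable_on unit_cube"
    unfolding g_def by (intro integrable_on_mult_right integrable_add f q)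
  have "integral unit_cube g = B * (C * r ^ 2) * integral unit_cube f +
     B * (3 * r) * (integral unit_cube (q (x + h)) + integral unit_cube (q (x - h)) + 2 * integral unit_cube (q x))"
    unfolding g_def
    by (simp add: integral_add integral_mult_right integrable_on_mult_right integrable_add f q)
  also have "\<dots> \<le> B * (C * r ^ 2) * (128 * (1 + ln (1 / r))) + B * (3 * r) * (192 * r + 192 * r + 2 * (192 * r))"
    by (intro mult_left_mono add_mono f q mult_nonneg_nonneg B0 C0) (use r in auto)
  also have "\<dots> = 128 * C * B * (r ^ 2 * (1 + ln (1 / r))) + 2304 * B * (r ^ 2 * 1)"
    by (simp add: power2_eq_square algebra_simps)
  also have "\<dots> \<le> 128 * C * B * (r ^ 2 * (1 + ln (1 / r))) + 2304 * B * (r ^ 2 * (1 + ln (1 / r)))"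
    using B0 r by (intro add_mono mult_left_mono order_refl) auto
  finally have g2: "integral unit_cube g \<le> (128 * C + 2304) * B * (r ^ 2 * (1 + ln (1 / r)))"
    by (simp only: distrib_right)
  define d where "d y = green k (x + h) y + green k (x - h) y - 2 * green k x y" for y
  have le: "cmod (d y * w y) \<le> g y" if y: "y \<in> unit_cube" for y
  proof -
    have "cmod (d y) \<le> C * r ^ 2 * f y + 3 * r * (q (x + h) y + q (x - h) y + 2 * q x y)"
    proof (cases "y \<in> F")
      case True
      then have far: "2 * r \<le> norm (x - y)" by (simp add: F_def)
      have "norm h \<le> 7 / 8 * norm (x - y)"
        using far r(1) unfolding r_def by linarith
      moreover have "x \<noteq> y" "norm (x - y) \<le> 2"
        using far norm_diff_unit_cube[OF x(1) y] r by auto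
      ultimately have "x \<noteq> y" "norm (x - y) \<le> 2" "norm h \<le> 7 / 8 * norm (x - y)" by auto
      from norm_green_second_diff[OF k this] have "cmod (d y) \<le> C * r ^ 2 * f y"
        using True by (simp add: d_def C_def f_def r_def)
      then show ?thesis using f0 r by (simp add: add_increasing2)
    next
      case False
      then have near: "norm (x - y) < 2 * r" using y by (auto simp: F_def)
      have G: "cmod (green k z y) \<le> 3 * r * q z y" if "norm (z - y) \<le> 3 * r" for z
      proof -
        have "cmod (green k z y) \<le> 1 / norm (z - y)" by (rule norm_green_le)
        also have "\<dots> \<le> 3 * r * (1 / norm (z - y) ^ 2)" using that by (rule inverse_norm_le)
        finally show ?thesis using that by (simp add: q_def dist_norm)
      qed
      have e: "x + h - y = (x - y) + h" "x - h - y = (x - y) - h" by simp_all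
      have n: "norm (x + h - y) \<le> 3 * r" "norm (x - h - y) \<le> 3 * r" "norm (x - y) \<le> 3 * r"
        using near r(1) norm_triangle_ineq[of "x - y" h] norm_triangle_ineq4[of "x - y" h]
        unfolding r_def e by linarith+
      have "cmod (d y) \<le> cmod (green k (x + h) y) + cmod (green k (x - h) y) + 2 * cmod (green k x y)"
        unfolding d_def
        by (rule order_trans[OF norm_triangle_ineq4]) (simp add: norm_mult norm_triangle_ineq)
      also have "\<dots> \<le> 3 * r * q (x + h) y + 3 * r * q (x - h) y + 2 * (3 * r * q x y)"
        by (intro add_mono mult_left_mono G n) auto
      also have "\<dots> \<le> C * r ^ 2 * f y + 3 * r * (q (x + h) y + q (x - h) y + 2 * q x y)"
        using f0[of y] C0 by (simp add: algebra_simps)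
      finally show ?thesis .
    qed
    then have "cmod (d y * w y) \<le> (C * r ^ 2 * f y + 3 * r * (q (x + h) y + q (x - h) y + 2 * q x y)) * B"
      unfolding norm_mult by (rule mult_mono[OF _ B[OF y]]) (use f0 C0 r in auto)
    then show ?thesis by (simp add: g_def algebra_simps)
  qed
  have m: "(\<lambda>y. d y * w y) \<in> borel_measurable (lebesgue_on unit_cube)"
    unfolding d_def
    by (intro borel_measurable_times borel_measurable_diff borel_measurable_add borel_measurable_const
        w borel_measurable_lebesgue_on borel_measurable_green)
  have i: "(\<lambda>y. green k z y * w y) integrable_on unit_cube" if "z \<in> unit_cube" for z
    using potential_integrable(1)[OF w B that, of k] by (simp add: absolutely_integrable_on_def)
  have "((\<lambda>y. green k (x + h) y * w y + green k (x - h) y * w y - 2 * (green k x y * w y)) has_integral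
      (U (x + h) + U (x - h) - 2 * U x)) unit_cube"
    unfolding U_def by (intro has_integral_diff has_integral_add has_integral_mult_right integrable_integral i x)
  then have "U (x + h) + U (x - h) - 2 * U x = integral unit_cube (\<lambda>y. d y * w y)"
    by (simp add: d_def algebra_simps integral_unique)
  then show ?thesis
    using measurable_bounded_by_integrable_on_cube(3)[OF m g1 le g2] by (simp add: r_def)
qed

section \<open>Functions with a log-Lipschitz gradient\<close>

text \<open>A quantitative form of continuous differentiability with a gradient of modulus of continuity
  \<open>t log (1 / t)\<close>, expressed by second differences and with a single constant. The solution \<open>u\<close> belongs to this class.
  It need not have bounded second derivatives: the density \<open>p u\<close> jumps to 0 across the
  boundary of the cube, and the second derivatives of such potentials can be logarithmically unbounded
  at the edges. The bound \<open>|h| \<le> 1 / 2\<close> keeps the logarithm positive.\<close>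

definition log_C11 :: "real \<Rightarrow> (real^3 \<Rightarrow> complex) \<Rightarrow> bool" where
  "log_C11 L f \<longleftrightarrow> (\<forall>x\<in>unit_cube. cmod (f x) \<le> L) \<and>
     (\<forall>x\<in>unit_cube. \<forall>y\<in>unit_cube. cmod (f x - f y) \<le> L * norm (x - y)) \<and>
     (\<forall>x h. x \<in> unit_cube \<longrightarrow> x + h \<in> unit_cube \<longrightarrow> x - h \<in> unit_cube \<longrightarrow> h \<noteq> 0 \<longrightarrow> norm h \<le> 1 / 2 \<longrightarrow>
        cmod (f (x + h) + f (x - h) - 2 * f x) \<le> L * (norm h ^ 2 * (1 + ln (1 / norm h))))"

lemma log_C11_nonneg: "log_C11 L f \<Longrightarrow> 0 \<le> L"
proof -
  assume "log_C11 L f"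
  then have "cmod (f 0) \<le> L" by (auto simp: log_C11_def mem_box_cart)
  then show ?thesis using norm_ge_zero order_trans by blast
qed

lemma log_modulus_ge:
  fixes h :: "real^3"
  assumes "h \<noteq> 0" "norm h \<le> 1 / 2"
  shows "norm h ^ 2 \<le> norm h ^ 2 * (1 + ln (1 / norm h))" "0 \<le> norm h ^ 2 * (1 + ln (1 / norm h))"
proof -
  have "0 \<le> ln (1 / norm h)"
    using assms by (intro ln_ge_zero) auto
  then show "norm h ^ 2 \<le> norm h ^ 2 * (1 + ln (1 / norm h))" "0 \<le> norm h ^ 2 * (1 + ln (1 / norm h))"
    using mult_left_mono[of 1 "1 + ln (1 / norm h)" "norm h ^ 2"] by auto
qed

lemma log_C11_diff:
  assumes f: "log_C11 L f" and g: "log_C11 M g"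
  shows "log_C11 (L + M) (\<lambda>x. f x - g x)"
  unfolding log_C11_def
proof (intro conjI ballI allI impI)
  fix x assume "x \<in> unit_cube"
  then have "cmod (f x) \<le> L" "cmod (g x) \<le> M" using assms by (auto simp: log_C11_def)
  then show "cmod (f x - g x) \<le> L + M" using norm_triangle_ineq4[of "f x" "g x"] by linarith
next
  fix x y assume "x \<in> unit_cube" "y \<in> unit_cube"
  then have a: "cmod (f x - f y) \<le> L * norm (x - y)" "cmod (g x - g y) \<le> M * norm (x - y)"
    using assms by (auto simp: log_C11_def)
  have "cmod (f x - g x - (f y - g y)) = cmod ((f x - f y) - (g x - g y))"
    by (simp add: algebra_simps)
  also have "\<dots> \<le> L * norm (x - y) + M * norm (x - y)"
    using a norm_triangle_ineq4[of "f x - f y" "g x - g y"] by linarith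
  finally show "cmod (f x - g x - (f y - g y)) \<le> (L + M) * norm (x - y)" by (simp add: distrib_right)
next
  fix x h :: "real^3" assume a: "x \<in> unit_cube" "x + h \<in> unit_cube" "x - h \<in> unit_cube" "h \<noteq> 0" "norm h \<le> 1 / 2"
  define s where "s = norm h ^ 2 * (1 + ln (1 / norm h))"
  have b: "cmod (f (x + h) + f (x - h) - 2 * f x) \<le> L * s" "cmod (g (x + h) + g (x - h) - 2 * g x) \<le> M * s"
    using a assms by (auto simp: log_C11_def s_def)
  have "f (x + h) - g (x + h) + (f (x - h) - g (x - h)) - 2 * (f x - g x) =
      (f (x + h) + f (x - h) - 2 * f x) - (g (x + h) + g (x - h) - 2 * g x)"
    by (simp add: algebra_simps)
  also have "cmod \<dots> \<le> L * s + M * s"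
    using b norm_triangle_ineq4 by (meson add_mono order_trans)
  finally show "cmod (f (x + h) - g (x + h) + (f (x - h) - g (x - h)) - 2 * (f x - g x))
       \<le> (L + M) * (norm h ^ 2 * (1 + ln (1 / norm h)))" by (simp add: distrib_right s_def)
qed

text \<open>The discrete Leibniz rule, with \<open>f1\<close>, \<open>f2\<close> and \<open>g1\<close>, \<open>g2\<close> in the role of the values at \<open>x + h\<close> and \<open>x - h\<close>.\<close>

lemma second_diff_mult:
  fixes f f1 f2 g g1 g2 :: complex
  assumes "cmod f \<le> A" "cmod g \<le> B" "cmod (f1 - f) \<le> a" "cmod (f2 - f) \<le> a" "cmod (g1 - g) \<le> b" "cmod (g2 - g) \<le> b"
    "cmod (f1 + f2 - 2 * f) \<le> a'" "cmod (g1 + g2 - 2 * g) \<le> b'"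
  shows "cmod (f1 * g1 + f2 * g2 - 2 * (f * g)) \<le> A * b' + B * a' + 2 * (a * b)"
proof -
  have "f1 * g1 + f2 * g2 - 2 * (f * g) = f * (g1 + g2 - 2 * g) + g * (f1 + f2 - 2 * f)
      + ((f1 - f) * (g1 - g) + (f2 - f) * (g2 - g))"
    by (simp add: algebra_simps)
  also have "cmod \<dots> \<le> A * b' + B * a' + (a * b + a * b)"
    using assms unfolding norm_mult
    by (intro norm_triangle_mono) (auto simp: norm_mult intro!: mult_mono norm_ge_zero intro: order_trans[OF norm_ge_zero])
  finally show ?thesis by simp
qed

lemma log_C11_mult:
  assumes f: "log_C11 L f" and g: "log_C11 M g"
  shows "log_C11 (4 * L * M) (\<lambda>x. f x * g x)"
  unfolding log_C11_def
proof (intro conjI ballI allI impI)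
  have LM: "0 \<le> L" "0 \<le> M" using assms log_C11_nonneg by auto
  have bd: "cmod (f x) \<le> L" "cmod (g x) \<le> M" if "x \<in> unit_cube" for x
    using that assms by (auto simp: log_C11_def)
  have lip: "cmod (f x - f y) \<le> L * norm (x - y)" "cmod (g x - g y) \<le> M * norm (x - y)"
    if "x \<in> unit_cube" "y \<in> unit_cube" for x y
    using that assms by (auto simp: log_C11_def)
  have LM': "0 \<le> L * M" using LM by simp
  {
    fix x assume "x \<in> unit_cube"
    then have "cmod (f x * g x) \<le> L * M" unfolding norm_mult using LM by (intro mult_mono bd) auto
    then show "cmod (f x * g x) \<le> 4 * L * M" using LM' by linarith
  next
    fix x y assume xy: "x \<in> unit_cube" "y \<in> unit_cube"
    have "f x * g x - f y * g y = f x * (g x - g y) + (f x - f y) * g y" by (simp add: algebra_simps)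
    also have "cmod \<dots> \<le> L * (M * norm (x - y)) + L * norm (x - y) * M"
      using LM xy by (intro norm_triangle_mono) (auto simp: norm_mult intro!: mult_mono bd lip)
    also have "\<dots> \<le> 4 * L * M * norm (x - y)"
      using mult_nonneg_nonneg[OF LM' norm_ge_zero[of "x - y"]] by (simp add: algebra_simps)
    finally show "cmod (f x * g x - f y * g y) \<le> 4 * L * M * norm (x - y)" .
  next
    fix x h :: "real^3" assume a: "x \<in> unit_cube" "x + h \<in> unit_cube" "x - h \<in> unit_cube" "h \<noteq> 0" "norm h \<le> 1 / 2"
    define s where "s = norm h ^ 2 * (1 + ln (1 / norm h))"
    have s: "norm h ^ 2 \<le> s" using log_modulus_ge[OF a(4,5)] by (simp add: s_def)
    have b: "cmod (f (x + h) + f (x - h) - 2 * f x) \<le> L * s" "cmod (g (x + h) + g (x - h) - 2 * g x) \<le> M * s"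
      using a assms by (auto simp: log_C11_def s_def)
    have "cmod (f (x + h) * g (x + h) + f (x - h) * g (x - h) - 2 * (f x * g x))
      \<le> L * (M * s) + M * (L * s) + 2 * ((L * norm h) * (M * norm h))"
      using lip[OF a(2,1)] lip[OF a(3,1)] by (intro second_diff_mult b bd a) auto
    also have "\<dots> = L * M * (2 * s + 2 * norm h ^ 2)" by (simp add: power2_eq_square algebra_simps)
    also have "\<dots> \<le> L * M * (4 * s)" using s LM' by (intro mult_left_mono) auto
    finally show "cmod (f (x + h) * g (x + h) + f (x - h) * g (x - h) - 2 * (f x * g x))
       \<le> 4 * L * M * (norm h ^ 2 * (1 + ln (1 / norm h)))" by (simp add: s_def)
  }
qed

lemma log_C11_continuous: "log_C11 L f \<Longrightarrow> continuous_on unit_cube f"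
  using log_C11_nonneg[of L f]
  by (intro lipschitz_on_continuous_on[of L]) (auto simp: lipschitz_on_def log_C11_def dist_norm)

lemma log_C11_potential:
  assumes w: "w \<in> borel_measurable (lebesgue_on unit_cube)"
    and B: "\<And>y. y \<in> unit_cube \<Longrightarrow> cmod (w y) \<le> B" and k: "k \<ge> 0"
  shows "\<exists>L. log_C11 L (\<lambda>x. integral unit_cube (\<lambda>y. green k x y * w y))"
proof -
  have "(0::real^3) \<in> unit_cube" by (simp add: mem_box_cart)
  then have B0: "B \<ge> 0"
    using B norm_ge_zero order_trans by blast
  define C where "C = 128 * (4 * k + 1 + 1024 * (16 * k ^ 2 + 8 * k + 2)) + 2304"
  define D where "D = C * B + 256 * (4 * k + 1) * B + 256 * B"
  have D: "256 * B \<le> D" "256 * (4 * k + 1) * B \<le> D" "C * B \<le> D"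
    using B0 k by (auto simp: D_def C_def)
  have "log_C11 D (\<lambda>x. integral unit_cube (\<lambda>y. green k x y * w y))"
    unfolding log_C11_def
  proof (intro conjI ballI allI impI)
    fix x assume "x \<in> unit_cube"
    then show "cmod (integral unit_cube (\<lambda>y. green k x y * w y)) \<le> D"
      using potential_integrable(3)[OF w B, of x k] D by linarith
  next
    fix x x' assume "x \<in> unit_cube" "x' \<in> unit_cube"
    then have "cmod (integral unit_cube (\<lambda>y. green k x y * w y) -
        integral unit_cube (\<lambda>y. green k x' y * w y)) \<le> 256 * (4 * k + 1) * B * norm (x - x')"
      by (intro potential_lipschitz(2) w B k)
    then show "cmod (integral unit_cube (\<lambda>y. green k x y * w y) -
        integral unit_cube (\<lambda>y. green k x' y * w y)) \<le> D * norm (x - x')"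
      using mult_right_mono[OF D(2) norm_ge_zero[of "x - x'"]] by linarith
  next
    fix x h :: "real^3" assume a: "x \<in> unit_cube" "x + h \<in> unit_cube" "x - h \<in> unit_cube" "h \<noteq> 0" "norm h \<le> 1 / 2"
    from potential_second_diff[OF w B a(1,2,3) k a(4,5), folded C_def]
      mult_right_mono[OF D(3) log_modulus_ge(2)[OF a(4,5)]]
    show "cmod (integral unit_cube (\<lambda>y. green k (x + h) y * w y) + integral unit_cube (\<lambda>y. green k (x - h) y * w y)
        - 2 * integral unit_cube (\<lambda>y. green k x y * w y)) \<le> D * (norm h ^ 2 * (1 + ln (1 / norm h)))"
      by linarith
  qed
  then show ?thesis by blast
qed

section \<open>Regularity of the data and of the solution\<close>

lemma log_C11_cong:
  assumes "\<And>x. x \<in> unit_cube \<Longrightarrow> f x = g x"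
  shows "log_C11 L f \<longleftrightarrow> log_C11 L g"
  using assms by (simp add: log_C11_def)

lemma norm_exp_i_diff_le: "cmod (exp (\<i> * of_real s) - exp (\<i> * of_real t)) \<le> \<bar>s - t\<bar>"
proof -
  have "exp (\<i> * of_real s) - exp (\<i> * of_real t) = exp (\<i> * of_real t) * (exp (\<i> * of_real (s - t)) - 1)"
    by (simp add: algebra_simps flip: exp_add)
  then have "cmod (exp (\<i> * of_real s) - exp (\<i> * of_real t)) = 2 * \<bar>sin ((s - t) / 2)\<bar>"
    by (simp only: norm_mult norm_exp_i_times dist_exp_i_1 mult_1)
  also have "\<dots> \<le> 2 * \<bar>(s - t) / 2\<bar>"
    by (intro mult_left_mono abs_sin_x_le_abs_x) auto
  finally show ?thesis by simp
qed

text \<open>The wave is a character of the additive group, so its second difference is a unimodular factor times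
  the square of the first difference at 0.\<close>

lemma log_C11_plane_wave:
  assumes "k > 0" "norm \<alpha> = 1"
  shows "log_C11 (1 + k + k ^ 2) (plane_wave k \<alpha>)"
  unfolding log_C11_def
proof (intro conjI ballI allI impI)
  have inner: "\<bar>\<alpha> \<bullet> v\<bar> \<le> norm v" for v
    using Cauchy_Schwarz_ineq2[of \<alpha> v] assms by simp
  {
    fix x
    show "cmod (plane_wave k \<alpha> x) \<le> 1 + k + k\<^sup>2"
      using assms unfolding plane_wave_def norm_exp_i_times by simp
  next
    fix x y
    have "cmod (plane_wave k \<alpha> x - plane_wave k \<alpha> y) \<le> \<bar>k * (\<alpha> \<bullet> x) - k * (\<alpha> \<bullet> y)\<bar>"
      unfolding plane_wave_def by (rule norm_exp_i_diff_le)
    also have "\<dots> = k * \<bar>\<alpha> \<bullet> (x - y)\<bar>"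
      using assms by (simp add: inner_diff_right right_diff_distrib[symmetric] abs_mult)
    also have "\<dots> \<le> k * norm (x - y)"
      using assms inner by (intro mult_left_mono) auto
    also have "\<dots> \<le> (1 + k + k\<^sup>2) * norm (x - y)"
      using assms by (intro mult_right_mono) auto
    finally show "cmod (plane_wave k \<alpha> x - plane_wave k \<alpha> y) \<le> (1 + k + k\<^sup>2) * norm (x - y)" .
  next
    fix x h :: "real^3" assume h: "h \<noteq> 0" "norm h \<le> 1 / 2"
    have E: "plane_wave k \<alpha> (x + v) = plane_wave k \<alpha> x * plane_wave k \<alpha> v" for x v
      by (simp add: plane_wave_def inner_add_right distrib_left exp_add)
    have 0: "plane_wave k \<alpha> 0 = 1" by (simp add: plane_wave_def)
    have "plane_wave k \<alpha> (x + h) + plane_wave k \<alpha> (x - h) - 2 * plane_wave k \<alpha> x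
        = plane_wave k \<alpha> (x - h) * (plane_wave k \<alpha> h - plane_wave k \<alpha> 0) ^ 2"
      using E[of "x - h" h] E[of x h] 0 by (simp add: power2_eq_square algebra_simps)
    also have "cmod \<dots> = cmod (plane_wave k \<alpha> h - plane_wave k \<alpha> 0) ^ 2"
      unfolding norm_mult norm_power by (simp only: plane_wave_def norm_exp_i_times mult_1)
    also have "\<dots> \<le> (k * norm h) ^ 2"
    proof (intro power_mono norm_ge_zero)
      have "cmod (plane_wave k \<alpha> h - plane_wave k \<alpha> 0) \<le> \<bar>k * (\<alpha> \<bullet> h) - k * (\<alpha> \<bullet> 0)\<bar>"
        unfolding plane_wave_def by (rule norm_exp_i_diff_le)
      also have "\<dots> = k * \<bar>\<alpha> \<bullet> h\<bar>" using assms by (simp add: abs_mult)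
      also have "\<dots> \<le> k * norm h" using assms inner by (intro mult_left_mono) auto
      finally show "cmod (plane_wave k \<alpha> h - plane_wave k \<alpha> 0) \<le> k * norm h" .
    qed
    also have "\<dots> = k ^ 2 * norm h ^ 2" by (simp add: power_mult_distrib)
    also have "\<dots> \<le> (1 + k + k\<^sup>2) * (norm h ^ 2 * (1 + ln (1 / norm h)))"
      using assms log_modulus_ge[OF h] by (intro mult_mono) auto
    finally show "cmod (plane_wave k \<alpha> (x + h) + plane_wave k \<alpha> (x - h) - 2 * plane_wave k \<alpha> x)
      \<le> (1 + k + k\<^sup>2) * (norm h ^ 2 * (1 + ln (1 / norm h)))" .
  }
qed

text \<open>Compactness bounds the derivatives, convexity of the cube gives the mean value inequality, and in the
  second difference the two linear Taylor terms cancel.\<close>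

lemma C2_on_imp_log_C11:
  assumes "C2_on unit_cube f"
  shows "\<exists>L. log_C11 L f"
proof -
  obtain f' f'' where f: "\<And>x. x \<in> unit_cube \<Longrightarrow> (f has_derivative blinfun_apply (f' x)) (at x within unit_cube)"
    and f': "\<And>x. x \<in> unit_cube \<Longrightarrow> (f' has_derivative blinfun_apply (f'' x)) (at x within unit_cube)"
    and f'': "continuous_on unit_cube f''"
    using assms unfolding C2_on_def by blast
  have bounded: "\<exists>B. \<forall>x\<in>unit_cube. norm (g x) \<le> B" if "continuous_on unit_cube g"
    for g :: "real^3 \<Rightarrow> 'b::real_normed_vector"
    using compact_imp_bounded[OF compact_continuous_image[OF that compact_cbox]] by (auto simp: bounded_iff)
  have "continuous_on unit_cube f" "continuous_on unit_cube f'"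
    using f f' by (auto simp: continuous_on_eq_continuous_within intro: has_derivative_continuous)
  with f'' obtain A0 A1 A2 where A: "\<And>x. x \<in> unit_cube \<Longrightarrow> norm (f x) \<le> A0"
    "\<And>x. x \<in> unit_cube \<Longrightarrow> norm (f' x) \<le> A1" "\<And>x. x \<in> unit_cube \<Longrightarrow> norm (f'' x) \<le> A2"
    using bounded by metis
  have "(0::real^3) \<in> unit_cube" by (simp add: mem_box_cart)
  then have A0: "0 \<le> A0" "0 \<le> A1" "0 \<le> A2"
    using A[of 0] norm_ge_zero order_trans by blast+
  have conv: "convex (unit_cube :: (real^3) set)" by (rule convex_box)
  have lip: "norm (f x - f y) \<le> A1 * norm (x - y)" if "x \<in> unit_cube" "y \<in> unit_cube" for x y
    using A f that by (intro differentiable_bound[OF conv, of f "\<lambda>x. blinfun_apply (f' x)"])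
      (auto simp flip: norm_blinfun.rep_eq)
  have lip': "norm (f' x - f' y) \<le> A2 * norm (x - y)" if "x \<in> unit_cube" "y \<in> unit_cube" for x y
    using A f' that by (intro differentiable_bound[OF conv, of f' "\<lambda>x. blinfun_apply (f'' x)"])
      (auto simp flip: norm_blinfun.rep_eq)
  have taylor: "norm (f (x + h) - f x - f' x h) \<le> A2 * norm h ^ 2"
    if x: "x \<in> unit_cube" "x + h \<in> unit_cube" for x h
  proof -
    define S where "S = closed_segment x (x + h)"
    have S: "S \<subseteq> unit_cube"
      using x conv unfolding S_def by (simp add: closed_segment_subset)
    have "norm (f (x + h) - f x - f' x (x + h - x)) \<le> norm (x + h - x) * (A2 * norm h)"
    proof (rule differentiable_bound_linearization)
      show "x + t *\<^sub>R (x + h - x) \<in> S" if "t \<in> {0..1}" for t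
        using that unfolding S_def closed_segment_def by (auto simp: algebra_simps intro!: exI[of _ t])
      show "x \<in> S" by (simp add: S_def)
      fix y assume y: "y \<in> S"
      then show "(f has_derivative blinfun_apply (f' y)) (at y within S)"
        using S f has_derivative_subset by blast
      have "onorm (blinfun_apply (f' y) - blinfun_apply (f' x)) = norm (f' y - f' x)"
        unfolding norm_blinfun.rep_eq minus_blinfun.rep_eq by (simp add: fun_diff_def)
      also have "\<dots> \<le> A2 * norm (y - x)" using y S x by (intro lip') auto
      also have "\<dots> \<le> A2 * norm h"
      proof (intro mult_left_mono A0)
        have "norm (y - x) \<le> norm (x + h - x)"
          using y unfolding S_def by (metis segment_bound(1) norm_minus_commute)
        then show "norm (y - x) \<le> norm h" by simp
      qed
      finally show "onorm (blinfun_apply (f' y) - blinfun_apply (f' x)) \<le> A2 * norm h" .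
    qed
    then show ?thesis by (simp add: power2_eq_square mult_ac)
  qed
  have "log_C11 (A0 + A1 + 2 * A2) f"
    unfolding log_C11_def
  proof (intro conjI ballI allI impI)
    fix x assume "x \<in> unit_cube"
    then show "cmod (f x) \<le> A0 + A1 + 2 * A2" using A(1)[of x] A0 by linarith
  next
    fix x y assume "x \<in> unit_cube" "y \<in> unit_cube"
    then have "cmod (f x - f y) \<le> A1 * norm (x - y)" by (rule lip)
    also have "\<dots> \<le> (A0 + A1 + 2 * A2) * norm (x - y)" using A0 by (intro mult_right_mono) auto
    finally show "cmod (f x - f y) \<le> (A0 + A1 + 2 * A2) * norm (x - y)" .
  next
    fix x h :: "real^3" assume a: "x \<in> unit_cube" "x + h \<in> unit_cube" "x - h \<in> unit_cube" "h \<noteq> 0" "norm h \<le> 1 / 2"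
    have "f (x + h) + f (x - h) - 2 * f x = (f (x + h) - f x - f' x h) + (f (x + - h) - f x - f' x (- h))"
      by (simp add: blinfun.minus_right)
    also have "cmod \<dots> \<le> A2 * norm h ^ 2 + A2 * norm (- h) ^ 2"
      using a by (intro norm_triangle_mono taylor) auto
    also have "\<dots> = 2 * A2 * norm h ^ 2" by simp
    also have "\<dots> \<le> (A0 + A1 + 2 * A2) * (norm h ^ 2 * (1 + ln (1 / norm h)))"
      using A0 log_modulus_ge[OF a(4,5)] by (intro mult_mono) auto
    finally show "cmod (f (x + h) + f (x - h) - 2 * f x) \<le> (A0 + A1 + 2 * A2) * (norm h ^ 2 * (1 + ln (1 / norm h)))" .
  qed
  then show ?thesis by blast
qed

lemma nn_integral_inverse_square_cube:
  fixes x :: "real^3"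
  assumes "x \<in> unit_cube"
  shows "(\<integral>\<^sup>+ y. ennreal (1 / norm (x - y) ^ 2) \<partial>lebesgue_on unit_cube) \<le> 128"
proof -
  note sq = integral_inverse_square_cube[OF assms]
  have "(\<lambda>y. 1 / norm (x - y) ^ 2) absolutely_integrable_on unit_cube"
    using sq by (subst absolutely_integrable_on_iff_nonneg) auto
  then have int: "integrable (lebesgue_on unit_cube) (\<lambda>y. 1 / norm (x - y) ^ 2)"
    by (intro absolutely_integrable_imp_integrable) auto
  then have "(\<integral>\<^sup>+ y. ennreal (1 / norm (x - y) ^ 2) \<partial>lebesgue_on unit_cube)
     = ennreal (integral\<^sup>L (lebesgue_on unit_cube) (\<lambda>y. 1 / norm (x - y) ^ 2))"
    by (intro nn_integral_eq_integral) auto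
  also have "integral\<^sup>L (lebesgue_on unit_cube) (\<lambda>y. 1 / norm (x - y) ^ 2) \<le> 128"
    using lebesgue_integral_eq_integral[OF int] sq(2) by simp
  then have "ennreal (integral\<^sup>L (lebesgue_on unit_cube) (\<lambda>y. 1 / norm (x - y) ^ 2)) \<le> ennreal 128"
    by (rule ennreal_leI)
  finally show ?thesis by simp
qed

text \<open>The kernel has no zeros off the diagonal, so the density is recovered from the integrand by division,
  apart from the singularity at 0.\<close>

lemma density_measurable:
  assumes "(\<lambda>y. green k 0 y * w y) \<in> borel_measurable (lebesgue_on unit_cube)"
  shows "w \<in> borel_measurable (lebesgue_on unit_cube)"
proof -
  have "(\<lambda>y. if y \<in> {0} then w 0 else green k 0 y * w y / green k 0 y) \<in> borel_measurable (lebesgue_on unit_cube)"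
  proof (rule measurable_If_set)
    show "(\<lambda>y. green k 0 y * w y / green k 0 y) \<in> borel_measurable (lebesgue_on unit_cube)"
      by (intro borel_measurable_divide assms borel_measurable_lebesgue_on borel_measurable_green)
    show "{0} \<inter> space (lebesgue_on unit_cube) \<in> sets (lebesgue_on unit_cube)"
      unfolding sets_restrict_space space_restrict_space by (rule image_eqI[of _ _ "{0}"]) auto
  qed auto
  also have "(\<lambda>y. if y \<in> {0} then w 0 else green k 0 y * w y / green k 0 y) = w"
  proof
    fix y :: "real^3"
    have "green k 0 y \<noteq> 0" if "y \<noteq> 0"
      using that by (simp add: green_def)
    then show "(if y \<in> {0} then w 0 else green k 0 y * w y / green k 0 y) = w y" by simp
  qed
  finally show ?thesis .
qed

text \<open>A priori only the convergence of the integrals is known. The corner 0 serves to show that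
  \<open>w = p u\<close> is measurable and integrable, as \<open>1 / |y|\<close> is bounded below on the cube. Inserting the equation for \<open>u\<close> once
  into the integral of \<open>|w (y)| / |x - y|\<close> and exchanging the integrations replaces the singular kernel
  by \<open>\<integral> 1 / (|x - y| |y - z|) dy\<close>, which is bounded in \<open>x\<close> and \<open>z\<close>; hence \<open>u\<close> is bounded in terms of the
  integral of \<open>|w|\<close>.\<close>

lemma solution_bounded:
  assumes k: "k > 0" and sol: "solves_integral_eq k \<alpha> p u" and p: "log_C11 B p"
  shows "(\<lambda>y. p y * u y) \<in> borel_measurable (lebesgue_on unit_cube)"
    and "\<exists>A. \<forall>x\<in>unit_cube. cmod (u x) \<le> A"
proof -
  define M where "M = lebesgue_on (unit_cube :: (real^3) set)"
  define w where "w y = p y * u y" for y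
  have B: "cmod (p y) \<le> B" if "y \<in> unit_cube" for y
    using p that by (auto simp: log_C11_def)
  have B0: "0 \<le> B" using log_C11_nonneg[OF p] .
  have spM: "space M = unit_cube" by (simp add: M_def)
  interpret fm: finite_measure M unfolding M_def by (rule finite_measure_lebesgue_on) simp
  interpret sigma_finite_measure M by standard
  interpret ps: pair_sigma_finite M M by standard
  have abs: "(\<lambda>y. green k x y * w y) absolutely_integrable_on unit_cube"
    and eq: "u x + integral unit_cube (\<lambda>y. green k x y * w y) = plane_wave k \<alpha> x" if "x \<in> unit_cube" for x
    using sol that unfolding solves_integral_eq_def w_def by (auto simp: mult.assoc)
  have int: "integrable M (\<lambda>y. green k x y * w y)" if "x \<in> unit_cube" for x
    unfolding M_def using abs[OF that] by (intro absolutely_integrable_imp_integrable) auto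
  have 0: "(0 :: real^3) \<in> unit_cube" by (simp add: mem_box_cart)
  have wM: "w \<in> borel_measurable M"
    using density_measurable[of k w] int[OF 0] by (auto simp: M_def)
  then show "(\<lambda>y. p y * u y) \<in> borel_measurable (lebesgue_on unit_cube)"
    by (simp add: M_def w_def[abs_def])
  have idM [measurable]: "(\<lambda>x. x) \<in> borel_measurable M"
    unfolding M_def by (intro borel_measurable_lebesgue_on) measurable
  note [measurable] = wM
  define I where "I = (\<integral>\<^sup>+ y. ennreal (cmod (w y)) \<partial>M)"
  have "I < \<infinity>"
  proof -
    have "I \<le> (\<integral>\<^sup>+ y. ennreal (8 * pi * cmod (green k 0 y * w y)) \<partial>M)"
      unfolding I_def
    proof (rule nn_integral_mono_AE)
      have "negligible {0 :: real^3}" by simp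
      then have "AE y in lebesgue. y \<noteq> (0 :: real^3)"
        by (auto simp: negligible_iff_null_sets intro: AE_I'[of "{0}"])
      then have "AE y in M. y \<noteq> 0"
        unfolding M_def by (subst AE_restrict_space_iff) auto
      moreover have "AE y in M. y \<in> unit_cube"
        using AE_space[of M] spM by simp
      ultimately show "AE y in M. ennreal (cmod (w y)) \<le> ennreal (8 * pi * cmod (green k 0 y * w y))"
      proof eventually_elim
        case (elim y)
        have "norm y \<le> 2" using norm_diff_unit_cube[OF 0 elim(2)] by simp
        then have "1 \<le> 8 * pi * (1 / (4 * pi * norm y))"
          using elim(1) by (simp add: field_simps)
        also have "1 / (4 * pi * norm y) = cmod (green k 0 y)"
          by (simp add: green_def norm_divide norm_mult)
        finally have "1 * cmod (w y) \<le> 8 * pi * cmod (green k 0 y) * cmod (w y)"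
          by (intro mult_right_mono) auto
        then show ?case by (simp add: norm_mult mult.assoc)
      qed
    qed
    also have "\<dots> < \<infinity>"
      using integrable_norm[OF int[OF 0]]
      by (subst nn_integral_eq_integral) (auto intro!: integrable_mult_right)
    finally show ?thesis .
  qed
  define A where "A x = (\<integral>\<^sup>+ y. ennreal (1 / norm (x - y)) * ennreal (cmod (w y)) \<partial>M)" for x
  have AM [measurable]: "A \<in> borel_measurable M"
    unfolding A_def[abs_def] by measurable
  have u_le: "ennreal (cmod (u x)) \<le> 1 + A x" if x: "x \<in> unit_cube" for x
  proof -
    have "u x = plane_wave k \<alpha> x - integral unit_cube (\<lambda>y. green k x y * w y)"
      using eq[OF x] by (simp add: algebra_simps)
    then have "cmod (u x) \<le> cmod (plane_wave k \<alpha> x) + cmod (integral unit_cube (\<lambda>y. green k x y * w y))"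
      by (simp add: norm_triangle_ineq4)
    also have "cmod (plane_wave k \<alpha> x) = 1" unfolding plane_wave_def by (rule norm_exp_i_times)
    also have "integral unit_cube (\<lambda>y. green k x y * w y) = integral\<^sup>L M (\<lambda>y. green k x y * w y)"
      unfolding M_def by (rule lebesgue_integral_eq_integral[symmetric]) (use int[OF x] in \<open>simp_all add: M_def\<close>)
    also have "cmod (integral\<^sup>L M (\<lambda>y. green k x y * w y)) \<le> integral\<^sup>L M (\<lambda>y. cmod (green k x y * w y))"
      by (rule integral_norm_bound)
    finally have "ennreal (cmod (u x)) \<le> ennreal (1 + integral\<^sup>L M (\<lambda>y. cmod (green k x y * w y)))"
      by (rule ennreal_leI) simp
    also have "\<dots> = 1 + (\<integral>\<^sup>+ y. ennreal (cmod (green k x y * w y)) \<partial>M)"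
      using integrable_norm[OF int[OF x]]
      by (subst nn_integral_eq_integral) (auto simp: ennreal_plus)
    also have "(\<integral>\<^sup>+ y. ennreal (cmod (green k x y * w y)) \<partial>M) \<le> A x"
      unfolding A_def
    proof (rule nn_integral_mono)
      fix y
      have "cmod (green k x y * w y) \<le> 1 / norm (x - y) * cmod (w y)"
        unfolding norm_mult by (intro mult_right_mono norm_green_le) auto
      then have "ennreal (cmod (green k x y * w y)) \<le> ennreal (1 / norm (x - y) * cmod (w y))"
        by (rule ennreal_leI)
      then show "ennreal (cmod (green k x y * w y)) \<le> ennreal (1 / norm (x - y)) * ennreal (cmod (w y))"
        by (subst (asm) ennreal_mult) auto
    qed
    finally show ?thesis by (simp add: add_left_mono)
  qed
  have w_le: "ennreal (cmod (w y)) \<le> ennreal B * (1 + A y)" if "y \<in> unit_cube" for y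
  proof -
    have "ennreal (cmod (w y)) \<le> ennreal B * ennreal (cmod (u y))"
      using B[OF that] B0 by (simp add: w_def norm_mult mult_right_mono ennreal_leI flip: ennreal_mult)
    also have "\<dots> \<le> ennreal B * (1 + A y)"
      by (intro mult_left_mono u_le that) auto
    finally show ?thesis .
  qed
  have two: "(\<integral>\<^sup>+ y. ennreal (1 / norm (x - y)) * ennreal (1 / norm (y - z)) \<partial>M) \<le> 256"
    if x: "x \<in> unit_cube" and z: "z \<in> unit_cube" for x z
  proof -
    have "(\<integral>\<^sup>+ y. ennreal (1 / norm (x - y)) * ennreal (1 / norm (y - z)) \<partial>M)
      \<le> (\<integral>\<^sup>+ y. ennreal (1 / norm (x - y) ^ 2) + ennreal (1 / norm (z - y) ^ 2) \<partial>M)"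
    proof (intro nn_integral_mono)
      fix y
      have "a * b \<le> a ^ 2 + b ^ 2" if "a \<ge> 0" "b \<ge> 0" for a b :: real
        using sum_squares_bound[of a b] mult_nonneg_nonneg[OF that] by linarith
      from this[of "1 / norm (x - y)" "1 / norm (y - z)"]
      have "1 / norm (x - y) * (1 / norm (y - z)) \<le> 1 / norm (x - y) ^ 2 + 1 / norm (z - y) ^ 2"
        by (simp add: power_divide norm_minus_commute)
      then show "ennreal (1 / norm (x - y)) * ennreal (1 / norm (y - z)) \<le>
          ennreal (1 / norm (x - y) ^ 2) + ennreal (1 / norm (z - y) ^ 2)"
        by (simp add: ennreal_leI flip: ennreal_mult ennreal_plus)
    qed
    also have "\<dots> = (\<integral>\<^sup>+ y. ennreal (1 / norm (x - y) ^ 2) \<partial>M) + (\<integral>\<^sup>+ y. ennreal (1 / norm (z - y) ^ 2) \<partial>M)"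
      unfolding M_def by (intro nn_integral_add measurable_compose[OF borel_measurable_lebesgue_on measurable_ennreal]) measurable
    also have "\<dots> \<le> 128 + 128"
      unfolding M_def using x z by (intro add_mono nn_integral_inverse_square_cube)
    finally show ?thesis by simp
  qed
  have one: "(\<integral>\<^sup>+ y. ennreal (1 / norm (x - y)) \<partial>M) \<le> 256" if x: "x \<in> unit_cube" for x
  proof -
    have "(\<integral>\<^sup>+ y. ennreal (1 / norm (x - y)) \<partial>M) \<le> (\<integral>\<^sup>+ y. 2 * ennreal (1 / norm (x - y) ^ 2) \<partial>M)"
    proof (intro nn_integral_mono)
      fix y assume "y \<in> space M"
      then have "norm (x - y) \<le> 2" using norm_diff_unit_cube[OF x] spM by simp
      then have "1 / norm (x - y) \<le> 2 * (1 / norm (x - y) ^ 2)" by (rule inverse_norm_le)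
      then have "ennreal (1 / norm (x - y)) \<le> ennreal (2 * (1 / norm (x - y) ^ 2))" by (rule ennreal_leI)
      then show "ennreal (1 / norm (x - y)) \<le> 2 * ennreal (1 / norm (x - y) ^ 2)"
        by (subst (asm) ennreal_mult) auto
    qed
    also have "\<dots> = 2 * (\<integral>\<^sup>+ y. ennreal (1 / norm (x - y) ^ 2) \<partial>M)"
      unfolding M_def by (intro nn_integral_cmult measurable_compose[OF borel_measurable_lebesgue_on measurable_ennreal]) measurable
    also have "\<dots> \<le> 2 * 128"
      unfolding M_def using x by (intro mult_left_mono nn_integral_inverse_square_cube) auto
    finally show ?thesis by simp
  qed
  have A_le: "A x \<le> ennreal B * (256 + 256 * I)" if x: "x \<in> unit_cube" for x
  proof -
    have "A x \<le> (\<integral>\<^sup>+ y. ennreal (1 / norm (x - y)) * (ennreal B * (1 + A y)) \<partial>M)"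
      unfolding A_def[of x] using w_le spM by (intro nn_integral_mono mult_left_mono) auto
    also have "\<dots> = (\<integral>\<^sup>+ y. ennreal B * (ennreal (1 / norm (x - y)) + ennreal (1 / norm (x - y)) * A y) \<partial>M)"
      by (simp add: distrib_left mult_ac)
    also have "\<dots> = ennreal B * (\<integral>\<^sup>+ y. ennreal (1 / norm (x - y)) + ennreal (1 / norm (x - y)) * A y \<partial>M)"
    proof (rule nn_integral_cmult)
      show "(\<lambda>y. ennreal (1 / norm (x - y)) + ennreal (1 / norm (x - y)) * A y) \<in> borel_measurable M"
        by measurable
    qed
    also have "(\<integral>\<^sup>+ y. ennreal (1 / norm (x - y)) + ennreal (1 / norm (x - y)) * A y \<partial>M)
      = (\<integral>\<^sup>+ y. ennreal (1 / norm (x - y)) \<partial>M) + (\<integral>\<^sup>+ y. ennreal (1 / norm (x - y)) * A y \<partial>M)"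
      by (intro nn_integral_add) measurable
    also have "(\<integral>\<^sup>+ y. ennreal (1 / norm (x - y)) * A y \<partial>M)
      = (\<integral>\<^sup>+ y. \<integral>\<^sup>+ z. ennreal (1 / norm (x - y)) * (ennreal (1 / norm (y - z)) * ennreal (cmod (w z))) \<partial>M \<partial>M)"
      unfolding A_def by (intro nn_integral_cong nn_integral_cmult[symmetric]) measurable
    also have "\<dots> = (\<integral>\<^sup>+ z. \<integral>\<^sup>+ y. ennreal (1 / norm (x - y)) * (ennreal (1 / norm (y - z)) * ennreal (cmod (w z))) \<partial>M \<partial>M)"
      by (intro ps.Fubini'[symmetric]) measurable
    also have "\<dots> = (\<integral>\<^sup>+ z. ennreal (cmod (w z)) * (\<integral>\<^sup>+ y. ennreal (1 / norm (x - y)) * ennreal (1 / norm (y - z)) \<partial>M) \<partial>M)"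
    proof (intro nn_integral_cong)
      fix z
      have m: "(\<lambda>y. ennreal (1 / norm (x - y)) * ennreal (1 / norm (y - z))) \<in> borel_measurable M"
        by measurable
      show "(\<integral>\<^sup>+ y. ennreal (1 / norm (x - y)) * (ennreal (1 / norm (y - z)) * ennreal (cmod (w z))) \<partial>M) =
        ennreal (cmod (w z)) * (\<integral>\<^sup>+ y. ennreal (1 / norm (x - y)) * ennreal (1 / norm (y - z)) \<partial>M)"
        by (subst nn_integral_cmult[OF m, symmetric]) (simp add: mult_ac)
    qed
    also have "\<dots> \<le> (\<integral>\<^sup>+ z. ennreal (cmod (w z)) * 256 \<partial>M)"
      using spM x two by (intro nn_integral_mono mult_left_mono) auto
    also have "\<dots> = I * 256"
      unfolding I_def by (intro nn_integral_multc) measurable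
    finally have "A x \<le> ennreal B * ((\<integral>\<^sup>+ y. ennreal (1 / norm (x - y)) \<partial>M) + I * 256)"
      by (simp add: add_left_mono mult_left_mono)
    also have "\<dots> \<le> ennreal B * (256 + I * 256)"
      using one[OF x] by (intro mult_left_mono add_right_mono) auto
    finally show ?thesis by (simp add: mult.commute)
  qed
  define K where "K = 1 + ennreal B * (256 + 256 * I)"
  have K: "K < \<infinity>"
    using \<open>I < \<infinity>\<close> unfolding K_def by (auto simp: ennreal_mult_less_top ennreal_add_less_top)
  have "cmod (u x) \<le> enn2real K" if x: "x \<in> unit_cube" for x
  proof -
    have "ennreal (cmod (u x)) \<le> K"
      using u_le[OF x] A_le[OF x] unfolding K_def by (meson add_left_mono order_trans)
    then show ?thesis using K
      by (metis enn2real_mono enn2real_ennreal norm_ge_zero infinity_ennreal_def)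
  qed
  then show "\<exists>A. \<forall>x\<in>unit_cube. cmod (u x) \<le> A" by blast
qed

text \<open>Once \<open>u\<close> is bounded, the equation represents it as a plane wave minus the potential of a bounded
  density.\<close>

lemma solution_log_C11:
  assumes k: "k > 0" and a: "norm \<alpha> = 1" and sol: "solves_integral_eq k \<alpha> p u" and p: "log_C11 B p"
  shows "\<exists>L. log_C11 L u"
proof -
  define w where "w y = p y * u y" for y
  note sb = solution_bounded[OF k sol p]
  from sb(2) obtain A where A: "\<And>x. x \<in> unit_cube \<Longrightarrow> cmod (u x) \<le> A" by blast
  have wB: "cmod (w y) \<le> B * A" if "y \<in> unit_cube" for y
    unfolding w_def norm_mult using A[OF that] p that log_C11_nonneg[OF p]
    by (intro mult_mono) (auto simp: log_C11_def)
  obtain L where "log_C11 L (\<lambda>x. integral unit_cube (\<lambda>y. green k x y * w y))"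
    using log_C11_potential[of w "B * A" k] sb(1) wB k by (auto simp: w_def[abs_def])
  from log_C11_diff[OF log_C11_plane_wave[OF k a] this]
  have "log_C11 (1 + k + k\<^sup>2 + L) (\<lambda>x. plane_wave k \<alpha> x - integral unit_cube (\<lambda>y. green k x y * w y))" .
  also have "?this \<longleftrightarrow> log_C11 (1 + k + k\<^sup>2 + L) u"
    using sol by (intro log_C11_cong)
      (auto simp: solves_integral_eq_def w_def mult.assoc algebra_simps)
  finally show ?thesis by blast
qed

section \<open>The cubical partition and the midpoint rule\<close>

text \<open>The vector \<open>1\<close> has all components equal to 1, so this is the closed cube of side \<open>1 / n\<close> with centre \<open>c\<close>.\<close>

definition cell :: "nat \<Rightarrow> real^3 \<Rightarrow> (real^3) set" where
  "cell n c = cbox (c - (1 / (2 * real n)) *\<^sub>R 1) (c + (1 / (2 * real n)) *\<^sub>R 1)"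

lemma mem_cell: "y \<in> cell n c \<longleftrightarrow> (\<forall>i. \<bar>y $ i - c $ i\<bar> \<le> 1 / (2 * real n))"
  unfolding cell_def mem_box_cart abs_le_iff by (simp add: algebra_simps) (meson)

lemma finite_cube_centers: "finite (cube_centers n)"
proof (rule finite_subset)
  show "cube_centers n \<subseteq> (\<lambda>f. \<chi> i. (real (f i) + 1 / 2) / real n) ` (PiE UNIV (\<lambda>_::3. {..<n}))"
  proof
    fix x assume "x \<in> cube_centers n"
    then obtain f where "\<And>i. f i < n \<and> x $ i = (real (f i) + 1 / 2) / real n"
      unfolding cube_centers_def by simp metis
    then show "x \<in> (\<lambda>f. \<chi> i. (real (f i) + 1 / 2) / real n) ` (PiE UNIV (\<lambda>_::3. {..<n}))"
      by (intro image_eqI[of _ _ f]) (auto simp: vec_eq_iff)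
  qed
qed (intro finite_imageI finite_PiE, auto)

lemma content_cell:
  assumes "n > 0"
  shows "measure lborel (cell n c) = 1 / real n ^ 3"
proof -
  have "c \<in> cell n c" by (simp add: mem_cell)
  then have "cell n c \<noteq> {}" by blast
  then show ?thesis
    unfolding cell_def using assms by (simp add: content_cbox_cart power_divide)
qed

lemma center_in_cell: "c \<in> cell n c"
  by (simp add: mem_cell)

lemma norm_diff_cell:
  assumes "y \<in> cell n c"
  shows "norm (y - c) \<le> 7 / 8 * (1 / real n)"
  using norm_vec3_le[of "y - c" "1 / (2 * real n)"] assms by (simp add: mem_cell)

lemma norm_diff_cell_le: "y \<in> cell n c \<Longrightarrow> norm (y - c) \<le> 1 / real n"
proof -
  assume "y \<in> cell n c"
  then have "norm (y - c) \<le> 7 / 8 * (1 / real n)" by (rule norm_diff_cell)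
  moreover have "0 \<le> 1 / real n" by simp
  ultimately show ?thesis by linarith
qed

lemma cell_reflect: "y \<in> cell n c \<Longrightarrow> 2 *\<^sub>R c - y \<in> cell n c"
  by (simp add: mem_cell scaleR_2 abs_minus_commute algebra_simps)

lemma cell_subset:
  assumes "c \<in> cube_centers n" "n > 0"
  shows "cell n c \<subseteq> unit_cube"
proof
  fix y assume y: "y \<in> cell n c"
  show "y \<in> unit_cube"
    unfolding mem_box_cart
  proof
    fix i
    obtain j where j: "j < n" "c $ i = (real j + 1/2) / real n"
      using assms by (auto simp: cube_centers_def)
    have "c $ i - 1 / (2 * real n) = real j / real n" "c $ i + 1 / (2 * real n) = (real j + 1) / real n"
      using assms by (auto simp: j field_simps)
    moreover have "(real j + 1) / real n \<le> 1" "0 \<le> real j / real n"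
      using j assms by auto
    moreover have "\<bar>y $ i - c $ i\<bar> \<le> 1 / (2 * real n)" using y by (simp add: mem_cell)
    ultimately have "0 \<le> y $ i" "y $ i \<le> 1" by linarith+
    then show "(0::real^3) $ i \<le> y $ i \<and> y $ i \<le> (1::real^3) $ i" by simp
  qed
qed

lemma centers_subset: "n > 0 \<Longrightarrow> c \<in> cube_centers n \<Longrightarrow> c \<in> unit_cube"
  using cell_subset center_in_cell by blast

text \<open>The subtraction of 1 in the minimum assigns the right end point \<open>t = 1\<close> to the last interval.\<close>

lemma center_grid_point:
  assumes "n > 0" "0 \<le> t" "t \<le> 1"
  shows "\<exists>j<n. \<bar>t - (real j + 1/2) / real n\<bar> \<le> 1 / (2 * real n)"
proof -
  define j where "j = min (nat \<lfloor>real n * t\<rfloor>) (n - 1)"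
  have "j < n" using assms by (simp add: j_def)
  have t0: "0 \<le> real n * t" "real n * t \<le> real n" using assms by (auto simp: mult_left_le)
  have "real j \<le> real n * t" "real n * t \<le> real j + 1"
  proof -
    have "real j \<le> real (nat \<lfloor>real n * t\<rfloor>)" by (simp add: j_def)
    then show "real j \<le> real n * t" using t0 by linarith
    show "real n * t \<le> real j + 1"
    proof (cases "nat \<lfloor>real n * t\<rfloor> \<le> n - 1")
      case True
      then show ?thesis using t0 unfolding j_def by linarith
    next
      case False
      then have "real j = real n - 1" using assms by (auto simp: j_def)
      then show ?thesis using t0 by simp
    qed
  qed
  then have "\<bar>real n * t - (real j + 1/2)\<bar> \<le> 1/2" by linarith
  then have "\<bar>real n * t - (real j + 1/2)\<bar> / real n \<le> (1/2) / real n" by (intro divide_right_mono) auto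
  moreover have "\<bar>real n * t - (real j + 1/2)\<bar> / real n = \<bar>(real n * t - (real j + 1/2)) / real n\<bar>"
    by simp
  moreover have "(real n * t - (real j + 1/2)) / real n = t - (real j + 1/2) / real n"
    using assms by (simp add: diff_divide_distrib)
  ultimately show ?thesis using \<open>j < n\<close> by (auto intro!: exI[of _ j])
qed

lemma Union_cells:
  assumes "n > 0"
  shows "(\<Union>c\<in>cube_centers n. cell n c) = unit_cube"
proof (intro equalityI subsetI)
  fix y assume "y \<in> (\<Union>c\<in>cube_centers n. cell n c)"
  then show "y \<in> unit_cube" using cell_subset assms by blast
next
  fix y :: "real^3" assume "y \<in> unit_cube"
  then have "\<exists>j<n. \<bar>y $ i - (real j + 1/2) / real n\<bar> \<le> 1 / (2 * real n)" for i
    using assms by (intro center_grid_point) (auto simp: mem_box_cart)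
  then obtain f where f: "\<And>i. f i < n" "\<And>i. \<bar>y $ i - (real (f i) + 1/2) / real n\<bar> \<le> 1 / (2 * real n)"
    by metis
  define c :: "real^3" where "c = (\<chi> i. (real (f i) + 1/2) / real n)"
  have "c \<in> cube_centers n" "y \<in> cell n c"
    using f by (auto simp: c_def cube_centers_def mem_cell)
  then show "y \<in> (\<Union>c\<in>cube_centers n. cell n c)" by blast
qed

lemma centers_separated:
  assumes "c \<in> cube_centers n" "c' \<in> cube_centers n" "c \<noteq> c'" "n > 0"
  shows "\<exists>i. 1 / real n \<le> \<bar>c $ i - c' $ i\<bar>"
proof -
  obtain i where i: "c $ i \<noteq> c' $ i" using assms by (auto simp: vec_eq_iff)
  obtain j where j: "c $ i = (real j + 1/2) / real n"
    using assms(1) by (auto simp: cube_centers_def)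
  obtain j' where j': "c' $ i = (real j' + 1/2) / real n"
    using assms(2) by (auto simp: cube_centers_def)
  have "j \<noteq> j'" using i j j' by auto
  then have "1 \<le> \<bar>real j - real j'\<bar>" by linarith
  then have "1 / real n \<le> \<bar>real j - real j'\<bar> / real n" by (intro divide_right_mono) auto
  also have "\<dots> = \<bar>(real j - real j') / real n\<bar>" by simp
  also have "(real j - real j') / real n = c $ i - c' $ i"
    by (simp add: j j' add_divide_distrib diff_divide_distrib)
  finally show ?thesis by blast
qed

text \<open>Distances from \<open>x\<close> to the points of another cell and to its centre are comparable. This is what allows
  sums over the centres to be estimated by integrals, and midpoint values by values in the cell.\<close>

lemma centers_far:
  assumes "x \<in> cube_centers n" "c \<in> cube_centers n" "x \<noteq> c" "n > 0"
  shows "1 / real n \<le> norm (x - c)"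
    and "y \<in> cell n c \<Longrightarrow> 1 / (2 * real n) \<le> norm (x - y)"
    and "y \<in> cell n c \<Longrightarrow> norm (y - c) \<le> 7 / 8 * norm (x - c)"
    and "y \<in> cell n c \<Longrightarrow> norm (x - y) \<le> 2 * norm (x - c)"
    and "y \<in> cell n c \<Longrightarrow> norm (x - c) \<le> 8 * norm (x - y)"
proof -
  obtain i where i: "1 / real n \<le> \<bar>x $ i - c $ i\<bar>" using centers_separated[OF assms] by blast
  show 1: "1 / real n \<le> norm (x - c)"
    using i component_le_norm_cart[of "x - c" i] by simp
  assume y: "y \<in> cell n c"
  have "\<bar>y $ i - c $ i\<bar> \<le> 1 / (2 * real n)" using y by (simp add: mem_cell)
  moreover have "1 / real n = 2 * (1 / (2 * real n))" by simp
  ultimately have "1 / (2 * real n) \<le> \<bar>x $ i - y $ i\<bar>" using i by linarith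
  then show "1 / (2 * real n) \<le> norm (x - y)"
    using component_le_norm_cart[of "x - y" i] by simp
  show 2: "norm (y - c) \<le> 7 / 8 * norm (x - c)"
    using norm_diff_cell[OF y] 1 by linarith
  have "norm (x - y) \<le> norm (x - c) + norm (y - c)"
    using norm_triangle_ineq4[of "x - c" "y - c"] by simp
  then show "norm (x - y) \<le> 2 * norm (x - c)" using 2 norm_ge_zero[of "x - c"] by linarith
  have "norm (x - c) \<le> norm (x - y) + norm (y - c)"
    using norm_triangle_ineq[of "x - y" "y - c"] by simp
  then show "norm (x - c) \<le> 8 * norm (x - y)" using 2 by linarith
qed

lemma negligible_cell_Int:
  assumes "c \<in> cube_centers n" "c' \<in> cube_centers n" "c \<noteq> c'" "n > 0"
  shows "negligible (cell n c \<inter> cell n c')"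
proof -
  obtain i where i: "1 / real n \<le> \<bar>c $ i - c' $ i\<bar>" using centers_separated[OF assms] by blast
  have "cell n c \<inter> cell n c' \<subseteq> {y. y $ i = (c $ i + c' $ i) / 2}"
  proof clarify
    fix y assume "y \<in> cell n c" "y \<in> cell n c'"
    then have "\<bar>y $ i - c $ i\<bar> \<le> 1 / (2 * real n)" "\<bar>y $ i - c' $ i\<bar> \<le> 1 / (2 * real n)"
      by (auto simp: mem_cell)
    moreover have "1 / real n = 2 * (1 / (2 * real n))" by simp
    ultimately show "y $ i = (c $ i + c' $ i) / 2" using i by (simp add: abs_if field_simps split: if_splits)
  qed
  moreover have "negligible {y :: real^3. y $ i = (c $ i + c' $ i) / 2}"
    unfolding cart_eq_inner_axis by (rule negligible_standard_hyperplane) (auto simp: Basis_vec_def)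
  ultimately show ?thesis by (rule negligible_subset[rotated])
qed

lemma integrable_on_cell:
  fixes f :: "real^3 \<Rightarrow> 'b::banach"
  assumes "f integrable_on unit_cube" "c \<in> cube_centers n" "n > 0"
  shows "f integrable_on cell n c"
  using integrable_on_subcbox[OF assms(1)] cell_subset[OF assms(2,3)] by (simp add: cell_def)

lemma integral_sum_cells:
  fixes f :: "real^3 \<Rightarrow> 'b::banach"
  assumes "f integrable_on unit_cube" "n > 0"
  shows "integral unit_cube f = (\<Sum>c\<in>cube_centers n. integral (cell n c) f)"
proof -
  have "(f has_integral (\<Sum>c\<in>cube_centers n. integral (cell n c) f)) (\<Union>c\<in>cube_centers n. cell n c)"
  proof (rule has_integral_UN[OF finite_cube_centers])
    show "(f has_integral integral (cell n c) f) (cell n c)" if "c \<in> cube_centers n" for c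
      using integrable_on_cell[OF assms(1) that assms(2)] by (rule integrable_integral)
    show "pairwise (\<lambda>c c'. negligible (cell n c \<inter> cell n c')) (cube_centers n)"
      using negligible_cell_Int assms(2) by (auto simp: pairwise_def)
  qed
  then show ?thesis
    unfolding Union_cells[OF assms(2)] by (rule integral_unique)
qed

lemma has_integral_cell_const:
  fixes a :: "'b::real_normed_vector"
  assumes "n > 0"
  shows "((\<lambda>y. a) has_integral (1 / real n ^ 3) *\<^sub>R a) (cell n c)"
  using has_integral_const[of a "c - (1 / (2 * real n)) *\<^sub>R 1" "c + (1 / (2 * real n)) *\<^sub>R 1"]
  unfolding cell_def[symmetric] content_cell[OF assms] .

text \<open>Reduces the singular sums over the centres to the singular integrals over the cube; leaving out \<open>x\<close> is what
  keeps the terms finite.\<close>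

lemma sum_cells_le_integral:
  fixes \<phi> :: "real^3 \<Rightarrow> real"
  assumes "\<phi> integrable_on unit_cube" "n > 0" "\<And>y. y \<in> unit_cube \<Longrightarrow> 0 \<le> \<phi> y"
    and "\<And>c y. c \<in> cube_centers n \<Longrightarrow> c \<noteq> x \<Longrightarrow> y \<in> cell n c \<Longrightarrow> a c \<le> \<phi> y"
  shows "(\<Sum>c\<in>cube_centers n - {x}. a c / real n ^ 3) \<le> integral unit_cube \<phi>"
proof -
  have int: "\<phi> integrable_on cell n c" if "c \<in> cube_centers n" for c
    using integrable_on_cell[OF assms(1) that assms(2)] .
  have "(\<Sum>c\<in>cube_centers n - {x}. a c / real n ^ 3) \<le> (\<Sum>c\<in>cube_centers n - {x}. integral (cell n c) \<phi>)"
  proof (rule sum_mono)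
    fix c assume c: "c \<in> cube_centers n - {x}"
    then show "a c / real n ^ 3 \<le> integral (cell n c) \<phi>"
      using has_integral_le[OF has_integral_cell_const[OF assms(2), of "a c" c] integrable_integral[OF int]]
        assms(4) by auto
  qed
  also have "\<dots> \<le> (\<Sum>c\<in>cube_centers n. integral (cell n c) \<phi>)"
  proof (rule sum_mono2[OF finite_cube_centers])
    fix c assume "c \<in> cube_centers n - (cube_centers n - {x})"
    then show "0 \<le> integral (cell n c) \<phi>"
      using cell_subset[of c n] assms by (intro integral_nonneg int) auto
  qed auto
  also have "\<dots> = integral unit_cube \<phi>"
    using integral_sum_cells[OF assms(1,2)] by simp
  finally show ?thesis .
qed

lemma sum_inverse_square_centers:
  assumes x: "x \<in> cube_centers n" and n: "n > 0"
  shows "(\<Sum>c\<in>cube_centers n - {x}. 1 / norm (x - c) ^ 2 / real n ^ 3) \<le> 512"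
proof -
  note sq = integral_inverse_square_cube[OF centers_subset[OF n x]]
  have "(\<Sum>c\<in>cube_centers n - {x}. 1 / norm (x - c) ^ 2 / real n ^ 3)
     \<le> integral unit_cube (\<lambda>y. 4 * (1 / norm (x - y) ^ 2))"
  proof (rule sum_cells_le_integral[OF _ n])
    show "(\<lambda>y. 4 * (1 / norm (x - y) ^ 2)) integrable_on unit_cube"
      by (intro integrable_on_mult_right sq)
    fix c y assume c: "c \<in> cube_centers n" "c \<noteq> x" "y \<in> cell n c"
    have "0 < 1 / (2 * real n)" using n by simp
    then have pos: "0 < norm (x - y)" using centers_far(2)[OF x c(1) c(2)[symmetric] n c(3)] by linarith
    have "norm (x - y) ^ 2 \<le> (2 * norm (x - c)) ^ 2"
      using centers_far(4)[of x n c y] x c n by (intro power_mono) auto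
    then have "1 / (2 * norm (x - c)) ^ 2 \<le> 1 / norm (x - y) ^ 2"
      using pos by (intro divide_left_mono) (auto intro!: mult_pos_pos zero_less_power simp: c(2)[symmetric])
    then show "1 / norm (x - c) ^ 2 \<le> 4 * (1 / norm (x - y) ^ 2)" by (simp add: power_mult_distrib)
  qed auto
  also have "\<dots> = 4 * integral unit_cube (\<lambda>y. 1 / norm (x - y) ^ 2)" by (rule integral_mult_right)
  also have "\<dots> \<le> 4 * 128" by (intro mult_left_mono sq) auto
  finally show ?thesis by simp
qed

lemma sum_inverse_centers:
  assumes x: "x \<in> cube_centers n" and n: "n > 0"
  shows "(\<Sum>c\<in>cube_centers n - {x}. 1 / norm (x - c) / real n ^ 3) \<le> 1024"
proof -
  have "(\<Sum>c\<in>cube_centers n - {x}. 1 / norm (x - c) / real n ^ 3)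
    \<le> (\<Sum>c\<in>cube_centers n - {x}. 2 * (1 / norm (x - c) ^ 2 / real n ^ 3))"
  proof (rule sum_mono)
    fix c assume c: "c \<in> cube_centers n - {x}"
    then have "norm (x - c) \<le> 2" using norm_diff_unit_cube centers_subset[OF n] x by blast
    then have "1 / norm (x - c) \<le> 2 * (1 / norm (x - c) ^ 2)" by (rule inverse_norm_le)
    then have "1 / norm (x - c) / real n ^ 3 \<le> 2 * (1 / norm (x - c) ^ 2) / real n ^ 3"
      by (rule divide_right_mono) auto
    then show "1 / norm (x - c) / real n ^ 3 \<le> 2 * (1 / norm (x - c) ^ 2 / real n ^ 3)" by simp
  qed
  also have "\<dots> = 2 * (\<Sum>c\<in>cube_centers n - {x}. 1 / norm (x - c) ^ 2 / real n ^ 3)"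
    by (rule sum_distrib_left[symmetric])
  also have "\<dots> \<le> 2 * 512" by (intro mult_left_mono sum_inverse_square_centers x n) auto
  finally show ?thesis by simp
qed

lemma sum_inverse_cube_centers:
  assumes x: "x \<in> cube_centers n" and n: "n > 0"
  shows "(\<Sum>c\<in>cube_centers n - {x}. 1 / norm (x - c) ^ 3 / real n ^ 3) \<le> 2048 * (1 + ln (real n))"
proof -
  define r where "r = 1 / (2 * real n)"
  have r: "0 < r" "r \<le> 1" using n by (auto simp: r_def)
  define F where "F = {y\<in>unit_cube. r \<le> norm (x - y)}"
  define \<phi> where "\<phi> y = (if y \<in> F then 1 / norm (x - y) ^ 3 else 0)" for y
  note e = integral_inverse_cube_far[OF centers_subset[OF n x] r, folded F_def]
  have F: "F \<inter> unit_cube = F" by (auto simp: F_def)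
  have int: "\<phi> integrable_on unit_cube"
    using e(1) F unfolding \<phi>_def by (simp add: integrable_restrict_Int Int_commute)
  have "(\<Sum>c\<in>cube_centers n - {x}. 1 / norm (x - c) ^ 3 / real n ^ 3) \<le> integral unit_cube (\<lambda>y. 8 * \<phi> y)"
  proof (rule sum_cells_le_integral[OF _ n])
    show "(\<lambda>y. 8 * \<phi> y) integrable_on unit_cube" by (intro integrable_on_mult_right int)
    show "0 \<le> 8 * \<phi> y" for y by (simp add: \<phi>_def)
    fix c y assume c: "c \<in> cube_centers n" "c \<noteq> x" "y \<in> cell n c"
    have far: "r \<le> norm (x - y)" using centers_far(2)[of x n c y] x c n by (simp add: r_def)
    then have pos: "0 < norm (x - y)" using r by linarith
    have "y \<in> F" using far c cell_subset n by (auto simp: F_def)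
    have "norm (x - y) ^ 3 \<le> (2 * norm (x - c)) ^ 3"
      using centers_far(4)[of x n c y] x c n by (intro power_mono) auto
    then have "1 / (2 * norm (x - c)) ^ 3 \<le> 1 / norm (x - y) ^ 3"
      using pos by (intro divide_left_mono) (auto intro!: mult_pos_pos zero_less_power simp: c(2)[symmetric])
    then show "1 / norm (x - c) ^ 3 \<le> 8 * \<phi> y" using \<open>y \<in> F\<close> by (simp add: \<phi>_def power_mult_distrib)
  qed
  also have "\<dots> = 8 * integral unit_cube \<phi>" by (rule integral_mult_right)
  also have "integral unit_cube \<phi> = integral F (\<lambda>y. 1 / norm (x - y) ^ 3)"
    using F unfolding \<phi>_def by (simp add: integral_restrict_Int Int_commute)
  also have "8 * \<dots> \<le> 8 * (128 * (1 + ln (1 / r)))" by (intro mult_left_mono e) auto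
  also have "ln (1 / r) = ln 2 + ln (real n)" using n by (simp add: r_def ln_mult)
  also have "8 * (128 * (1 + (ln 2 + ln (real n)))) \<le> 2048 * (1 + ln (real n))"
  proof -
    have "ln 2 \<le> (1 :: real)" using ln_le_minus_one[of 2] by simp
    moreover have "0 \<le> ln (real n)" using n by simp
    ultimately show ?thesis by simp
  qed
  finally show ?thesis by simp
qed

text \<open>The reflection at the centre preserves the cell, so twice the error is the integral of the
  symmetric second difference, and the first-order terms never appear.\<close>

lemma midpoint_rule:
  fixes f :: "real^3 \<Rightarrow> complex"
  assumes f: "f integrable_on cell n c" and n: "n > 0"
    and K: "\<And>h. c + h \<in> cell n c \<Longrightarrow> cmod (f (c + h) + f (c - h) - 2 * f c) \<le> K"
  shows "cmod (f c / of_real (real n ^ 3) - integral (cell n c) f) \<le> K / real n ^ 3"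
proof -
  define I where "I = integral (cell n c) f"
  have I: "(f has_integral I) (cell n c)" using f by (simp add: I_def integrable_integral)
  have "((\<lambda>y. f (- 1 *\<^sub>R y + 2 *\<^sub>R c)) has_integral (1 / \<bar>- 1\<bar> ^ DIM(real^3)) *\<^sub>R I)
     ((\<lambda>y. (1 / - 1) *\<^sub>R y + - ((1 / - 1) *\<^sub>R 2 *\<^sub>R c)) ` cell n c)"
    using has_integral_affinity[OF I[unfolded cell_def], of "- 1" "2 *\<^sub>R c"] by (simp add: cell_def)
  moreover have "(\<lambda>y. (1 / - 1) *\<^sub>R y + - ((1 / - 1) *\<^sub>R 2 *\<^sub>R c)) ` cell n c = cell n c"
  proof (intro equalityI subsetI)
    fix y assume "y \<in> cell n c"
    then show "y \<in> (\<lambda>y. (1 / - 1) *\<^sub>R y + - ((1 / - 1) *\<^sub>R 2 *\<^sub>R c)) ` cell n c"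
      by (intro image_eqI[of _ _ "2 *\<^sub>R c - y"] cell_reflect) auto
  qed (auto dest!: cell_reflect simp: algebra_simps)
  ultimately have R: "((\<lambda>y. f (2 *\<^sub>R c - y)) has_integral I) (cell n c)" by simp
  have C: "((\<lambda>y. 2 * f c) has_integral 2 * f c / of_real (real n ^ 3)) (cell n c)"
    using has_integral_cell_const[OF n, of "2 * f c" c] by (simp add: scaleR_conv_of_real)
  have D: "((\<lambda>y. f y + f (2 *\<^sub>R c - y) - 2 * f c) has_integral (I + I - 2 * f c / of_real (real n ^ 3))) (cell n c)"
    by (intro has_integral_diff has_integral_add I R C)
  have K': "cmod (f y + f (2 *\<^sub>R c - y) - 2 * f c) \<le> K" if "y \<in> cell n c" for y
    using K[of "y - c"] that by (simp add: scaleR_2 algebra_simps)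
  have "cmod (I + I - 2 * f c / of_real (real n ^ 3)) \<le> K * measure lborel (cell n c)"
    unfolding cell_def
  proof (rule has_integral_bound)
    show "((\<lambda>y. f y + f (2 *\<^sub>R c - y) - 2 * f c) has_integral (I + I - 2 * f c / of_real (real n ^ 3)))
      (cbox (c - (1 / (2 * real n)) *\<^sub>R 1) (c + (1 / (2 * real n)) *\<^sub>R 1))"
      using D by (simp add: cell_def)
    show "0 \<le> K" using K'[OF center_in_cell] norm_ge_zero order_trans by blast
  qed (use K' in \<open>auto simp: cell_def\<close>)
  also have "measure lborel (cell n c) = 1 / real n ^ 3"
    by (rule content_cell[OF n])
  also have "I + I - 2 * f c / of_real (real n ^ 3) = - (2 * (f c / of_real (real n ^ 3) - I))"
    by (simp add: algebra_simps)
  finally have "2 * cmod (f c / of_real (real n ^ 3) - I) \<le> K * (1 / real n ^ 3)"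
    unfolding norm_minus_cancel norm_mult by simp
  then have "cmod (f c / of_real (real n ^ 3) - I) \<le> K * (1 / real n ^ 3)"
    using norm_ge_zero[of "f c / of_real (real n ^ 3) - I"] by linarith
  then show ?thesis by (simp add: I_def)
qed

text \<open>The cell that contains the singularity is left out of the discrete sum; the omitted integral is
  already of order \<open>1 / n\<^sup>2\<close>.\<close>

lemma integral_own_cell:
  assumes L: "\<And>y. y \<in> unit_cube \<Longrightarrow> cmod (w y) \<le> L" and x: "x \<in> cube_centers n" and n: "n > 0"
    and int: "(\<lambda>y. green k x y * w y) integrable_on unit_cube"
  shows "cmod (integral (cell n x) (\<lambda>y. green k x y * w y)) \<le> 64 * L / real n ^ 2"
proof -
  define R where "R = 1 / real n"
  have R: "R \<ge> 0" by (simp add: R_def)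
  have L0: "L \<ge> 0" using L[OF centers_subset[OF n x]] norm_ge_zero order_trans by blast
  have near: "norm (x - y) \<le> R" if "y \<in> cell n x" for y
  proof -
    have "7 / 8 * R \<le> R" using R by simp
    then show ?thesis using norm_diff_cell[OF that] unfolding R_def norm_minus_commute[of x] by linarith
  qed
  then have sub: "cell n x \<subseteq> cball x R" by (auto simp: dist_norm)
  note c = integral_inverse_square_cball[OF R, of x]
  have sqi: "(\<lambda>y. 1 / norm (x - y) ^ 2) integrable_on cell n x"
    using integrable_on_subcbox[OF c(1)] sub by (simp add: cell_def)
  have "cmod (integral (cell n x) (\<lambda>y. green k x y * w y)) \<le> integral (cell n x) (\<lambda>y. R * L * (1 / norm (x - y) ^ 2))"
  proof (rule integral_norm_bound_integral)
    show "(\<lambda>y. green k x y * w y) integrable_on cell n x" by (rule integrable_on_cell[OF int x n])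
    show "(\<lambda>y. R * L * (1 / norm (x - y) ^ 2)) integrable_on cell n x" by (intro integrable_on_mult_right sqi)
    fix y assume y: "y \<in> cell n x"
    have "cmod (green k x y * w y) \<le> R * (1 / norm (x - y) ^ 2) * L"
      unfolding norm_mult
    proof (rule mult_mono)
      show "cmod (green k x y) \<le> R * (1 / norm (x - y) ^ 2)"
        using norm_green_le inverse_norm_le[OF near[OF y]] by (rule order_trans)
      show "cmod (w y) \<le> L" using L cell_subset[OF x n] y by blast
    qed (use R in auto)
    then show "cmod (green k x y * w y) \<le> R * L * (1 / norm (x - y) ^ 2)" by (simp add: mult_ac)
  qed
  also have "\<dots> = R * L * integral (cell n x) (\<lambda>y. 1 / norm (x - y) ^ 2)" by (rule integral_mult_right)
  also have "integral (cell n x) (\<lambda>y. 1 / norm (x - y) ^ 2) \<le> 64 * R"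
    using integral_subset_le[OF sub sqi c(1)] c(2) by auto
  also have "R * L * (64 * R) = 64 * L / real n ^ 2" by (simp add: R_def power2_eq_square)
  finally show ?thesis using R L0 by (simp add: mult_left_mono)
qed

section \<open>Consistency of the discrete potential\<close>

text \<open>The potential of \<open>w\<close> with every integral over a cell replaced by its midpoint value, and with the cell of
  \<open>x\<close> itself omitted.\<close>

definition discrete_potential :: "real \<Rightarrow> nat \<Rightarrow> (real^3 \<Rightarrow> complex) \<Rightarrow> real^3 \<Rightarrow> complex" where
  "discrete_potential k n w x = (\<Sum>c\<in>cube_centers n - {x}. green k x c * w c / of_real (real n ^ 3))"

lemma norm_discrete_potential_le:
  assumes "\<And>c. c \<in> cube_centers n \<Longrightarrow> cmod (w c) \<le> B" "x \<in> cube_centers n" "n > 0"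
  shows "cmod (discrete_potential k n w x) \<le> 1024 * B"
proof -
  have B: "B \<ge> 0" using assms(1)[OF assms(2)] norm_ge_zero order_trans by blast
  have "cmod (discrete_potential k n w x) \<le> (\<Sum>c\<in>cube_centers n - {x}. B * (1 / norm (x - c) / real n ^ 3))"
    unfolding discrete_potential_def
  proof (rule sum_norm_le)
    fix c assume c: "c \<in> cube_centers n - {x}"
    have "cmod (green k x c) * cmod (w c) \<le> 1 / norm (x - c) * B"
      using c assms by (intro mult_mono norm_green_le) auto
    then have "cmod (green k x c) * cmod (w c) / real n ^ 3 \<le> 1 / norm (x - c) * B / real n ^ 3"
      by (intro divide_right_mono) auto
    then show "cmod (green k x c * w c / of_real (real n ^ 3)) \<le> B * (1 / norm (x - c) / real n ^ 3)"
      by (simp add: norm_divide norm_mult norm_power mult.commute)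
  qed
  also have "\<dots> = B * (\<Sum>c\<in>cube_centers n - {x}. 1 / norm (x - c) / real n ^ 3)"
    by (rule sum_distrib_left[symmetric])
  also have "\<dots> \<le> B * 1024"
    using B assms by (intro mult_left_mono sum_inverse_centers) auto
  finally show ?thesis by simp
qed

text \<open>With \<open>t = 1 / (n h) \<ge> 1\<close> the left-hand side is \<open>(1 + log n + log t) / (n\<^sup>2 t\<^sup>2)\<close>, and \<open>log t \<le> t\<^sup>2\<close>.\<close>

lemma log_modulus_le:
  assumes n: "n \<ge> 1" and h: "0 < h" "h \<le> 1 / real n"
  shows "h ^ 2 * (1 + ln (1 / h)) \<le> 2 * (1 + ln (real n)) / real n ^ 2"
proof -
  define t where "t = 1 / (real n * h)"
  have n0: "real n > 0" "0 \<le> ln (real n)" using n by auto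
  have t: "t \<ge> 1" using h n0 by (simp add: t_def field_simps)
  have ht: "h = 1 / (real n * t)" "1 / h = real n * t" using n0 h by (auto simp: t_def)
  have "ln t \<le> t - 1" using t by (intro ln_le_minus_one) auto
  also have "\<dots> \<le> t ^ 2" using t self_le_power[of t 2] by simp
  finally have "ln t \<le> t ^ 2" .
  moreover have "1 + ln (real n) \<le> (1 + ln (real n)) * t ^ 2"
    using t n0 mult_left_mono[of 1 "t ^ 2" "1 + ln (real n)"] by (simp add: one_le_power)
  moreover have "t ^ 2 \<le> (1 + ln (real n)) * t ^ 2"
    using n0 mult_right_mono[of 1 "1 + ln (real n)" "t ^ 2"] by simp
  ultimately have "1 + (ln (real n) + ln t) \<le> 2 * (1 + ln (real n)) * t ^ 2" by linarith
  then have "(1 / (real n * t)) ^ 2 * (1 + (ln (real n) + ln t))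
     \<le> (1 / (real n * t)) ^ 2 * (2 * (1 + ln (real n)) * t ^ 2)"
    by (rule mult_left_mono) auto
  also have "\<dots> = 2 * (1 + ln (real n)) / real n ^ 2"
    using t by (simp add: power_divide power_mult_distrib)
  also have "ln (real n) + ln t = ln (1 / h)"
    unfolding ht(2) using n0 t by (simp add: ln_mult)
  finally show ?thesis unfolding ht(1)[symmetric] .
qed

lemma green_diff_in_cell:
  assumes k: "k \<ge> 0" and x: "x \<in> cube_centers n" and c: "c \<in> cube_centers n" "x \<noteq> c"
    and y: "y \<in> cell n c" and n: "n > 0"
  shows "cmod (green k x y - green k x c) \<le> 65 * (4 * k + 1) * norm (y - c) / norm (x - c) ^ 2"
proof -
  have cube: "x \<in> unit_cube" "c \<in> unit_cube" "y \<in> unit_cube"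
    using centers_subset[OF n] cell_subset[OF c(1) n] x c y by auto
  note far = centers_far[OF x c(1) c(2) n]
  have "0 < 1 / real n" using n by simp
  then have pos: "0 < norm (x - c)" using far(1) by linarith
  have pos': "0 < norm (x - y)" using far(5)[OF y] pos by linarith
  have "norm (x - y) \<le> 4" "norm (x - c) \<le> 4"
    using norm_diff_unit_cube[OF cube(1,3)] norm_diff_unit_cube[OF cube(1,2)] by auto
  then have "cmod (green k y x - green k c x)
     \<le> (4 * k + 1) * norm (y - c) * (1 / norm (y - x) ^ 2 + 1 / norm (c - x) ^ 2)"
    by (intro norm_green_diff k) (auto simp: norm_minus_commute)
  also have "\<dots> \<le> (4 * k + 1) * norm (y - c) * (64 / norm (x - c) ^ 2 + 1 / norm (x - c) ^ 2)"
  proof (intro mult_left_mono add_mono)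
    have "norm (x - c) ^ 2 \<le> (8 * norm (x - y)) ^ 2"
      using far(5)[OF y] by (intro power_mono) auto
    then have "1 / (8 * norm (x - y)) ^ 2 \<le> 1 / norm (x - c) ^ 2"
      using pos pos' by (intro divide_left_mono mult_pos_pos zero_less_power) auto
    then show "1 / norm (y - x) ^ 2 \<le> 64 / norm (x - c) ^ 2"
      by (simp add: power_mult_distrib norm_minus_commute)
  qed (use k in \<open>auto simp: norm_minus_commute\<close>)
  also have "\<dots> = 65 * (4 * k + 1) * norm (y - c) / norm (x - c) ^ 2"
    by (simp add: algebra_simps add_divide_distrib)
  finally show ?thesis by (simp add: green_commute[of k x])
qed

text \<open>The discrete Leibniz rule distributes the second difference over kernel and density. The three
  summands pair a regular kernel with the log-quadratic second difference of \<open>w\<close>, the singular second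
  difference of the kernel with a bounded \<open>w\<close>, and two first differences.\<close>

lemma midpoint_error_far_cell:
  assumes k: "k \<ge> 0" and w: "log_C11 L w" and n: "n \<ge> 2"
    and x: "x \<in> cube_centers n" and c: "c \<in> cube_centers n" "x \<noteq> c"
    and int: "(\<lambda>y. green k x y * w y) integrable_on unit_cube"
  defines "C1 \<equiv> 4 * k + 1 + 1024 * (16 * k ^ 2 + 8 * k + 2)" and "C2 \<equiv> 65 * (4 * k + 1)"
  shows "cmod (green k x c * w c / of_real (real n ^ 3) - integral (cell n c) (\<lambda>y. green k x y * w y))
     \<le> L / real n ^ 2 * (2 * (1 + ln (real n)) * (1 / norm (x - c) / real n ^ 3)
        + C1 * (1 / norm (x - c) ^ 3 / real n ^ 3) + 2 * C2 * (1 / norm (x - c) ^ 2 / real n ^ 3))"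
proof -
  have n0: "n > 0" "real n > 0" "0 \<le> ln (real n)" using n by auto
  have L0: "L \<ge> 0" by (rule log_C11_nonneg[OF w])
  have C0: "C1 \<ge> 0" "C2 \<ge> 0" using k by (auto simp: C1_def C2_def)
  have cube: "x \<in> unit_cube" "c \<in> unit_cube"
    using centers_subset[OF n0(1)] x c by auto
  define d where "d = norm (x - c)"
  have "0 < 1 / real n" using n0 by simp
  then have d: "0 < d" "d \<le> 2"
    using centers_far(1)[OF x c(1) c(2) n0(1)] norm_diff_unit_cube[OF cube] unfolding d_def by linarith+
  define q where "q = 1 / real n"
  define s where "s = 2 * (1 + ln (real n)) / real n ^ 2"
  have q: "q > 0" "q ^ 2 = 1 / real n ^ 2" using n0 by (auto simp: q_def power_divide)
  have s0: "s \<ge> 0" using n0 by (simp add: s_def)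
  define K where "K = 1 / d * (L * s) + L * (C1 * q ^ 2 / d ^ 3) + 2 * ((C2 * q / d ^ 2) * (L * q))"
  have "cmod (green k x c * w c / of_real (real n ^ 3) - integral (cell n c) (\<lambda>y. green k x y * w y)) \<le> K / real n ^ 3"
  proof (rule midpoint_rule[OF integrable_on_cell[OF int c(1) n0(1)] n0(1)])
    fix h assume h: "c + h \<in> cell n c"
    then have h': "c - h \<in> cell n c" by (simp add: mem_cell)
    have hq1: "norm h \<le> 7 / 8 * q"
      using norm_diff_cell[OF h] by (simp add: q_def)
    then have hq: "norm h \<le> 7 / 8 * q" "norm h \<le> q"
      using q by linarith+
    have in_cube: "c + h \<in> unit_cube" "c - h \<in> unit_cube"
      using h h' cell_subset[OF c(1) n0(1)] by auto
    show "cmod (green k x (c + h) * w (c + h) + green k x (c - h) * w (c - h) - 2 * (green k x c * w c)) \<le> K"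
      unfolding K_def
    proof (rule second_diff_mult)
      show "cmod (green k x c) \<le> 1 / d" unfolding d_def by (rule norm_green_le)
      show "cmod (w c) \<le> L" using w cube by (auto simp: log_C11_def)
      have g: "cmod (green k x y - green k x c) \<le> C2 * q / d ^ 2" if "y \<in> cell n c" "norm (y - c) \<le> q" for y
      proof -
        have "cmod (green k x y - green k x c) \<le> C2 * norm (y - c) / d ^ 2"
          unfolding C2_def d_def by (rule green_diff_in_cell[OF k x c that(1) n0(1)])
        also have "\<dots> \<le> C2 * q / d ^ 2" using that C0 by (intro divide_right_mono mult_left_mono) auto
        finally show ?thesis .
      qed
      show "cmod (green k x (c + h) - green k x c) \<le> C2 * q / d ^ 2"
           "cmod (green k x (c - h) - green k x c) \<le> C2 * q / d ^ 2"
        using h h' hq by (intro g; simp)+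
      have wl: "cmod (w y - w c) \<le> L * q" if "y \<in> unit_cube" "norm (y - c) \<le> q" for y
      proof -
        have "cmod (w y - w c) \<le> L * norm (y - c)" using w that cube by (auto simp: log_C11_def)
        also have "\<dots> \<le> L * q" using that L0 by (intro mult_left_mono) auto
        finally show ?thesis .
      qed
      show "cmod (w (c + h) - w c) \<le> L * q" "cmod (w (c - h) - w c) \<le> L * q"
        using in_cube hq by (intro wl; simp)+
      show "cmod (green k x (c + h) + green k x (c - h) - 2 * green k x c) \<le> C1 * q ^ 2 / d ^ 3"
      proof -
        have "norm h \<le> 7 / 8 * norm (c - x)"
          using centers_far(3)[OF x c(1) c(2) n0(1) h] by (simp add: norm_minus_commute)
        moreover have "norm (c - x) \<le> 2" using d by (simp add: d_def norm_minus_commute)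
        ultimately have "cmod (green k (c + h) x + green k (c - h) x - 2 * green k c x) \<le> C1 * norm h ^ 2 / norm (c - x) ^ 3"
          unfolding C1_def using c(2) by (intro norm_green_second_diff k) auto
        also have "\<dots> \<le> C1 * q ^ 2 / norm (c - x) ^ 3"
          using hq C0 by (intro divide_right_mono mult_left_mono power_mono) auto
        finally show ?thesis by (simp add: green_commute[of k x] d_def norm_minus_commute)
      qed
      show "cmod (w (c + h) + w (c - h) - 2 * w c) \<le> L * s"
      proof (cases "h = 0")
        case True
        then show ?thesis using L0 s0 by simp
      next
        case False
        have "7 / 8 * q \<le> 1 / 2" using n by (simp add: q_def field_simps)
        then have "norm h \<le> 1 / 2" using hq by linarith
        then have "cmod (w (c + h) + w (c - h) - 2 * w c) \<le> L * (norm h ^ 2 * (1 + ln (1 / norm h)))"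
          using w cube in_cube False by (auto simp: log_C11_def)
        also have "\<dots> \<le> L * s"
          unfolding s_def using False n hq L0 by (intro mult_left_mono log_modulus_le) (auto simp: q_def)
        finally show ?thesis .
      qed
    qed
  qed
  also have "K / real n ^ 3 = L / real n ^ 2 * (2 * (1 + ln (real n)) * (1 / norm (x - c) / real n ^ 3)
        + C1 * (1 / norm (x - c) ^ 3 / real n ^ 3) + 2 * C2 * (1 / norm (x - c) ^ 2 / real n ^ 3))"
  proof -
    have "K = L / real n ^ 2 * (2 * (1 + ln (real n)) * (1 / d) + C1 * (1 / d ^ 3) + 2 * C2 * (1 / d ^ 2))"
    proof -
      have "K = L * (s * (1 / d) + q ^ 2 * (C1 * (1 / d ^ 3)) + q ^ 2 * (2 * C2 * (1 / d ^ 2)))"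
        by (simp add: K_def power2_eq_square algebra_simps)
      also have "s = q ^ 2 * (2 * (1 + ln (real n)))" by (simp add: s_def q)
      finally show ?thesis unfolding q(2) by (simp add: algebra_simps add_divide_distrib)
    qed
    then show ?thesis by (simp add: d_def add_divide_distrib distrib_left)
  qed
  finally show ?thesis .
qed

text \<open>Summation of the errors of the cells. The inverse cubes contribute one logarithm and the second
  difference of \<open>w\<close> another one, but the latter is multiplied by a sum of inverse first powers, which is
  bounded; so the logarithm enters only to the first power.\<close>

proposition discrete_potential_consistent:
  assumes k: "k \<ge> 0" and w: "log_C11 L w"
  shows "\<exists>C\<ge>0. \<forall>n\<ge>2. \<forall>x\<in>cube_centers n.
     cmod (discrete_potential k n w x - integral unit_cube (\<lambda>y. green k x y * w y)) \<le> C * (1 + ln (real n)) / real n ^ 2"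
proof -
  define C1 where "C1 = 4 * k + 1 + 1024 * (16 * k ^ 2 + 8 * k + 2)"
  define C2 where "C2 = 65 * (4 * k + 1)"
  define C where "C = L * (2 * 1024 + C1 * 2048 + 2 * C2 * 512) + 64 * L"
  have L0: "L \<ge> 0" by (rule log_C11_nonneg[OF w])
  have C12: "C1 \<ge> 0" "C2 \<ge> 0" using k by (auto simp: C1_def C2_def)
  then have C0: "C \<ge> 0" using L0 by (simp add: C_def)
  have wB: "cmod (w y) \<le> L" if "y \<in> unit_cube" for y using w that by (auto simp: log_C11_def)
  have wm: "w \<in> borel_measurable (lebesgue_on unit_cube)"
    by (rule continuous_imp_measurable_on_sets_lebesgue[OF log_C11_continuous[OF w]]) simp
  have "cmod (discrete_potential k n w x - integral unit_cube (\<lambda>y. green k x y * w y)) \<le> C * (1 + ln (real n)) / real n ^ 2"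
    if n: "n \<ge> 2" and x: "x \<in> cube_centers n" for n x
  proof -
    have n0: "n > 0" "0 \<le> ln (real n)" using n by auto
    have int: "(\<lambda>y. green k x y * w y) integrable_on unit_cube"
      using potential_integrable(1)[OF wm wB centers_subset[OF n0(1) x], of k] by (simp add: absolutely_integrable_on_def)
    define J where "J c = integral (cell n c) (\<lambda>y. green k x y * w y)" for c
    have "integral unit_cube (\<lambda>y. green k x y * w y) = (\<Sum>c\<in>cube_centers n. J c)"
      unfolding J_def by (rule integral_sum_cells[OF int n0(1)])
    also have "\<dots> = J x + (\<Sum>c\<in>cube_centers n - {x}. J c)"
      by (rule sum.remove[OF finite_cube_centers x])
    finally have "discrete_potential k n w x - integral unit_cube (\<lambda>y. green k x y * w y)
      = (\<Sum>c\<in>cube_centers n - {x}. green k x c * w c / of_real (real n ^ 3) - J c) - J x"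
      by (simp add: discrete_potential_def sum_subtractf)
    also have "cmod \<dots> \<le> cmod (\<Sum>c\<in>cube_centers n - {x}. green k x c * w c / of_real (real n ^ 3) - J c) + cmod (J x)"
      by (rule norm_triangle_ineq4)
    also have "\<dots> \<le> L / real n ^ 2 * (2 * (1 + ln (real n)) * 1024 + C1 * (2048 * (1 + ln (real n))) + 2 * C2 * 512)
      + 64 * L / real n ^ 2"
    proof (rule add_mono)
      show "cmod (J x) \<le> 64 * L / real n ^ 2"
        unfolding J_def by (rule integral_own_cell[OF wB x n0(1) int])
      have "cmod (\<Sum>c\<in>cube_centers n - {x}. green k x c * w c / of_real (real n ^ 3) - J c)
        \<le> (\<Sum>c\<in>cube_centers n - {x}. L / real n ^ 2 * (2 * (1 + ln (real n)) * (1 / norm (x - c) / real n ^ 3)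
        + C1 * (1 / norm (x - c) ^ 3 / real n ^ 3) + 2 * C2 * (1 / norm (x - c) ^ 2 / real n ^ 3)))"
        unfolding J_def C1_def C2_def
        by (rule sum_norm_le, rule midpoint_error_far_cell[OF k w n x _ _ int]) auto
      also have "\<dots> = L / real n ^ 2 * (2 * (1 + ln (real n)) * (\<Sum>c\<in>cube_centers n - {x}. 1 / norm (x - c) / real n ^ 3)
        + C1 * (\<Sum>c\<in>cube_centers n - {x}. 1 / norm (x - c) ^ 3 / real n ^ 3)
        + 2 * C2 * (\<Sum>c\<in>cube_centers n - {x}. 1 / norm (x - c) ^ 2 / real n ^ 3))"
        by (simp only: sum.distrib sum_distrib_left[symmetric])
      also have "\<dots> \<le> L / real n ^ 2 * (2 * (1 + ln (real n)) * 1024 + C1 * (2048 * (1 + ln (real n))) + 2 * C2 * 512)"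
        using L0 C12 n0 x
        by (intro mult_left_mono add_mono sum_inverse_centers sum_inverse_cube_centers sum_inverse_square_centers) auto
      finally show "cmod (\<Sum>c\<in>cube_centers n - {x}. green k x c * w c / of_real (real n ^ 3) - J c)
        \<le> L / real n ^ 2 * (2 * (1 + ln (real n)) * 1024 + C1 * (2048 * (1 + ln (real n))) + 2 * C2 * 512)" .
    qed
    also have "\<dots> \<le> L / real n ^ 2 * ((2 * 1024 + C1 * 2048 + 2 * C2 * 512) * (1 + ln (real n)))
      + 64 * L / real n ^ 2 * (1 + ln (real n))"
    proof (intro add_mono mult_left_mono)
      have "C2 * 1 \<le> C2 * (1 + ln (real n))" using C12 n0 by (intro mult_left_mono) auto
      then show "2 * (1 + ln (real n)) * 1024 + C1 * (2048 * (1 + ln (real n))) + 2 * C2 * 512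
        \<le> (2 * 1024 + C1 * 2048 + 2 * C2 * 512) * (1 + ln (real n))" by (simp add: algebra_simps)
      show "64 * L / real n ^ 2 \<le> 64 * L / real n ^ 2 * (1 + ln (real n))"
        using L0 n0 mult_left_mono[of 1 "1 + ln (real n)" "64 * L / real n ^ 2"] by simp
    qed (use L0 in auto)
    also have "\<dots> = C * (1 + ln (real n)) / real n ^ 2"
      by (simp add: C_def distrib_right add_divide_distrib)
    finally show ?thesis .
  qed
  then show ?thesis using C0 by blast
qed

section \<open>Stability of the discrete equations\<close>

text \<open>For a grid function \<open>v\<close> without any regularity the discrete potential is compared with the exact potential of
  \<open>p\<close> times the step function with the values of \<open>v\<close>. The step function is constant on each cell, so
  only the variation of kernel and \<open>p\<close> matters, and the error is uniform in \<open>v\<close>. The step function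
  appears as a sum over the cells, which avoids any choice of values on the common faces.\<close>

lemma discrete_potential_vs_step:
  assumes k: "k \<ge> 0" and p: "log_C11 L p"
  shows "\<exists>C\<ge>0. \<forall>n\<ge>1. \<forall>x\<in>cube_centers n. \<forall>v. (\<forall>c\<in>cube_centers n. cmod (v c) \<le> 1) \<longrightarrow>
     cmod (discrete_potential k n (\<lambda>c. p c * v c) x
            - (\<Sum>c\<in>cube_centers n. v c * integral (cell n c) (\<lambda>y. green k x y * p y))) \<le> C / real n"
proof -
  define C2 where "C2 = 65 * (4 * k + 1)"
  define C where "C = (2 * L + C2 * L) * 512 + 64 * L"
  have L0: "L \<ge> 0" by (rule log_C11_nonneg[OF p])
  have C0: "C2 \<ge> 0" "C \<ge> 0" using k L0 by (auto simp: C2_def C_def)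
  have pB: "cmod (p y) \<le> L" if "y \<in> unit_cube" for y using p that by (auto simp: log_C11_def)
  have pm: "p \<in> borel_measurable (lebesgue_on unit_cube)"
    by (rule continuous_imp_measurable_on_sets_lebesgue[OF log_C11_continuous[OF p]]) simp
  have "cmod (discrete_potential k n (\<lambda>c. p c * v c) x
            - (\<Sum>c\<in>cube_centers n. v c * integral (cell n c) (\<lambda>y. green k x y * p y))) \<le> C / real n"
    if n: "n \<ge> 1" and x: "x \<in> cube_centers n" and v: "\<And>c. c \<in> cube_centers n \<Longrightarrow> cmod (v c) \<le> 1" for n x v
  proof -
    have n0: "n > 0" using n by simp
    have int: "(\<lambda>y. green k x y * p y) integrable_on unit_cube"
      using potential_integrable(1)[OF pm pB centers_subset[OF n0 x], of k] by (simp add: absolutely_integrable_on_def)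
    define J where "J c = integral (cell n c) (\<lambda>y. green k x y * p y)" for c
    define E where "E c = green k x c * p c / of_real (real n ^ 3) - J c" for c
    define b where "b = (2 * L + C2 * L) / real n"
    have E: "cmod (E c) \<le> b * (1 / norm (x - c) ^ 2 / real n ^ 3)" if c: "c \<in> cube_centers n" "x \<noteq> c" for c
    proof -
      have cube: "x \<in> unit_cube" "c \<in> unit_cube"
        using centers_subset[OF n0] x c by auto
      define f where "f = green k x c * p c"
      have I: "((\<lambda>y. f - green k x y * p y) has_integral E c) (cell n c)"
      proof -
        have "((\<lambda>y. f) has_integral f / of_real (real n ^ 3)) (cell n c)"
          using has_integral_cell_const[OF n0, of f c] by (simp add: scaleR_conv_of_real)
        then show ?thesis
          unfolding E_def J_def f_def
          by (intro has_integral_diff integrable_integral integrable_on_cell[OF int c(1) n0])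
      qed
      have bd: "cmod (f - green k x y * p y) \<le> b * (1 / norm (x - c) ^ 2)" if y: "y \<in> cell n c" for y
      proof -
        have yc: "norm (y - c) \<le> 1 / real n"
          by (rule norm_diff_cell_le[OF y])
        have ycube: "y \<in> unit_cube" using y cell_subset[OF c(1) n0] by auto
        have "f - green k x y * p y = green k x c * (p c - p y) + (green k x c - green k x y) * p y"
          by (simp add: f_def algebra_simps)
        also have "cmod \<dots> \<le> cmod (green k x c) * cmod (p c - p y) + cmod (green k x c - green k x y) * cmod (p y)"
          using norm_triangle_ineq by (simp only: norm_mult[symmetric])
        also have "\<dots> \<le> (2 * (1 / norm (x - c) ^ 2)) * (L * (1 / real n)) + (C2 * (1 / real n) / norm (x - c) ^ 2) * L"
        proof (intro add_mono mult_mono)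
          show "cmod (green k x c) \<le> 2 * (1 / norm (x - c) ^ 2)"
            using norm_green_le inverse_norm_le[OF norm_diff_unit_cube[OF cube]] by (rule order_trans)
          have "cmod (p c - p y) \<le> L * norm (c - y)" using p cube ycube by (auto simp: log_C11_def)
          also have "\<dots> \<le> L * (1 / real n)" using yc L0 by (intro mult_left_mono) (simp_all add: norm_minus_commute)
          finally show "cmod (p c - p y) \<le> L * (1 / real n)" .
          have "cmod (green k x c - green k x y) \<le> C2 * norm (y - c) / norm (x - c) ^ 2"
            unfolding C2_def norm_minus_commute[of "green k x c"] by (rule green_diff_in_cell[OF k x c y n0])
          also have "\<dots> \<le> C2 * (1 / real n) / norm (x - c) ^ 2"
            using yc C0 by (intro divide_right_mono mult_left_mono) auto
          finally show "cmod (green k x c - green k x y) \<le> C2 * (1 / real n) / norm (x - c) ^ 2" .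
          show "cmod (p y) \<le> L" by (rule pB[OF ycube])
        qed (use C0 in auto)
        also have "\<dots> = b * (1 / norm (x - c) ^ 2)"
          by (simp add: b_def algebra_simps add_divide_distrib)
        finally show ?thesis .
      qed
      have "cmod (E c) \<le> b * (1 / norm (x - c) ^ 2) * measure lborel (cell n c)"
        unfolding cell_def
      proof (rule has_integral_bound[OF _ I[unfolded cell_def]])
        show "0 \<le> b * (1 / norm (x - c) ^ 2)" using L0 C0 by (simp add: b_def)
      qed (use bd in \<open>simp add: cell_def\<close>)
      also have "measure lborel (cell n c) = 1 / real n ^ 3"
        by (rule content_cell[OF n0])
      finally show ?thesis by simp
    qed
    have "(\<Sum>c\<in>cube_centers n. v c * J c) = v x * J x + (\<Sum>c\<in>cube_centers n - {x}. v c * J c)"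
      by (rule sum.remove[OF finite_cube_centers x])
    then have "discrete_potential k n (\<lambda>c. p c * v c) x - (\<Sum>c\<in>cube_centers n. v c * J c)
      = (\<Sum>c\<in>cube_centers n - {x}. v c * E c) - v x * J x"
      by (simp add: discrete_potential_def E_def right_diff_distrib sum_subtractf mult_ac)
    also have "cmod \<dots> \<le> cmod (\<Sum>c\<in>cube_centers n - {x}. v c * E c) + cmod (v x * J x)"
      by (rule norm_triangle_ineq4)
    also have "cmod (v x * J x) \<le> 1 * (64 * L / real n ^ 2)"
      unfolding norm_mult J_def using v[OF x] by (intro mult_mono integral_own_cell[OF pB x n0 int]) auto
    also have "1 * (64 * L / real n ^ 2) \<le> 64 * L / real n"
      using n L0 by (simp add: power2_eq_square divide_left_mono mult_left_mono)
    also have "cmod (\<Sum>c\<in>cube_centers n - {x}. v c * E c)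
        \<le> (\<Sum>c\<in>cube_centers n - {x}. b * (1 / norm (x - c) ^ 2 / real n ^ 3))"
    proof (rule sum_norm_le)
      fix c assume c: "c \<in> cube_centers n - {x}"
      then have "cmod (v c * E c) \<le> 1 * cmod (E c)"
        unfolding norm_mult using v by (intro mult_right_mono) auto
      then show "cmod (v c * E c) \<le> b * (1 / norm (x - c) ^ 2 / real n ^ 3)" using E[of c] c by auto
    qed
    also have "\<dots> = b * (\<Sum>c\<in>cube_centers n - {x}. 1 / norm (x - c) ^ 2 / real n ^ 3)"
      by (rule sum_distrib_left[symmetric])
    also have "\<dots> \<le> b * 512"
      using L0 C0 by (intro mult_left_mono sum_inverse_square_centers x n0) (simp add: b_def)
    finally show ?thesis
      by (simp add: b_def C_def J_def add_divide_distrib)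
  qed
  then show ?thesis using C0 by blast
qed

lemma norm_sum_cells_le:
  fixes f g :: "real^3 \<Rightarrow> complex"
  assumes f: "f absolutely_integrable_on unit_cube" and n: "n > 0"
    and a: "\<And>c y. c \<in> cube_centers n \<Longrightarrow> y \<in> cell n c \<Longrightarrow> cmod (a c y) \<le> d"
    and int: "\<And>c. c \<in> cube_centers n \<Longrightarrow> (\<lambda>y. a c y * f y) integrable_on cell n c"
  shows "cmod (\<Sum>c\<in>cube_centers n. integral (cell n c) (\<lambda>y. a c y * f y)) \<le> d * integral unit_cube (\<lambda>y. cmod (f y))"
proof -
  have fi: "(\<lambda>y. cmod (f y)) integrable_on unit_cube"
    using f by (simp add: absolutely_integrable_on_def)
  have "cmod (\<Sum>c\<in>cube_centers n. integral (cell n c) (\<lambda>y. a c y * f y))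
     \<le> (\<Sum>c\<in>cube_centers n. d * integral (cell n c) (\<lambda>y. cmod (f y)))"
  proof (rule sum_norm_le)
    fix c assume c: "c \<in> cube_centers n"
    have "cmod (integral (cell n c) (\<lambda>y. a c y * f y)) \<le> integral (cell n c) (\<lambda>y. d * cmod (f y))"
    proof (rule integral_norm_bound_integral[OF int[OF c]])
      show "(\<lambda>y. d * cmod (f y)) integrable_on cell n c"
        by (intro integrable_on_mult_right integrable_on_cell[OF fi c n])
      show "cmod (a c y * f y) \<le> d * cmod (f y)" if "y \<in> cell n c" for y
        unfolding norm_mult using a[OF c that] by (rule mult_right_mono) simp
    qed
    then show "cmod (integral (cell n c) (\<lambda>y. a c y * f y)) \<le> d * integral (cell n c) (\<lambda>y. cmod (f y))"
      by simp
  qed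
  also have "\<dots> = d * integral unit_cube (\<lambda>y. cmod (f y))"
    unfolding integral_sum_cells[OF fi n] by (rule sum_distrib_left[symmetric])
  finally show ?thesis .
qed

text \<open>The negative potentials \<open>W i\<close> of the step functions of \<open>p v\<^sub>i\<close> are uniformly bounded and uniformly Lipschitz, so a subsequence
  converges uniformly. As \<open>W i\<close> differs from \<open>v\<^sub>i\<close> on the grid by \<open>O(1 / i)\<close>, the limit inherits both the norm 1 and,
  by passing to the limit in the potentials, the homogeneous equation.\<close>

lemma approximate_null_vectors_limit:
  fixes n :: "nat \<Rightarrow> nat" and v :: "nat \<Rightarrow> real^3 \<Rightarrow> complex"
  assumes k: "k \<ge> 0" and p: "log_C11 L p"
    and n: "\<And>i. n i \<ge> Suc i"
    and v1: "\<And>i c. c \<in> cube_centers (n i) \<Longrightarrow> cmod (v i c) \<le> 1"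
    and v2: "\<And>i. \<exists>c\<in>cube_centers (n i). cmod (v i c) = 1"
    and v3: "\<And>i x. x \<in> cube_centers (n i) \<Longrightarrow>
       cmod (v i x + discrete_potential k (n i) (\<lambda>c. p c * v i c) x) \<le> 1 / real (Suc i)"
  shows "\<exists>\<phi>. continuous_on unit_cube \<phi> \<and> (\<exists>x\<in>unit_cube. \<phi> x \<noteq> 0) \<and>
     (\<forall>x\<in>unit_cube. \<phi> x + integral unit_cube (\<lambda>y. green k x y * p y * \<phi> y) = 0)"
proof -
  obtain C where C: "C \<ge> 0" "\<And>n x v. n \<ge> 1 \<Longrightarrow> x \<in> cube_centers n \<Longrightarrow> (\<forall>c\<in>cube_centers n. cmod (v c) \<le> 1) \<Longrightarrow>
     cmod (discrete_potential k n (\<lambda>c. p c * v c) x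
            - (\<Sum>c\<in>cube_centers n. v c * integral (cell n c) (\<lambda>y. green k x y * p y))) \<le> C / real n"
    using discrete_potential_vs_step[OF k p] by blast
  have L0: "L \<ge> 0" by (rule log_C11_nonneg[OF p])
  have pB: "cmod (p y) \<le> L" if "y \<in> unit_cube" for y using p that by (auto simp: log_C11_def)
  have pm: "p \<in> borel_measurable (lebesgue_on unit_cube)"
    by (rule continuous_imp_measurable_on_sets_lebesgue[OF log_C11_continuous[OF p]]) simp
  have n0: "n i > 0" "n i \<ge> 1" for i using n[of i] by auto
  note abs = potential_integrable(1)[OF pm pB, where k = k]
  have int: "(\<lambda>y. green k x y * p y) integrable_on unit_cube" if "x \<in> unit_cube" for x
    using abs[OF _ that] by (simp add: absolutely_integrable_on_def)
  define W where "W i x = - (\<Sum>c\<in>cube_centers (n i). v i c * integral (cell (n i) c) (\<lambda>y. green k x y * p y))" for i x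
  have W_integral: "W i x = - (\<Sum>c\<in>cube_centers (n i). integral (cell (n i) c) (\<lambda>y. v i c * (green k x y * p y)))" for i x
    unfolding W_def by simp
  define \<Lambda> where "\<Lambda> = 256 * (4 * k + 1) * L"
  have \<Lambda>0: "\<Lambda> \<ge> 0" using k L0 by (simp add: \<Lambda>_def)
  have W_bound: "cmod (W i x) \<le> 256 * L" if x: "x \<in> unit_cube" for i x
  proof -
    have "cmod (\<Sum>c\<in>cube_centers (n i). integral (cell (n i) c) (\<lambda>y. v i c * (green k x y * p y)))
      \<le> 1 * integral unit_cube (\<lambda>y. cmod (green k x y * p y))"
      by (rule norm_sum_cells_le[OF abs[OF _ x] n0(1)])
         (use v1 in \<open>auto intro!: integrable_on_mult_right integrable_on_cell[OF int[OF x] _ n0(1)]\<close>)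
    also have "\<dots> \<le> 256 * L"
      using potential_integrable(2)[OF pm pB x, of k] by simp
    finally show ?thesis unfolding W_integral norm_minus_cancel .
  qed
  have W_lip: "cmod (W i x - W i x') \<le> \<Lambda> * norm (x - x')" if x: "x \<in> unit_cube" "x' \<in> unit_cube" for i x x'
  proof -
    have d: "(\<lambda>y. green k x y * p y - green k x' y * p y) absolutely_integrable_on unit_cube"
      using x abs by (intro set_integral_diff) auto
    then have di: "(\<lambda>y. green k x y * p y - green k x' y * p y) integrable_on unit_cube"
      by (simp add: absolutely_integrable_on_def)
    have "W i x' - W i x = (\<Sum>c\<in>cube_centers (n i). v i c * integral (cell (n i) c) (\<lambda>y. green k x y * p y)
        - v i c * integral (cell (n i) c) (\<lambda>y. green k x' y * p y))"
      unfolding W_def by (simp add: sum_subtractf)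
    also have "\<dots> = (\<Sum>c\<in>cube_centers (n i). integral (cell (n i) c) (\<lambda>y. v i c * (green k x y * p y - green k x' y * p y)))"
    proof (rule sum.cong[OF refl])
      fix c assume c: "c \<in> cube_centers (n i)"
      show "v i c * integral (cell (n i) c) (\<lambda>y. green k x y * p y) - v i c * integral (cell (n i) c) (\<lambda>y. green k x' y * p y)
        = integral (cell (n i) c) (\<lambda>y. v i c * (green k x y * p y - green k x' y * p y))"
        unfolding integral_mult_right
          integral_diff[OF integrable_on_cell[OF int[OF x(1)] c n0(1)] integrable_on_cell[OF int[OF x(2)] c n0(1)]]
        by (rule right_diff_distrib[symmetric])
    qed
    also have "cmod \<dots> \<le> 1 * integral unit_cube (\<lambda>y. cmod (green k x y * p y - green k x' y * p y))"
      by (rule norm_sum_cells_le[OF d n0(1)])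
         (use v1 in \<open>auto intro!: integrable_on_mult_right integrable_on_cell[OF di _ n0(1)]\<close>)
    also have "\<dots> \<le> \<Lambda> * norm (x - x')"
      unfolding \<Lambda>_def using potential_lipschitz(1)[OF pm pB x k] by simp
    finally show ?thesis by (simp add: norm_minus_commute)
  qed
  have vW: "cmod (v i x - W i x) \<le> (1 + C) / real (Suc i)" if x: "x \<in> cube_centers (n i)" for i x
  proof -
    have "v i x - W i x = (v i x + discrete_potential k (n i) (\<lambda>c. p c * v i c) x)
      - (discrete_potential k (n i) (\<lambda>c. p c * v i c) x
            - (\<Sum>c\<in>cube_centers (n i). v i c * integral (cell (n i) c) (\<lambda>y. green k x y * p y)))"
      by (simp add: W_def)
    also have "cmod \<dots> \<le> 1 / real (Suc i) + C / real (n i)"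
      by (rule order_trans[OF norm_triangle_ineq4 add_mono[OF v3[OF x] C(2)[OF n0(2) x]]]) (use v1 in auto)
    also have "C / real (n i) \<le> C / real (Suc i)"
      using n[of i] C(1) by (intro divide_left_mono) auto
    finally show ?thesis by (simp add: add_divide_distrib)
  qed
  obtain \<phi> r where \<phi>: "continuous_on unit_cube \<phi>" and r: "strict_mono (r :: nat \<Rightarrow> nat)"
    and lim: "\<And>e. 0 < e \<Longrightarrow> \<exists>N. \<forall>i x. i \<ge> N \<and> x \<in> unit_cube \<longrightarrow> norm (W (r i) x - \<phi> x) < e"
  proof (rule Arzela_Ascoli[of unit_cube W "256 * L"])
    show "compact (unit_cube :: (real^3) set)" by simp
    show "\<And>i x. x \<in> unit_cube \<Longrightarrow> norm (W i x) \<le> 256 * L" by (rule W_bound)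
    fix x :: "real^3" and e :: real assume x: "x \<in> unit_cube" and e: "0 < e"
    show "\<exists>d. 0 < d \<and> (\<forall>i y. y \<in> unit_cube \<and> norm (x - y) < d \<longrightarrow> norm (W i x - W i y) < e)"
    proof (intro exI[of _ "e / (\<Lambda> + 1)"] conjI allI impI)
      show "0 < e / (\<Lambda> + 1)" using e \<Lambda>0 by simp
      fix i y assume y: "y \<in> unit_cube \<and> norm (x - y) < e / (\<Lambda> + 1)"
      then have "norm (W i x - W i y) \<le> \<Lambda> * norm (x - y)" using x by (intro W_lip) auto
      also have "\<dots> \<le> (\<Lambda> + 1) * norm (x - y)" by (intro mult_right_mono) auto
      also have "\<dots> < (\<Lambda> + 1) * (e / (\<Lambda> + 1))" using y \<Lambda>0 by (intro mult_strict_left_mono) auto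
      also have "\<dots> = e" using \<Lambda>0 by simp
      finally show "norm (W i x - W i y) < e" .
    qed
  qed blast
  have ri: "real (Suc i) \<le> real (Suc (r i))" for i
    using seq_suble[OF r, of i] by simp
  define \<delta> where "\<delta> i = (1 + C + \<Lambda>) / real (Suc i)" for i
  have \<delta>: "\<delta> \<longlonglongrightarrow> 0"
    unfolding \<delta>_def[abs_def] using LIMSEQ_Suc[OF lim_const_over_n] by simp
  \<comment> \<open>The limit is close to the step function on each cell: pass from \<open>\<phi>\<close> to \<open>W\<close>, from \<open>y\<close> to the centre, and from \<open>W\<close>
    to \<open>v\<close>.\<close>
  have v_phi: "cmod (\<phi> y - v (r i) c) \<le> e + \<delta> i"
    if e: "\<And>x. x \<in> unit_cube \<Longrightarrow> norm (W (r i) x - \<phi> x) < e" and c: "c \<in> cube_centers (n (r i))" and y: "y \<in> cell (n (r i)) c"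
    for e i c y
  proof -
    have cube: "y \<in> unit_cube" "c \<in> unit_cube"
      using y cell_subset[OF c n0(1)] center_in_cell by auto
    have "cmod (\<phi> y - v (r i) c) \<le> cmod (W (r i) y - \<phi> y) + cmod (W (r i) y - W (r i) c) + cmod (v (r i) c - W (r i) c)"
      using norm_triangle_ineq4[of "W (r i) y - W (r i) c" "W (r i) y - \<phi> y"]
        norm_triangle_ineq4[of "(W (r i) y - W (r i) c) - (W (r i) y - \<phi> y)" "v (r i) c - W (r i) c"]
      by (simp add: algebra_simps)
    also have "\<dots> \<le> e + \<Lambda> * (1 / real (n (r i))) + (1 + C) / real (Suc (r i))"
    proof (intro add_mono)
      show "cmod (W (r i) y - \<phi> y) \<le> e" using e[OF cube(1)] by simp
      show "cmod (v (r i) c - W (r i) c) \<le> (1 + C) / real (Suc (r i))" by (rule vW[OF c])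
      have "norm (y - c) \<le> 1 / real (n (r i))"
        by (rule norm_diff_cell_le[OF y])
      then show "cmod (W (r i) y - W (r i) c) \<le> \<Lambda> * (1 / real (n (r i)))"
        using W_lip[OF cube] \<Lambda>0 by (meson mult_left_mono order_trans)
    qed
    also have "\<dots> \<le> e + \<Lambda> * (1 / real (Suc i)) + (1 + C) / real (Suc i)"
    proof (intro add_mono mult_left_mono divide_left_mono order_refl ri)
      show "real (Suc i) \<le> real (n (r i))" using n[of "r i"] ri[of i] by linarith
    qed (use \<Lambda>0 C n0 in auto)
    also have "\<dots> = e + \<delta> i" by (simp add: \<delta>_def add_divide_distrib)
    finally show ?thesis .
  qed
  have small: "\<exists>i. \<delta> i < e \<and> (\<forall>x\<in>unit_cube. norm (W (r i) x - \<phi> x) < e)" if e: "e > 0" for e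
  proof -
    obtain N where N: "\<And>i x. i \<ge> N \<Longrightarrow> x \<in> unit_cube \<Longrightarrow> norm (W (r i) x - \<phi> x) < e" using lim[OF e] by blast
    have "\<forall>\<^sub>F i in sequentially. \<delta> i < e" using \<delta> e by (rule order_tendstoD)
    then obtain N' where "\<And>i. i \<ge> N' \<Longrightarrow> \<delta> i < e" by (auto simp: eventually_sequentially)
    then show ?thesis using N by (intro exI[of _ "max N N'"]) auto
  qed
  have "\<exists>x\<in>unit_cube. \<phi> x \<noteq> 0"
  proof -
    obtain i where i: "\<delta> i < 1/4" "\<And>x. x \<in> unit_cube \<Longrightarrow> norm (W (r i) x - \<phi> x) < 1/4" using small[of "1/4"] by auto
    obtain c where c: "c \<in> cube_centers (n (r i))" "cmod (v (r i) c) = 1" using v2 by blast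
    have "cmod (\<phi> c - v (r i) c) \<le> 1/4 + \<delta> i" by (rule v_phi[OF i(2) c(1) center_in_cell])
    then have "\<phi> c \<noteq> 0" using c(2) i(1) by auto
    then show ?thesis using centers_subset[OF n0(1) c(1)] by blast
  qed
  moreover have "\<phi> x + integral unit_cube (\<lambda>y. green k x y * p y * \<phi> y) = 0" if x: "x \<in> unit_cube" for x
  proof -
    define Q where "Q = integral unit_cube (\<lambda>y. green k x y * p y * \<phi> y)"
    obtain B where B: "\<And>y. y \<in> unit_cube \<Longrightarrow> cmod (\<phi> y) \<le> B"
      using compact_imp_bounded[OF compact_continuous_image[OF \<phi> compact_cbox]] by (auto simp: bounded_iff)
    have \<phi>m: "(\<lambda>y. p y * \<phi> y) \<in> borel_measurable (lebesgue_on unit_cube)"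
      by (intro borel_measurable_times pm continuous_imp_measurable_on_sets_lebesgue[OF \<phi>]) simp
    have \<phi>i: "(\<lambda>y. green k x y * p y * \<phi> y) integrable_on unit_cube"
      using potential_integrable(1)[OF \<phi>m _ x, of "L * B" k] B pB L0
      by (simp add: absolutely_integrable_on_def mult.assoc norm_mult mult_mono)
    have key: "cmod (\<phi> x + Q) \<le> e * (1 + 2 * (256 * L))" if e: "e > 0" for e
    proof -
      obtain i where i: "\<delta> i < e" "\<And>x. x \<in> unit_cube \<Longrightarrow> norm (W (r i) x - \<phi> x) < e" using small[OF e] by auto
      let ?n = "n (r i)"
      have "Q + W (r i) x = (\<Sum>c\<in>cube_centers ?n. integral (cell ?n c) (\<lambda>y. (\<phi> y - v (r i) c) * (green k x y * p y)))"
      proof -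
        have "Q = (\<Sum>c\<in>cube_centers ?n. integral (cell ?n c) (\<lambda>y. green k x y * p y * \<phi> y))"
          unfolding Q_def by (rule integral_sum_cells[OF \<phi>i n0(1)])
        then have "Q + W (r i) x = (\<Sum>c\<in>cube_centers ?n. integral (cell ?n c) (\<lambda>y. green k x y * p y * \<phi> y)
            - integral (cell ?n c) (\<lambda>y. v (r i) c * (green k x y * p y)))"
          unfolding W_integral sum_subtractf by (simp only: diff_conv_add_uminus)
        also have "\<dots> = (\<Sum>c\<in>cube_centers ?n. integral (cell ?n c) (\<lambda>y. (\<phi> y - v (r i) c) * (green k x y * p y)))"
        proof (rule sum.cong[OF refl])
          fix c assume c: "c \<in> cube_centers ?n"
          have "((\<lambda>y. green k x y * p y * \<phi> y - v (r i) c * (green k x y * p y)) has_integral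
             (integral (cell ?n c) (\<lambda>y. green k x y * p y * \<phi> y) - integral (cell ?n c) (\<lambda>y. v (r i) c * (green k x y * p y)))) (cell ?n c)"
            by (intro has_integral_diff integrable_integral integrable_on_mult_right
                integrable_on_cell[OF \<phi>i c n0(1)] integrable_on_cell[OF int[OF x] c n0(1)])
          then show "integral (cell ?n c) (\<lambda>y. green k x y * p y * \<phi> y)
            - integral (cell ?n c) (\<lambda>y. v (r i) c * (green k x y * p y)) =
            integral (cell ?n c) (\<lambda>y. (\<phi> y - v (r i) c) * (green k x y * p y))"
            by (subst integral_unique[symmetric]) (auto simp: algebra_simps)
        qed
        finally show ?thesis .
      qed
      also have "cmod \<dots> \<le> (2 * e) * integral unit_cube (\<lambda>y. cmod (green k x y * p y))"
      proof (rule norm_sum_cells_le[OF abs[OF _ x] n0(1)])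
        show "cmod (\<phi> y - v (r i) c) \<le> 2 * e" if "c \<in> cube_centers ?n" "y \<in> cell ?n c" for c y
          using v_phi[OF i(2) that] i(1) by linarith
        show "(\<lambda>y. (\<phi> y - v (r i) c) * (green k x y * p y)) integrable_on cell ?n c" if c: "c \<in> cube_centers ?n" for c
        proof -
          have "(\<lambda>y. green k x y * p y * \<phi> y - v (r i) c * (green k x y * p y)) integrable_on cell ?n c"
            by (intro integrable_diff integrable_on_mult_right
                integrable_on_cell[OF \<phi>i c n0(1)] integrable_on_cell[OF int[OF x] c n0(1)])
          then show ?thesis by (simp add: algebra_simps)
        qed
      qed auto
      also have "\<dots> \<le> (2 * e) * (256 * L)"
        using e by (intro mult_left_mono potential_integrable(2)[OF pm pB x]) auto
      finally have "cmod (Q + W (r i) x) \<le> (2 * e) * (256 * L)" .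
      moreover have "cmod (W (r i) x - \<phi> x) \<le> e" using i(2)[OF x] by simp
      moreover have "cmod (\<phi> x + Q) \<le> cmod (Q + W (r i) x) + cmod (W (r i) x - \<phi> x)"
        using norm_triangle_ineq4[of "Q + W (r i) x" "W (r i) x - \<phi> x"] by (simp add: add.commute)
      ultimately have "cmod (\<phi> x + Q) \<le> (2 * e) * (256 * L) + e" by linarith
      then show ?thesis by (simp add: algebra_simps)
    qed
    have "cmod (\<phi> x + Q) \<le> 0 + e" if e: "e > 0" for e
    proof -
      have D: "1 + 2 * (256 * L) > 0" using L0 by simp
      show ?thesis using key[of "e / (1 + 2 * (256 * L))"] D e by simp
    qed
    then have "cmod (\<phi> x + Q) \<le> 0" by (rule field_le_epsilon)
    then show ?thesis by (simp add: Q_def)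
  qed
  ultimately show ?thesis using \<phi> by blast
qed

text \<open>If no constant worked, normalised grid functions with residuals tending to 0 would exist on finer and
  finer grids, and their limit would be a nontrivial solution of the homogeneous equation. The argument gives
  no value for the constant.\<close>

proposition discrete_stability:
  assumes k: "k \<ge> 0" and p: "log_C11 L p"
    and inj: "\<forall>\<phi>. continuous_on unit_cube \<phi> \<longrightarrow>
       (\<forall>x\<in>unit_cube. \<phi> x + integral unit_cube (\<lambda>y. green k x y * p y * \<phi> y) = 0) \<longrightarrow> (\<forall>x\<in>unit_cube. \<phi> x = 0)"
  shows "\<exists>C\<ge>0. \<exists>N. \<forall>n\<ge>N. \<forall>v B. (\<forall>x\<in>cube_centers n. cmod (v x + discrete_potential k n (\<lambda>c. p c * v c) x) \<le> B) \<longrightarrow>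
     (\<forall>x\<in>cube_centers n. cmod (v x) \<le> C * B)"
proof (rule ccontr)
  assume neg: "\<not> ?thesis"
  define R where "R n v x = cmod (v x + discrete_potential k n (\<lambda>c. p c * v c) x)" for n v x
  define Q where "Q i n v \<longleftrightarrow> n \<ge> Suc i \<and> (\<forall>c\<in>cube_centers n. cmod (v c) \<le> 1) \<and> (\<exists>c\<in>cube_centers n. cmod (v c) = 1) \<and>
     (\<forall>x\<in>cube_centers n. R n v x \<le> 1 / real (Suc i))" for i n and v :: "real^3 \<Rightarrow> complex"
  have "\<exists>n v. Q i n v" for i
  proof -
    have "\<not> (\<exists>N. \<forall>n\<ge>N. \<forall>v B. (\<forall>x\<in>cube_centers n. R n v x \<le> B) \<longrightarrow>
        (\<forall>x\<in>cube_centers n. cmod (v x) \<le> real (Suc i) * B))"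
      using neg of_nat_0_le_iff unfolding R_def by blast
    then obtain n v B where n: "n \<ge> Suc i" and B: "\<forall>x\<in>cube_centers n. R n v x \<le> B"
      and "\<not> (\<forall>x\<in>cube_centers n. cmod (v x) \<le> real (Suc i) * B)" by blast
    then obtain x0 where x0: "x0 \<in> cube_centers n" "cmod (v x0) > real (Suc i) * B" by auto
    have B0: "B \<ge> 0" using B x0(1) norm_ge_zero order_trans unfolding R_def by blast
    obtain x1 where x1: "x1 \<in> cube_centers n" "\<And>c. c \<in> cube_centers n \<Longrightarrow> cmod (v c) \<le> cmod (v x1)"
    proof -
      let ?S = "(\<lambda>c. cmod (v c)) ` cube_centers n"
      have "finite ?S" "?S \<noteq> {}" using finite_cube_centers x0(1) by auto
      then have "Max ?S \<in> ?S" "\<And>s. s \<in> ?S \<Longrightarrow> s \<le> Max ?S" by auto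
      then show ?thesis using that by force
    qed
    define V where "V = cmod (v x1)"
    have VB: "V > real (Suc i) * B" using x0 x1(2)[OF x0(1)] by (simp add: V_def)
    then have V: "V > 0" using B0 by (meson mult_nonneg_nonneg of_nat_0_le_iff order_le_less_trans)
    define v' where "v' c = v c / of_real V" for c
    have scale: "discrete_potential k n (\<lambda>c. p c * v' c) x = discrete_potential k n (\<lambda>c. p c * v c) x / of_real V" for x
      by (simp add: discrete_potential_def v'_def sum_divide_distrib mult.commute)
    have "R n v' x \<le> 1 / real (Suc i)" if "x \<in> cube_centers n" for x
    proof -
      have "v' x + discrete_potential k n (\<lambda>c. p c * v' c) x = (v x + discrete_potential k n (\<lambda>c. p c * v c) x) / of_real V"
        unfolding scale by (simp add: v'_def add_divide_distrib)
      then have "R n v' x = cmod (v x + discrete_potential k n (\<lambda>c. p c * v c) x) / V"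
        using V by (simp add: R_def norm_divide)
      also have "\<dots> \<le> B / V" using B that V by (intro divide_right_mono) (auto simp: R_def)
      also have "\<dots> \<le> 1 / real (Suc i)" using VB V by (simp add: field_simps)
      finally show ?thesis .
    qed
    moreover have "cmod (v' c) \<le> 1" if "c \<in> cube_centers n" for c
      using x1(2)[OF that] V unfolding v'_def norm_divide by (simp add: V_def)
    moreover have "cmod (v' x1) = 1" using V unfolding v'_def norm_divide by (simp add: V_def)
    ultimately have "Q i n v'" unfolding Q_def using n x1(1) by blast
    then show ?thesis by blast
  qed
  then obtain n v where Q: "\<And>i. Q i (n i) (v i)" by metis
  obtain \<phi> where "continuous_on unit_cube \<phi>" "\<exists>x\<in>unit_cube. \<phi> x \<noteq> 0"
    "\<forall>x\<in>unit_cube. \<phi> x + integral unit_cube (\<lambda>y. green k x y * p y * \<phi> y) = 0"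
    using approximate_null_vectors_limit[OF k p, of n v] Q unfolding Q_def R_def by blast
  then show False using inj by blast
qed

section \<open>The error estimate\<close>

text \<open>Adding a solution of the homogeneous equation to \<open>u\<close> produces another solution of the integral
  equation.\<close>

lemma homogeneous_solution_trivial:
  assumes k: "k \<ge> 0" and p: "log_C11 L p" and sol: "solves_integral_eq k \<alpha> p u"
    and unique: "\<forall>v. solves_integral_eq k \<alpha> p v \<longrightarrow> (\<forall>y\<in>unit_cube. v y = u y)"
    and \<phi>: "continuous_on unit_cube \<phi>"
    and hom: "\<forall>x\<in>unit_cube. \<phi> x + integral unit_cube (\<lambda>y. green k x y * p y * \<phi> y) = 0"
    and x: "x \<in> unit_cube"
  shows "\<phi> x = 0"
proof -
  obtain B where B: "\<And>y. y \<in> unit_cube \<Longrightarrow> cmod (\<phi> y) \<le> B"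
    using compact_imp_bounded[OF compact_continuous_image[OF \<phi> compact_cbox]] by (auto simp: bounded_iff)
  have pB: "cmod (p y) \<le> L" if "y \<in> unit_cube" for y using p that by (auto simp: log_C11_def)
  have m: "(\<lambda>y. p y * \<phi> y) \<in> borel_measurable (lebesgue_on unit_cube)"
    by (intro borel_measurable_times continuous_imp_measurable_on_sets_lebesgue \<phi> log_C11_continuous[OF p]) simp_all
  have pphi: "cmod (p y * \<phi> y) \<le> L * B" if "y \<in> unit_cube" for y
    unfolding norm_mult using pB[OF that] B[OF that] log_C11_nonneg[OF p] by (intro mult_mono) auto
  have abs: "(\<lambda>y. green k z y * p y * \<phi> y) absolutely_integrable_on unit_cube" if "z \<in> unit_cube" for z
    using potential_integrable(1)[OF m pphi that, of k] by (simp add: mult.assoc)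
  have "solves_integral_eq k \<alpha> p (\<lambda>y. u y + \<phi> y)"
    unfolding solves_integral_eq_def
  proof (intro ballI conjI)
    fix z :: "real^3" assume z: "z \<in> unit_cube"
    have U: "(\<lambda>y. green k z y * p y * u y) absolutely_integrable_on unit_cube"
      and Ueq: "u z + integral unit_cube (\<lambda>y. green k z y * p y * u y) = plane_wave k \<alpha> z"
      using sol z by (auto simp: solves_integral_eq_def)
    show "(\<lambda>y. green k z y * p y * (u y + \<phi> y)) absolutely_integrable_on unit_cube"
      unfolding distrib_left by (intro set_integral_add U abs z)
    have "integral unit_cube (\<lambda>y. green k z y * p y * (u y + \<phi> y))
       = integral unit_cube (\<lambda>y. green k z y * p y * u y) + integral unit_cube (\<lambda>y. green k z y * p y * \<phi> y)"
      unfolding distrib_left using U abs[OF z] by (intro integral_add) (auto simp: absolutely_integrable_on_def)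
    then have "u z + \<phi> z + integral unit_cube (\<lambda>y. green k z y * p y * (u y + \<phi> y))
       = (u z + integral unit_cube (\<lambda>y. green k z y * p y * u y)) + (\<phi> z + integral unit_cube (\<lambda>y. green k z y * p y * \<phi> y))"
      by (simp only: ac_simps)
    also have "\<dots> = plane_wave k \<alpha> z"
      unfolding Ueq using hom z by simp
    finally show "u z + \<phi> z + integral unit_cube (\<lambda>y. green k z y * p y * (u y + \<phi> y)) = plane_wave k \<alpha> z" .
  qed
  then have "u x + \<phi> x = u x" using unique x by blast
  then show ?thesis by simp
qed

text \<open>The factor \<open>\<rho>\<close> stands for \<open>\<gamma>\<^sup>3 M a\<^bsup>2 - \<kappa>\<^esup>\<close>. With \<open>T\<close> the discrete potential and \<open>e = u - V\<close>, the residual is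
  \<open>e + T e = (T u - J) - (1 - \<rho>) (T u - T e)\<close>, where \<open>J\<close> is the exact potential. Stability bounds \<open>e\<close> by the
  residual; the term with \<open>T e\<close> is absorbed into the left-hand side when \<open>\<rho>\<close> is within \<open>\<eta>\<close> of 1.\<close>

proposition discrete_error_bound:
  assumes k: "k > 0" and \<alpha>: "norm \<alpha> = 1" and p: "log_C11 L p" and sol: "solves_integral_eq k \<alpha> p u"
    and unique: "\<forall>v. solves_integral_eq k \<alpha> p v \<longrightarrow> (\<forall>y\<in>unit_cube. v y = u y)"
  shows "\<exists>K\<ge>0. \<exists>N. \<exists>\<eta>>0. \<forall>n\<ge>N. \<forall>\<rho> V. \<bar>1 - \<rho>\<bar> \<le> \<eta> \<longrightarrow>
     (\<forall>x\<in>cube_centers n. V x = plane_wave k \<alpha> x - of_real \<rho> * discrete_potential k n (\<lambda>c. p c * V c) x) \<longrightarrow>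
     (\<forall>x\<in>cube_centers n. cmod (u x - V x) \<le> K * ((1 + ln (real n)) / real n ^ 2 + \<bar>1 - \<rho>\<bar>))"
proof -
  have k0: "k \<ge> 0" using k by simp
  obtain Lu where Lu: "log_C11 Lu u" using solution_log_C11[OF k \<alpha> sol p] by blast
  define Lw where "Lw = 4 * L * Lu"
  have w: "log_C11 Lw (\<lambda>y. p y * u y)" unfolding Lw_def by (rule log_C11_mult[OF p Lu])
  have L0: "L \<ge> 0" "Lw \<ge> 0" using log_C11_nonneg p w by auto
  obtain C1 where C1: "C1 \<ge> 0" "\<And>n x. n \<ge> 2 \<Longrightarrow> x \<in> cube_centers n \<Longrightarrow>
     cmod (discrete_potential k n (\<lambda>y. p y * u y) x - integral unit_cube (\<lambda>y. green k x y * (p y * u y)))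
       \<le> C1 * (1 + ln (real n)) / real n ^ 2"
    using discrete_potential_consistent[OF k0 w] by blast
  have inj: "\<forall>\<phi>. continuous_on unit_cube \<phi> \<longrightarrow>
      (\<forall>x\<in>unit_cube. \<phi> x + integral unit_cube (\<lambda>y. green k x y * p y * \<phi> y) = 0) \<longrightarrow> (\<forall>x\<in>unit_cube. \<phi> x = 0)"
    using homogeneous_solution_trivial[OF k0 p sol unique] by blast
  obtain C2 N where C2: "C2 \<ge> 0" "\<And>n v B x. n \<ge> N \<Longrightarrow>
      (\<forall>x\<in>cube_centers n. cmod (v x + discrete_potential k n (\<lambda>c. p c * v c) x) \<le> B) \<Longrightarrow>
      x \<in> cube_centers n \<Longrightarrow> cmod (v x) \<le> C2 * B"
    using discrete_stability[OF k0 p inj] by blast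
  \<comment> \<open>\<open>\<eta>\<close> is chosen such that \<open>T e\<close>, of norm at most \<open>1024 L\<close> times that of \<open>e\<close>, returns at most half of \<open>e\<close>
    after multiplication by \<open>|1 - \<rho>|\<close> and the stability constant; the summand 1 excludes a zero denominator.\<close>
  define \<eta> where "\<eta> = 1 / (2 * (C2 * (1024 * L) + 1))"
  have den: "C2 * (1024 * L) + 1 > 0" using C2(1) L0 by (simp add: add_nonneg_pos)
  then have \<eta>: "\<eta> > 0" by (simp add: \<eta>_def)
  define K where "K = 2 * C2 * (C1 + 1024 * Lw)"
  have K0: "K \<ge> 0" using C1(1) C2(1) L0 by (simp add: K_def)
  have "cmod (u x - V x) \<le> K * ((1 + ln (real n)) / real n ^ 2 + \<bar>1 - \<rho>\<bar>)"
    if n: "n \<ge> max N 2" and \<rho>: "\<bar>1 - \<rho>\<bar> \<le> \<eta>"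
      and V: "\<forall>x\<in>cube_centers n. V x = plane_wave k \<alpha> x - of_real \<rho> * discrete_potential k n (\<lambda>c. p c * V c) x"
      and x: "x \<in> cube_centers n" for n \<rho> V x
  proof -
    have n0: "n \<ge> N" "n \<ge> 2" "n > 0" "0 \<le> ln (real n)" using n by auto
    define e where "e c = u c - V c" for c
    define T where "T w y = discrete_potential k n (\<lambda>c. p c * w c) y" for w y
    define s where "s = \<bar>1 - \<rho>\<bar>"
    define E where "E = Max ((\<lambda>c. cmod (e c)) ` cube_centers n)"
    have fin: "finite ((\<lambda>c. cmod (e c)) ` cube_centers n)" by (intro finite_imageI finite_cube_centers)
    have E: "cmod (e c) \<le> E" if "c \<in> cube_centers n" for c
      unfolding E_def using that fin by (intro Max_ge) auto
    have E0: "E \<ge> 0" using E[OF x] norm_ge_zero order_trans by blast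
    have Te: "cmod (T e c) \<le> 1024 * (L * E)" if "c \<in> cube_centers n" for c
      unfolding T_def
    proof (rule norm_discrete_potential_le[OF _ that n0(3)])
      fix c assume c: "c \<in> cube_centers n"
      have "cmod (p c) \<le> L" using p centers_subset[OF n0(3) c] by (auto simp: log_C11_def)
      then show "cmod (p c * e c) \<le> L * E" unfolding norm_mult using E[OF c] L0 by (intro mult_mono) auto
    qed
    have Tu: "cmod (T u c) \<le> 1024 * Lw" if "c \<in> cube_centers n" for c
      unfolding T_def
      by (rule norm_discrete_potential_le[OF _ that n0(3)])
         (use w centers_subset[OF n0(3)] in \<open>auto simp: log_C11_def\<close>)
    define b where "b = C1 * (1 + ln (real n)) / real n ^ 2"
    have residual: "cmod (e c + T e c) \<le> b + s * (1024 * Lw + 1024 * (L * E))" if c: "c \<in> cube_centers n" for c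
    proof -
      define J where "J = integral unit_cube (\<lambda>y. green k c y * (p y * u y))"
      have "u c + J = plane_wave k \<alpha> c"
        using sol centers_subset[OF n0(3) c] by (simp add: solves_integral_eq_def J_def mult.assoc)
      then have uc: "u c = plane_wave k \<alpha> c - J" by (simp add: eq_diff_eq)
      have Vc: "V c = plane_wave k \<alpha> c - of_real \<rho> * T V c" using V c by (simp add: T_def)
      have TV: "T V c = T u c - T e c"
        by (simp add: T_def e_def discrete_potential_def right_diff_distrib diff_divide_distrib sum_subtractf)
      have "e c = (plane_wave k \<alpha> c - J) - (plane_wave k \<alpha> c - of_real \<rho> * (T u c - T e c))"
        unfolding TV[symmetric] uc[symmetric] Vc[symmetric] by (rule e_def)
      then have "e c + T e c = (T u c - J) - of_real (1 - \<rho>) * (T u c - T e c)"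
        by (simp add: algebra_simps)
      also have "cmod \<dots> \<le> cmod (T u c - J) + s * cmod (T u c - T e c)"
        by (rule order_trans[OF norm_triangle_ineq4]) (simp add: norm_mult s_def del: of_real_diff)
      also have "\<dots> \<le> b + s * (1024 * Lw + 1024 * (L * E))"
      proof (intro add_mono mult_left_mono)
        show "cmod (T u c - J) \<le> b" unfolding T_def J_def b_def by (rule C1(2)[OF n0(2) c])
        show "cmod (T u c - T e c) \<le> 1024 * Lw + 1024 * (L * E)"
          using Tu[OF c] Te[OF c] by (intro order_trans[OF norm_triangle_ineq4] add_mono)
      qed (simp add: s_def)
      finally show ?thesis .
    qed
    have bound: "cmod (e c) \<le> C2 * (b + s * (1024 * Lw + 1024 * (L * E)))" if "c \<in> cube_centers n" for c
      using residual by (intro C2(2)[OF n0(1) _ that]) (simp add: T_def)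
    have "E \<in> (\<lambda>c. cmod (e c)) ` cube_centers n"
      unfolding E_def using fin x by (intro Max_in) auto
    then have "E \<le> C2 * (b + s * (1024 * Lw + 1024 * (L * E)))" using bound by auto
    also have "\<dots> = C2 * (b + s * (1024 * Lw)) + s * (C2 * (1024 * L)) * E"
      by (simp add: algebra_simps)
    also have "s * (C2 * (1024 * L)) * E \<le> 1 / 2 * E"
    proof (intro mult_right_mono E0)
      have "s * (C2 * (1024 * L)) \<le> \<eta> * (C2 * (1024 * L) + 1)"
        using \<rho> \<eta> C2(1) L0 by (intro mult_mono) (auto simp: s_def)
      also have "\<dots> = 1 / 2" using den by (simp add: \<eta>_def)
      finally show "s * (C2 * (1024 * L)) \<le> 1 / 2" .
    qed
    finally have "E \<le> 2 * (C2 * (b + s * (1024 * Lw)))" by simp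
    also have "\<dots> \<le> K * ((1 + ln (real n)) / real n ^ 2 + s)"
    proof -
      define q where "q = (1 + ln (real n)) / real n ^ 2"
      have q: "q \<ge> 0" "b = C1 * q" "s \<ge> 0" using n0 by (auto simp: q_def b_def s_def)
      have "b + s * (1024 * Lw) \<le> (C1 + 1024 * Lw) * (q + s)"
        using mult_nonneg_nonneg[OF C1(1) q(3)] mult_nonneg_nonneg[OF L0(2) q(1)] unfolding q(2) by (simp add: algebra_simps)
      then have "2 * C2 * (b + s * (1024 * Lw)) \<le> 2 * C2 * ((C1 + 1024 * Lw) * (q + s))"
        using C2(1) by (intro mult_left_mono) auto
      then show ?thesis by (simp add: K_def q_def mult.assoc)
    qed
    finally show ?thesis using E[OF x] by (simp add: e_def s_def)
  qed
  then show ?thesis using K0 \<eta> by blast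
qed

text \<open>Multiplying the equation for \<open>a\<close> by \<open>n\<close> and cubing shows that the expression equals \<open>(1 - 2 n a)\<^sup>3\<close>. The same equation
  gives \<open>\<gamma> n a\<^bsup>(2 - \<kappa>) / 3\<^esup> \<le> 1\<close>, hence \<open>n a \<le> a\<^bsup>(1 + \<kappa>) / 3\<^esup> / \<gamma>\<close>, which tends to 0 with \<open>a\<close>.\<close>

lemma density_factor_tendsto_1:
  fixes a :: "nat \<Rightarrow> real" and n :: "nat \<Rightarrow> nat"
  assumes "\<gamma> > 0" "0 < \<kappa>"
    and n: "filterlim n at_top sequentially"
    and a: "\<And>m. m \<ge> 1 \<Longrightarrow> 0 < a m \<and> a m < 1 / real (n m)"
    and eq: "\<And>m. m \<ge> 1 \<Longrightarrow> 1 / real (n m) - 2 * a m = \<gamma> * a m powr ((2 - \<kappa>) / 3)"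
  shows "(\<lambda>m. \<gamma> ^ 3 * real (n m) ^ 3 * a m powr (2 - \<kappa>)) \<longlonglongrightarrow> 1"
proof -
  have n_real: "filterlim (\<lambda>m. real (n m)) at_top sequentially"
    by (rule filterlim_compose[OF filterlim_real_sequentially n])
  then have inv: "(\<lambda>m. 1 / real (n m)) \<longlonglongrightarrow> 0"
    by (intro tendsto_divide_0[OF tendsto_const] filterlim_at_top_imp_at_infinity)
  have npos: "n m > 0" if "m \<ge> 1" for m
    using a[OF that] by (cases "n m = 0") auto
  have ev1: "\<forall>\<^sub>F m in sequentially. m \<ge> (1::nat)" by (rule eventually_ge_at_top)
  have a0: "a \<longlonglongrightarrow> 0"
    by (rule tendsto_sandwich[OF _ _ tendsto_const inv])
       (use ev1 in eventually_elim, use a in force)+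
  have "(\<lambda>m. a m powr ((1 + \<kappa>) / 3)) \<longlonglongrightarrow> 0"
  proof (rule tendsto_zero_powrI[OF a0 tendsto_const])
    show "\<forall>\<^sub>F m in sequentially. 0 \<le> a m"
      using ev1 by eventually_elim (use a in force)
  qed (use assms(2) in simp)
  then have powr0: "(\<lambda>m. a m powr ((1 + \<kappa>) / 3) / \<gamma>) \<longlonglongrightarrow> 0"
    by (rule tendsto_divide_zero)
  have na: "(\<lambda>m. real (n m) * a m) \<longlonglongrightarrow> 0"
  proof (rule tendsto_sandwich[OF _ _ tendsto_const powr0])
    show "\<forall>\<^sub>F m in sequentially. 0 \<le> real (n m) * a m"
      using ev1 by eventually_elim (use a in \<open>simp add: less_imp_le\<close>)
    show "\<forall>\<^sub>F m in sequentially. real (n m) * a m \<le> a m powr ((1 + \<kappa>) / 3) / \<gamma>"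
      using ev1
    proof eventually_elim
      case (elim m)
      have am: "a m > 0" using a[OF elim] by simp
      have np: "real (n m) > 0" using npos[OF elim] by simp
      have "a m = a m powr ((2 - \<kappa>) / 3) * a m powr ((1 + \<kappa>) / 3)"
        using am by (simp add: add_divide_distrib[symmetric] flip: powr_add)
      moreover have "\<gamma> * a m powr ((2 - \<kappa>) / 3) \<le> 1 / real (n m)" using eq[OF elim] am by linarith
      then have "real (n m) * (\<gamma> * a m powr ((2 - \<kappa>) / 3)) \<le> 1"
        using np by (simp add: field_simps)
      then have "real (n m) * (\<gamma> * a m powr ((2 - \<kappa>) / 3)) * a m powr ((1 + \<kappa>) / 3) \<le> 1 * a m powr ((1 + \<kappa>) / 3)"
        by (rule mult_right_mono) simp
      ultimately have "\<gamma> * (real (n m) * a m) \<le> a m powr ((1 + \<kappa>) / 3)"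
        by (simp add: mult_ac)
      then show ?case using assms(1) by (simp add: field_simps)
    qed
  qed
  have "(\<lambda>m. (1 - 2 * (real (n m) * a m)) ^ 3) \<longlonglongrightarrow> (1 - 2 * 0) ^ 3"
    by (intro tendsto_intros na)
  moreover have "\<forall>\<^sub>F m in sequentially. (1 - 2 * (real (n m) * a m)) ^ 3 = \<gamma> ^ 3 * real (n m) ^ 3 * a m powr (2 - \<kappa>)"
    using ev1
  proof eventually_elim
    case (elim m)
    have am: "a m > 0" using a[OF elim] by simp
    have np: "real (n m) > 0" using npos[OF elim] by simp
    have "a m powr (2 - \<kappa>) = (a m powr ((2 - \<kappa>) / 3)) ^ 3"
    proof -
      have e: "real 3 * ((2 - \<kappa>) / 3) = 2 - \<kappa>" by (simp add: field_simps)
      have "(a m powr ((2 - \<kappa>) / 3)) ^ 3 = a m powr (real 3 * ((2 - \<kappa>) / 3))"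
        by (rule powr_power) (use am in simp)
      then show ?thesis unfolding e by simp
    qed
    then have "\<gamma> ^ 3 * real (n m) ^ 3 * a m powr (2 - \<kappa>) = (real (n m) * (\<gamma> * a m powr ((2 - \<kappa>) / 3))) ^ 3"
      by (simp add: power_mult_distrib)
    also have "\<dots> = (1 - 2 * (real (n m) * a m)) ^ 3"
      unfolding eq[OF elim, symmetric] using np by (simp add: right_diff_distrib mult_ac)
    finally show ?case by simp
  qed
  ultimately show ?thesis by (simp add: tendsto_cong)
qed

text \<open>Consistency and stability are formulated for functions on the set of centres. The enumeration \<open>x\<close> carries the
  indexed system over to such functions, and the coefficients \<open>4 \<pi> h a\<^bsup>2 - \<kappa>\<^esup>\<close> become \<open>\<rho> p / n\<^sup>3\<close>.\<close>

lemma linear_system_discrete_potential: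
  assumes sys: "solves_linear_system k \<alpha> h \<kappa> a M x v" and M: "M = n ^ 3" and n: "n > 0"
    and x: "bij_betw x {1..M} (cube_centers n)"
    and h: "\<forall>c\<in>cube_centers n. p c = 4 * of_real pi * h c / of_real (\<gamma> ^ 3)" and \<gamma>: "\<gamma> > 0"
  defines "\<rho> \<equiv> \<gamma> ^ 3 * real n ^ 3 * a powr (2 - \<kappa>)"
  defines "V \<equiv> \<lambda>c. v (the_inv_into {1..M} x c)"
  shows "c \<in> cube_centers n \<Longrightarrow> V c = plane_wave k \<alpha> c - of_real \<rho> * discrete_potential k n (\<lambda>c. p c * V c) c"
    and "l \<in> {1..M} \<Longrightarrow> V (x l) = v l"
proof -
  have inj: "inj_on x {1..M}" using x by (simp add: bij_betw_def)
  show Vx: "V (x l) = v l" if "l \<in> {1..M}" for l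
    unfolding V_def using the_inv_into_f_f[OF inj that] by simp
  show "V c = plane_wave k \<alpha> c - of_real \<rho> * discrete_potential k n (\<lambda>c. p c * V c) c" if c: "c \<in> cube_centers n"
  proof -
    obtain l where l: "l \<in> {1..M}" "c = x l" using c bij_betw_imp_surj_on[OF x] by blast
    have bij: "bij_betw x ({1..M} - {l}) (cube_centers n - {c})"
      by (rule bij_betw_DiffI[OF x]) (use l c in simp_all)
    have "4 * of_real pi * (\<Sum>j\<in>{1..M} - {l}. green k (x l) (x j) * h (x j) * of_real (a powr (2 - \<kappa>)) * v j)
       = (\<Sum>j\<in>{1..M} - {l}. of_real \<rho> * (green k c (x j) * (p (x j) * V (x j)) / of_real (real n ^ 3)))"
      unfolding sum_distrib_left
    proof (rule sum.cong[OF refl])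
      fix j assume j: "j \<in> {1..M} - {l}"
      then have "x j \<in> cube_centers n" using x by (auto simp: bij_betw_def)
      then show "4 * of_real pi * (green k (x l) (x j) * h (x j) * of_real (a powr (2 - \<kappa>)) * v j)
        = of_real \<rho> * (green k c (x j) * (p (x j) * V (x j)) / of_real (real n ^ 3))"
        using j \<gamma> n by (simp add: h Vx l(2) \<rho>_def)
    qed
    also have "\<dots> = (\<Sum>c'\<in>cube_centers n - {c}. of_real \<rho> * (green k c c' * (p c' * V c') / of_real (real n ^ 3)))"
      by (rule sum.reindex_bij_betw[OF bij])
    also have "\<dots> = of_real \<rho> * discrete_potential k n (\<lambda>c. p c * V c) c"
      unfolding discrete_potential_def by (rule sum_distrib_left[symmetric])
    finally have sum_eq: "4 * of_real pi * (\<Sum>j\<in>{1..M} - {l}. green k (x l) (x j) * h (x j) * of_real (a powr (2 - \<kappa>)) * v j)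
       = of_real \<rho> * discrete_potential k n (\<lambda>c. p c * V c) c" .
    have "V c = v l" using Vx[OF l(1)] by (simp only: l(2))
    also have "v l = plane_wave k \<alpha> (x l) - 4 * of_real pi *
        (\<Sum>j\<in>{1..M} - {l}. green k (x l) (x j) * h (x j) * of_real (a powr (2 - \<kappa>)) * v j)"
      using sys l(1) unfolding solves_linear_system_def by (rule bspec)
    also have "\<dots> = plane_wave k \<alpha> c - of_real \<rho> * discrete_potential k n (\<lambda>c. p c * V c) c"
      unfolding sum_eq by (simp only: l(2))
    finally show ?thesis .
  qed
qed

theorem theorem3p4:
  fixes k \<gamma> \<kappa> :: real and P :: nat and \<alpha> :: "real^3"
    and N :: "real^3 \<Rightarrow> real" and h p u :: "real^3 \<Rightarrow> complex"
    and a :: "nat \<Rightarrow> real" and x :: "nat \<Rightarrow> nat \<Rightarrow> real^3" and ue :: "nat \<Rightarrow> nat \<Rightarrow> complex"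
  assumes "k > 0" and "\<gamma> > 0" and "0 < \<kappa>" and "\<kappa> < 1" and "P > 0" and "norm \<alpha> = 1"
    and N: "\<And>y. y \<in> unit_cube \<Longrightarrow> N y = 1 / \<gamma> ^ 3"
    and Im_h: "\<And>y. y \<in> unit_cube \<Longrightarrow> Im (h y) \<le> 0"
    and p: "\<And>y. y \<in> unit_cube \<Longrightarrow> p y = 4 * of_real pi * h y * of_real (N y)"
    and p_C2: "C2_on unit_cube p"
    and u_solution: "solves_integral_eq k \<alpha> p u"
    and u_unique: "\<And>v y. solves_integral_eq k \<alpha> p v \<Longrightarrow> y \<in> unit_cube \<Longrightarrow> v y = u y"
    and centers: "\<And>m. m \<ge> 1 \<Longrightarrow> bij_betw (x m) {1..(m * P) ^ 3} (cube_centers (m * P))"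
    and a_range: "\<And>m. m \<ge> 1 \<Longrightarrow> 0 < a m \<and> a m < 1 / real (m * P)"
    and a_eq: "\<And>m. m \<ge> 1 \<Longrightarrow> 1 / real (m * P) - 2 * a m = \<gamma> * a m powr ((2 - \<kappa>) / 3)"
    and ue_solution: "eventually
          (\<lambda>m. solves_linear_system k \<alpha> h \<kappa> (a m) ((m * P) ^ 3) (x m) (ue m)) sequentially"
  shows "(\<lambda>m. vec_max_norm ((m * P) ^ 3) (\<lambda>j. u (x m j) - ue m j)) \<in>
         O[sequentially](\<lambda>m. ln (real ((m * P) ^ 3)) / real ((m * P) ^ 3) powr (2 / 3) +
              \<bar>1 - \<gamma> ^ 3 * real ((m * P) ^ 3) * a m powr (2 - \<kappa>)\<bar>)"
proof -
  obtain L where L: "log_C11 L p" using C2_on_imp_log_C11[OF p_C2] by blast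
  have unique: "\<forall>v. solves_integral_eq k \<alpha> p v \<longrightarrow> (\<forall>y\<in>unit_cube. v y = u y)"
    using u_unique by blast
  obtain K N0 \<eta> where K: "K \<ge> 0" and \<eta>: "\<eta> > 0"
    and bound: "\<forall>n\<ge>N0. \<forall>\<rho> V. \<bar>1 - \<rho>\<bar> \<le> \<eta> \<longrightarrow>
     (\<forall>x\<in>cube_centers n. V x = plane_wave k \<alpha> x - of_real \<rho> * discrete_potential k n (\<lambda>c. p c * V c) x) \<longrightarrow>
     (\<forall>x\<in>cube_centers n. cmod (u x - V x) \<le> K * ((1 + ln (real n)) / real n ^ 2 + \<bar>1 - \<rho>\<bar>))"
    using discrete_error_bound[OF \<open>k > 0\<close> \<open>norm \<alpha> = 1\<close> L u_solution unique] by blast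
  define n where "n m = m * P" for m
  define \<rho> where "\<rho> m = \<gamma> ^ 3 * real (n m) ^ 3 * a m powr (2 - \<kappa>)" for m
  have n_top: "filterlim n at_top sequentially"
    unfolding filterlim_at_top n_def
  proof
    fix Z
    show "\<forall>\<^sub>F m in sequentially. Z \<le> m * P"
      using eventually_ge_at_top[of Z]
    proof eventually_elim
      case (elim m)
      also have "m \<le> m * P" using \<open>P > 0\<close> by simp
      finally show ?case .
    qed
  qed
  have "\<rho> \<longlonglongrightarrow> 1"
    unfolding \<rho>_def[abs_def]
    by (rule density_factor_tendsto_1[OF \<open>\<gamma> > 0\<close> \<open>0 < \<kappa>\<close> n_top]) (use a_range a_eq in \<open>auto simp: n_def\<close>)
  then have "\<forall>\<^sub>F m in sequentially. dist (\<rho> m) 1 < \<eta>" using \<eta> by (rule tendstoD)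
  \<comment> \<open>From \<open>n = 3\<close> on, \<open>1 \<le> ln n\<close>, so that \<open>1 + ln n \<le> 3 ln n = ln M\<close>.\<close>
  moreover have "\<forall>\<^sub>F m in sequentially. max N0 3 \<le> n m" using n_top unfolding filterlim_at_top by blast
  moreover have "\<forall>\<^sub>F m in sequentially. m \<ge> (1::nat)" by (rule eventually_ge_at_top)
  ultimately have "\<forall>\<^sub>F m in sequentially. norm (vec_max_norm ((m * P) ^ 3) (\<lambda>j. u (x m j) - ue m j))
     \<le> K * norm (ln (real ((m * P) ^ 3)) / real ((m * P) ^ 3) powr (2 / 3) +
              \<bar>1 - \<gamma> ^ 3 * real ((m * P) ^ 3) * a m powr (2 - \<kappa>)\<bar>)"
    using ue_solution
  proof eventually_elim
    case (elim m)
    have n3: "n m \<ge> 3" "n m \<ge> N0" "n m > 0" using elim(2) by auto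
    have bij: "bij_betw (x m) {1..n m ^ 3} (cube_centers (n m))" using centers[OF elim(3)] by (simp add: n_def)
    have h: "\<forall>c\<in>cube_centers (n m). p c = 4 * of_real pi * h c / of_real (\<gamma> ^ 3)"
      using p N centers_subset[OF n3(3)] by simp
    define V where "V c = ue m (the_inv_into {1..n m ^ 3} (x m) c)" for c
    note sys = linear_system_discrete_potential[OF elim(4)[folded n_def] refl n3(3) bij h \<open>\<gamma> > 0\<close>, folded \<rho>_def V_def]
    define R where "R = ln (real (n m ^ 3)) / real (n m ^ 3) powr (2 / 3) + \<bar>1 - \<rho> m\<bar>"
    have "(1 + ln (real (n m))) / real (n m) ^ 2 \<le> ln (real (n m ^ 3)) / real (n m ^ 3) powr (2 / 3)"
    proof -
      have "3 \<le> real (n m)" using n3(1) by simp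
      then have "exp 1 \<le> real (n m)" using exp_le by linarith
      then have "1 \<le> ln (real (n m))" using n3 by (subst ln_ge_iff) auto
      then have "1 + ln (real (n m)) \<le> ln (real (n m ^ 3))" using n3 by (simp add: ln_realpow)
      moreover have "real (n m ^ 3) powr (2 / 3) = real (n m) ^ 2"
      proof -
        have "real (n m ^ 3) = real (n m) powr 3" using n3 by simp
        then have "real (n m ^ 3) powr (2 / 3) = real (n m) powr (3 * (2 / 3))" by (simp only: powr_powr)
        then show ?thesis using n3 by simp
      qed
      ultimately show ?thesis by (simp add: divide_right_mono)
    qed
    then have RK: "K * ((1 + ln (real (n m))) / real (n m) ^ 2 + \<bar>1 - \<rho> m\<bar>) \<le> K * R"
      unfolding R_def using K by (intro mult_left_mono add_right_mono) auto
    have each: "cmod (u (x m j) - ue m j) \<le> K * R" if j: "j \<in> {1..n m ^ 3}" for j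
    proof -
      have c: "x m j \<in> cube_centers (n m)" using bij j by (auto simp: bij_betw_def)
      have "\<bar>1 - \<rho> m\<bar> \<le> \<eta>" using elim(1) by (simp add: dist_real_def)
      then have "cmod (u (x m j) - V (x m j)) \<le> K * ((1 + ln (real (n m))) / real (n m) ^ 2 + \<bar>1 - \<rho> m\<bar>)"
        using bound sys(1) n3(2) c by blast
      then show ?thesis using RK sys(2)[OF j] by simp
    qed
    have ne: "{1..n m ^ 3} \<noteq> {}" using n3(3) by simp
    define v where "v = vec_max_norm (n m ^ 3) (\<lambda>j. u (x m j) - ue m j)"
    have "v \<in> (\<lambda>j. cmod (u (x m j) - ue m j)) ` {1..n m ^ 3}"
      unfolding v_def vec_max_norm_def using ne by (intro Max_in) auto
    then have "0 \<le> v" "v \<le> K * R" using each by auto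
    moreover have "K * R \<le> K * norm R" using K by (intro mult_left_mono) auto
    ultimately have "norm v \<le> K * norm R" by simp
    then show ?case by (simp add: v_def R_def n_def \<rho>_def)
  qed
  then show ?thesis by (rule bigoI)
qed

end
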